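(* Let $k$ be a field of odd characteristic $p$, and let $k(t)$ be the field of rational functions in one variable $t$ over $k$. Let $f\colon Y=\mathbb P^1_{k(t)}\to X=\mathbb P^1_{k(t)}$ be the map of curves over $k(t)$ given in the affine coordinate $y$ on the source by $y\mapsto y^p-y$, let $d$ be its degree, and let $df$ be the section of $\mathcal V=\operatorname{Hom}(f^*T^\vee X,T^\vee Y)$ given by pullback of differentials. Then there is a relative orientation of $\mathcal V$ such that, in $\operatorname{GW}(k(t))$, $$\operatorname{ind}_{\infty}df=(p-1)\cdot h,$$ where $\infty$ is the point $y=\infty$ of $Y$. In particular, the enriched Riemann--Hurwitz formula $$\chi^{\mathbb A^1}(Y)=d\cdot \chi^{\mathbb A^1}(X)-\sum_{\{q\in Y:\ df(q)=0\}}\operatorname{ind}_q df$$ holds in $\operatorname{GW}(k(t))$.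
   Context: Write $L=k(t)$ for the base field. $\operatorname{GW}(L)$ is the Grothendieck--Witt group: the group completion of the semiring (under $\oplus,\otimes$) of isomorphism classes of nondegenerate symmetric $L$-bilinear forms on finite-dimensional $L$-vector spaces. For $a\in L^*$, $\langle a\rangle$ is the class of $L\times L\to L$, $(x,y)\mapsto axy$, and $h=\langle 1\rangle+\langle -1\rangle$. For a smooth proper geometrically connected curve $C$ over $L$ of genus $g(C)$, $\chi^{\mathbb A^1}(C)=(1-g(C))\cdot h\in\operatorname{GW}(L)$. $T$ and $T^\vee$ denote tangent and cotangent bundles. A relative orientation of a line bundle $\mathcal V$ on a smooth curve $Y$ over $L$ is a line bundle $N$ on $Y$ together with an isomorphism $\operatorname{Hom}(TY,\mathcal V)\cong N^{\otimes 2}$. Nisnevich coordinates around a closed point $q\in Y$ are a Zariski open neighborhood $U$ of $q$ and an étale map $\phi\colon U\to\mathbb A^1_L=\operatorname{Spec}L[s]$ inducing an isomorphism of residue fields $L(\phi(q))\to L(q)$; they exist around every closed point. Local index. Let $\sigma$ be a section of a relatively oriented line bundle $\mathcal V$ with an isolated zero at $q$, vanishing to order $n$ there. Choose Nisnevich coordinates $\phi$ around $q$; they trivialize $TY|_U$ by the vector field $\partial$ dual to $d(\phi^*s)$. After shrinking $U$, choose a trivialization of $\mathcal V|_U$, i.e. a generator $v$, compatible with the relative orientation: the homomorphism $TY|_U\to\mathcal V|_U$, $\partial\mapsto v$, corresponds to $\ell\otimes\ell$ for some $\ell\in N(U)$. Then $\sigma$ becomes a function $\sigma_0\in\mathcal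 O_{Y,q}$. With $m_q$ the maximal ideal of $\mathcal O_{Y,q}$, choose $g\in m_q^{N_0}$ with $N_0$ sufficiently large (e.g. $N_0\ge 2n$) such that $\sigma_0+g=\phi^*F$ for some $F\in R:=\mathcal O_{\mathbb A^1_L,\phi(q)}$. Put $Q=R/(F)$, a finite-dimensional $L$-algebra. Choose $a\in R\otimes_L R$ with $F\otimes 1-1\otimes F=a\,(s\otimes 1-1\otimes s)$ and let $\Delta$ be the image of $a$ in $Q\otimes_LQ$. Under the map $Q\otimes_LQ\to\operatorname{Hom}_L(\operatorname{Hom}_L(Q,L),Q)$, $b\otimes c\mapsto(\mu\mapsto\mu(b)c)$, $\Delta$ goes to an isomorphism $\Theta$. Let $\eta=\Theta^{-1}(1)$. Then $\operatorname{ind}_q\sigma\in\operatorname{GW}(L)$ is the class of the form $Q\times Q\to L$, $(b,c)\mapsto\eta(bc)$ (it does not depend on the choices). *)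

theory Defs
  imports
    "Jordan_Normal_Form.Determinant"
    "HOL-Computational_Algebra.Polynomial"
    "HOL-Computational_Algebra.Fraction_Field"
    "HOL-Library.Function_Algebras"
begin

section \<open>The Grothendieck--Witt group of a field\<close>

text \<open>
  A form on an \<open>n\<close>-dimensional space is given by its Gram matrix in some basis; forms are
  isometric iff their Gram matrices are congruent.
\<close>

definition is_form :: "'a::field mat \<Rightarrow> bool" where
  "is_form A \<longleftrightarrow> square_mat A \<and> transpose_mat A = A \<and> det A \<noteq> 0"

definition isometric :: "'a::field mat \<Rightarrow> 'a mat \<Rightarrow> bool" where
  "isometric A B \<longleftrightarrow> is_form A \<and> is_form B \<and> dim_row A = dim_row B \<and>
     (\<exists>P \<in> carrier_mat (dim_row A) (dim_row A).
        invertible_mat P \<and> B = transpose_mat P * A * P)"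

definition orth_sum :: "'a::zero mat \<Rightarrow> 'a mat \<Rightarrow> 'a mat" where
  "orth_sum A B =
     four_block_mat A (0\<^sub>m (dim_row A) (dim_col B)) (0\<^sub>m (dim_row B) (dim_col A)) B"

lemma isometricI:
  assumes "A \<in> carrier_mat n n" "is_form A" "P \<in> carrier_mat n n" "Q \<in> carrier_mat n n"
    "P * Q = 1\<^sub>m n" "B = transpose_mat P * A * P"
  shows "isometric A B"
proof -
  have d: "det P * det Q = 1"
    using assms det_mult[of P n Q] by simp
  hence dP: "det P \<noteq> 0" by auto
  have B: "B \<in> carrier_mat n n" using assms by simp
  have "det B = det P * det A * det P"
    using assms by (simp add: det_mult[of _ n] det_transpose)
  moreover have "det A \<noteq> 0" using assms by (simp add: is_form_def)
  ultimately have "det B \<noteq> 0" using dP by simp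
  moreover have "transpose_mat B = B"
  proof -
    have "transpose_mat B = transpose_mat P * transpose_mat (transpose_mat P * A)"
      unfolding assms(6) using assms by (intro transpose_mult) auto
    also have "transpose_mat (transpose_mat P * A) = transpose_mat A * P"
      using assms by (subst transpose_mult[of _ n n _ n]) auto
    also have "transpose_mat A = A" using assms by (simp add: is_form_def)
    also have "transpose_mat P * (A * P) = B"
      unfolding assms(6) using assms by (intro assoc_mult_mat[symmetric]) auto
    finally show ?thesis .
  qed
  ultimately have "is_form B" using B by (auto simp: is_form_def)
  moreover have "Q * P = 1\<^sub>m n" using mat_mult_left_right_inverse[OF assms(3-5)] .
  hence "invertible_mat P" using assms unfolding invertible_mat_def inverts_mat_def by auto
  ultimately show ?thesis using assms B unfolding isometric_def by auto
qed

lemma isometricE: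
  assumes "isometric A B"
  obtains n P Q where "A \<in> carrier_mat n n" "B \<in> carrier_mat n n" "is_form A" "is_form B"
    "P \<in> carrier_mat n n" "Q \<in> carrier_mat n n" "P * Q = 1\<^sub>m n" "Q * P = 1\<^sub>m n"
    "B = transpose_mat P * A * P"
proof -
  from assms obtain P where P: "P \<in> carrier_mat (dim_row A) (dim_row A)" "invertible_mat P"
    "B = transpose_mat P * A * P"
    and f: "is_form A" "is_form B" "dim_row A = dim_row B"
    unfolding isometric_def by blast
  let ?n = "dim_row A"
  have A: "A \<in> carrier_mat ?n ?n" using f by (auto simp: is_form_def)
  have B: "B \<in> carrier_mat ?n ?n" using f by (auto simp: is_form_def)
  from P(2) obtain Q where "inverts_mat P Q" "inverts_mat Q P"
    by (auto simp: invertible_mat_def)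
  hence Q: "P * Q = 1\<^sub>m ?n" "Q * P = 1\<^sub>m (dim_row Q)" using P by (auto simp: inverts_mat_def)
  have c: "dim_col Q = ?n" using Q(1) by (metis index_mult_mat(3) index_one_mat(3))
  have r: "dim_row Q = ?n" using Q(2) P(1) by (metis carrier_matD(2) index_mult_mat(3) index_one_mat(3))
  from that[OF A B f(1,2) P(1) _ Q(1) _ P(3)] c r Q(2) show thesis by auto
qed

lemma isometric_refl: "is_form A \<Longrightarrow> isometric A A"
  by (rule isometricI[of A "dim_row A" "1\<^sub>m (dim_row A)" "1\<^sub>m (dim_row A)"])
     (auto simp: is_form_def)

lemma isometric_sym: "isometric A B \<Longrightarrow> isometric B A"
proof (erule isometricE)
  fix n P Q
  assume *: "A \<in> carrier_mat n n" "B \<in> carrier_mat n n" "is_form A" "is_form B"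
    "P \<in> carrier_mat n n" "Q \<in> carrier_mat n n" "P * Q = 1\<^sub>m n" "Q * P = 1\<^sub>m n"
    "B = transpose_mat P * A * P"
  have 1: "transpose_mat Q * transpose_mat P = 1\<^sub>m n"
    using transpose_mult[OF *(5,6)] *(7) by simp
  have "transpose_mat Q * B * Q = transpose_mat Q * (transpose_mat P * (A * P)) * Q"
    using * by (simp add: assoc_mult_mat[of _ n n _ n _ n])
  also have "\<dots> = (transpose_mat Q * transpose_mat P) * (A * P) * Q"
    using * by (simp add: assoc_mult_mat[of _ n n _ n _ n])
  also have "\<dots> = A * (P * Q)"
    unfolding 1 using * by (simp add: assoc_mult_mat[of _ n n _ n _ n])
  also have "\<dots> = A" using * by simp
  finally show "isometric B A"
    using * by (intro isometricI[of B n Q P]) auto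
qed

lemma isometric_trans: "isometric A B \<Longrightarrow> isometric B C \<Longrightarrow> isometric A C"
proof (erule isometricE, erule isometricE)
  fix n P Q m P' Q'
  assume *: "A \<in> carrier_mat n n" "B \<in> carrier_mat n n" "is_form A" "is_form B"
    "P \<in> carrier_mat n n" "Q \<in> carrier_mat n n" "P * Q = 1\<^sub>m n" "Q * P = 1\<^sub>m n"
    "B = transpose_mat P * A * P"
  assume m: "B \<in> carrier_mat m m" "C \<in> carrier_mat m m" "is_form B" "is_form C"
    "P' \<in> carrier_mat m m" "Q' \<in> carrier_mat m m" "P' * Q' = 1\<^sub>m m" "Q' * P' = 1\<^sub>m m"
    "C = transpose_mat P' * B * P'"
  have [simp]: "m = n" using *(2) m(1) by auto
  note m = m[unfolded \<open>m = n\<close>]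
  have "(P * P') * (Q' * Q) = P * (P' * Q') * Q"
    using * m(2,4-6) by (simp add: assoc_mult_mat[of _ n n _ n _ n])
  also have "\<dots> = 1\<^sub>m n" using * m by simp
  finally have 1: "(P * P') * (Q' * Q) = 1\<^sub>m n" .
  have "C = transpose_mat (P * P') * A * (P * P')"
    unfolding m(9) *(9) using * m(2,4-6)
    by (simp add: transpose_mult[of _ n n _ n] assoc_mult_mat[of _ n n _ n _ n])
  with 1 * m show "isometric A C"
    by (intro isometricI[of A n "P * P'" "Q' * Q"]) auto
qed

lemma orth_sum_carrier:
  "A \<in> carrier_mat n n \<Longrightarrow> B \<in> carrier_mat m m \<Longrightarrow> orth_sum A B \<in> carrier_mat (n + m) (n + m)"
  by (auto simp: orth_sum_def)

lemma is_form_orth_sum: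
  assumes "is_form A" "is_form B"
  shows "is_form (orth_sum A B)"
proof -
  obtain n m where nm: "A \<in> carrier_mat n n" "B \<in> carrier_mat m m"
    using assms by (auto simp: is_form_def)
  have "det (orth_sum A B) = det A * det B"
    using nm unfolding orth_sum_def by (subst det_four_block_mat_upper_right_zero[of _ n _ m]) auto
  moreover have "transpose_mat (orth_sum A B) = orth_sum A B"
    using nm assms unfolding orth_sum_def is_form_def
    by (subst transpose_four_block_mat[of _ n n _ m _ m]) auto
  ultimately show ?thesis
    using assms orth_sum_carrier[OF nm] by (auto simp: is_form_def)
qed

lemma orth_sum_mult:
  fixes A B C D :: "'a::semiring_0 mat"
  assumes "A \<in> carrier_mat n n" "B \<in> carrier_mat m m" "C \<in> carrier_mat n n" "D \<in> carrier_mat m m"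
  shows "orth_sum A B * orth_sum C D = orth_sum (A * C) (B * D)"
  using assms unfolding orth_sum_def
  by (subst mult_four_block_mat[of _ n n _ m _ m _ _ n _ m]) auto

lemma orth_sum_transpose:
  assumes "A \<in> carrier_mat n n" "B \<in> carrier_mat m m"
  shows "transpose_mat (orth_sum A B) = orth_sum (transpose_mat A) (transpose_mat B)"
  using assms unfolding orth_sum_def by (subst transpose_four_block_mat[of _ n n _ m _ m]) auto

lemma orth_sum_one: "orth_sum (1\<^sub>m n) (1\<^sub>m m) = 1\<^sub>m (n + m)"
  unfolding orth_sum_def by simp

lemma isometric_orth_sum:
  assumes "isometric A A'" "isometric B B'"
  shows "isometric (orth_sum A B) (orth_sum A' B')"
  using assms
proof (elim isometricE)
  fix n P Q m P' Q'
  assume *: "A \<in> carrier_mat n n" "A' \<in> carrier_mat n n" "is_form A" "is_form A'"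
    "P \<in> carrier_mat n n" "Q \<in> carrier_mat n n" "P * Q = 1\<^sub>m n" "Q * P = 1\<^sub>m n"
    "A' = transpose_mat P * A * P"
  assume m: "B \<in> carrier_mat m m" "B' \<in> carrier_mat m m" "is_form B" "is_form B'"
    "P' \<in> carrier_mat m m" "Q' \<in> carrier_mat m m" "P' * Q' = 1\<^sub>m m" "Q' * P' = 1\<^sub>m m"
    "B' = transpose_mat P' * B * P'"
  show ?thesis
  proof (rule isometricI[of _ "n + m" "orth_sum P P'" "orth_sum Q Q'"])
    show "is_form (orth_sum A B)" using * m by (intro is_form_orth_sum)
    show "orth_sum P P' * orth_sum Q Q' = 1\<^sub>m (n + m)"
      using * m by (simp add: orth_sum_mult[of _ n _ m] orth_sum_one)
    show "orth_sum A' B' = transpose_mat (orth_sum P P') * orth_sum A B * orth_sum P P'"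
      using * m by (simp add: orth_sum_transpose[of _ n _ m] orth_sum_mult[of _ n _ m])
  qed (use * m in \<open>auto intro: orth_sum_carrier\<close>)
qed

lemma orth_sum_assoc: "orth_sum (orth_sum A B) C = orth_sum A (orth_sum B C)"
  unfolding orth_sum_def using assoc_four_block_mat[of A B C] by simp

lemma isometric_orth_sum_commute:
  assumes "is_form A" "is_form B"
  shows "isometric (orth_sum A B) (orth_sum B A)"
proof -
  obtain n m where nm: "A \<in> carrier_mat n n" "B \<in> carrier_mat m m"
    using assms by (auto simp: is_form_def)
  define P :: "'a mat" where "P = four_block_mat (0\<^sub>m n m) (1\<^sub>m n) (1\<^sub>m m) (0\<^sub>m m n)"
  define Q :: "'a mat" where "Q = four_block_mat (0\<^sub>m m n) (1\<^sub>m m) (1\<^sub>m n) (0\<^sub>m n m)"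
  have P: "P \<in> carrier_mat (n + m) (n + m)"
    unfolding P_def by (rule carrier_matI) auto
  have Q: "Q \<in> carrier_mat (n + m) (n + m)"
    unfolding Q_def by (rule carrier_matI) auto
  have PQ: "P * Q = 1\<^sub>m (n + m)"
    unfolding P_def Q_def by (subst mult_four_block_mat[of _ n m _ n _ m _ _ n _ m]) auto
  have PT: "transpose_mat P = Q"
    unfolding P_def Q_def by (subst transpose_four_block_mat[of _ n m _ n _ m]) auto
  have "Q * orth_sum A B = four_block_mat (0\<^sub>m m n) B A (0\<^sub>m n m)"
    unfolding Q_def orth_sum_def using nm
    by (subst mult_four_block_mat[of _ m n _ m _ n _ _ n _ m]) auto
  also have "\<dots> * P = orth_sum B A"
    unfolding P_def orth_sum_def using nm
    by (subst mult_four_block_mat[of _ m n _ m _ n _ _ m _ n]) auto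
  finally have "orth_sum B A = transpose_mat P * orth_sum A B * P" by (simp add: PT)
  with P Q PQ nm assms show ?thesis
    by (intro isometricI[of _ "n + m" P Q]) (auto intro: orth_sum_carrier is_form_orth_sum)
qed

text \<open>Isometry classes of nondegenerate symmetric bilinear forms.\<close>

quotient_type (overloaded) 'a form_class = "'a::field mat" / partial: isometric
proof (rule part_equivpI)
  have "is_form (1\<^sub>m 0 :: 'a mat)" by (simp add: is_form_def)
  thus "\<exists>A::'a mat. isometric A A" using isometric_refl by blast
qed (auto intro: sympI transpI isometric_sym isometric_trans)

lemma isometricD: "isometric A B \<Longrightarrow> is_form A" "isometric A B \<Longrightarrow> is_form B"
  by (auto simp: isometric_def)

instantiation form_class :: (field) comm_monoid_add
begin

lift_definition zero_form_class :: "'a form_class" is "1\<^sub>m 0"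
  by (rule isometric_refl) (simp add: is_form_def)

lift_definition plus_form_class :: "'a form_class \<Rightarrow> 'a form_class \<Rightarrow> 'a form_class" is orth_sum
  by (rule isometric_orth_sum)

instance
proof
  fix a b c :: "'a form_class"
  show "a + b + c = a + (b + c)"
    by transfer (auto simp: orth_sum_assoc dest!: isometricD(1)
        intro!: isometric_refl is_form_orth_sum)
  show "a + b = b + a"
    by transfer (auto dest!: isometricD(1) intro!: isometric_orth_sum_commute)
  show "0 + a = a"
  proof transfer
    fix A :: "'a mat"
    assume "isometric A A"
    moreover have "orth_sum (1\<^sub>m 0) A = A" by (rule eq_matI) (auto simp: orth_sum_def)
    ultimately show "isometric (orth_sum (1\<^sub>m 0) A) A" by simp
  qed
qed

end

text \<open>
  Group completion of the monoid of isometry classes; the pair \<open>(a, b)\<close> represents \<open>a - b\<close>.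
  Only the additive group of the Grothendieck--Witt ring is needed here.
\<close>

definition gw_rel :: "'a::field form_class \<times> 'a form_class \<Rightarrow> 'a form_class \<times> 'a form_class \<Rightarrow> bool"
  where "gw_rel x y \<longleftrightarrow> (\<exists>e. fst x + snd y + e = fst y + snd x + e)"

quotient_type (overloaded) 'a gw = "'a::field form_class \<times> 'a form_class" / gw_rel
proof (rule equivpI)
  show "reflp (gw_rel :: ('a form_class \<times> 'a form_class) \<Rightarrow> _)"
    by (auto simp: reflp_def gw_rel_def)
  show "symp (gw_rel :: ('a form_class \<times> 'a form_class) \<Rightarrow> _)"
    unfolding symp_def gw_rel_def by metis
  show "transp (gw_rel :: ('a form_class \<times> 'a form_class) \<Rightarrow> _)"
  proof (rule transpI)
    fix x y z :: "'a form_class \<times> 'a form_class"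
    assume "gw_rel x y" "gw_rel y z"
    then obtain e f where e: "fst x + snd y + e = fst y + snd x + e"
      and f: "fst y + snd z + f = fst z + snd y + f"
      by (auto simp: gw_rel_def)
    have "fst x + snd z + (snd y + e + (fst y + f)) =
          (fst x + snd y + e) + (fst y + snd z + f)" by (simp add: ac_simps)
    also have "\<dots> = (fst y + snd x + e) + (fst z + snd y + f)" by (simp only: e f)
    also have "\<dots> = fst z + snd x + (snd y + e + (fst y + f))" by (simp add: ac_simps)
    finally show "gw_rel x z" unfolding gw_rel_def by blast
  qed
qed

instantiation gw :: (field) ab_group_add
begin

lift_definition zero_gw :: "'a gw" is "(0, 0)" .

lift_definition plus_gw :: "'a gw \<Rightarrow> 'a gw \<Rightarrow> 'a gw"
  is "\<lambda>x y. (fst x + fst y, snd x + snd y)"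
proof -
  fix x x' y y' :: "'a form_class \<times> 'a form_class"
  assume "gw_rel x x'" "gw_rel y y'"
  then obtain e f where e: "fst x + snd x' + e = fst x' + snd x + e"
    and f: "fst y + snd y' + f = fst y' + snd y + f"
    by (auto simp: gw_rel_def)
  have "fst x + fst y + (snd x' + snd y') + (e + f) =
        (fst x + snd x' + e) + (fst y + snd y' + f)" by (simp add: ac_simps)
  also have "\<dots> = (fst x' + snd x + e) + (fst y' + snd y + f)" by (simp only: e f)
  also have "\<dots> = fst x' + fst y' + (snd x + snd y) + (e + f)" by (simp add: ac_simps)
  finally show "gw_rel (fst x + fst y, snd x + snd y) (fst x' + fst y', snd x' + snd y')"
    unfolding gw_rel_def fst_conv snd_conv by blast
qed

lift_definition uminus_gw :: "'a gw \<Rightarrow> 'a gw" is "\<lambda>x. (snd x, fst x)"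
  unfolding gw_rel_def by (metis add.commute fst_conv snd_conv)

definition minus_gw :: "'a gw \<Rightarrow> 'a gw \<Rightarrow> 'a gw" where "minus_gw x y = x + - y"

instance
  by standard (simp add: minus_gw_def | transfer, simp add: gw_rel_def ac_simps)+

end

definition gw_class :: "'a::field mat \<Rightarrow> 'a gw" where
  "gw_class A = abs_gw (abs_form_class A, 0)"

definition gw_unary :: "'a::field \<Rightarrow> 'a gw" where
  "gw_unary a = gw_class (mat 1 1 (\<lambda>_. a))"

definition gw_hyp :: "'a::field gw" where
  "gw_hyp = gw_unary 1 + gw_unary (- 1)"

definition zmult :: "int \<Rightarrow> 'g::ab_group_add \<Rightarrow> 'g" where
  "zmult n x = (if 0 \<le> n then (\<Sum>i<nat n. x) else - (\<Sum>i<nat (- n). x))"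

text \<open>
  \<open>quot_basis sc V W bs\<close>: the classes of the members of \<open>bs\<close> form a basis of \<open>V / W\<close>.
\<close>

definition quot_basis ::
  "('a::field \<Rightarrow> 'v::ab_group_add \<Rightarrow> 'v) \<Rightarrow> 'v set \<Rightarrow> 'v set \<Rightarrow> 'v list \<Rightarrow> bool" where
  "quot_basis sc V W bs \<longleftrightarrow> set bs \<subseteq> V \<and>
     (\<forall>v\<in>V. \<exists>!cs. length cs = length bs \<and>
        v - (\<Sum>i<length bs. sc (cs ! i) (bs ! i)) \<in> W)"

text \<open>
  The class in the Grothendieck--Witt group of the form induced on \<open>V / W\<close> by a bilinear
  form \<open>\<beta>\<close> on \<open>V\<close> having \<open>W\<close> in its radical.
\<close>

definition has_gw_class ::
  "('a::field \<Rightarrow> 'v::ab_group_add \<Rightarrow> 'v) \<Rightarrow> 'v set \<Rightarrow> 'v set \<Rightarrow> ('v \<Rightarrow> 'v \<Rightarrow> 'a) \<Rightarrow> 'a gw \<Rightarrow> bool"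
  where
  "has_gw_class sc V W \<beta> \<gamma> \<longleftrightarrow>
     (\<exists>bs. quot_basis sc V W bs \<and>
        (let G = mat (length bs) (length bs) (\<lambda>(i, j). \<beta> (bs ! i) (bs ! j))
         in is_form G \<and> \<gamma> = gw_class G))"


section \<open>Tensor products over a field\<close>

text \<open>
  \<open>B \<otimes> C\<close> is the free vector space on \<open>B \<times> C\<close> modulo the span of \<open>tensor_rels\<close>; free generators
  are encoded as indicator functions.
\<close>

definition free_gen :: "'b \<Rightarrow> 'c \<Rightarrow> ('b \<times> 'c \<Rightarrow> 'a::field)" where
  "free_gen b c = (\<lambda>p. if p = (b, c) then 1 else 0)"

definition tensor_rels ::
  "('a::field \<Rightarrow> 'b::ab_group_add \<Rightarrow> 'b) \<Rightarrow> ('a \<Rightarrow> 'c::ab_group_add \<Rightarrow> 'c) \<Rightarrow>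
   'b set \<Rightarrow> 'c set \<Rightarrow> ('b \<times> 'c \<Rightarrow> 'a) set" where
  "tensor_rels sb sc B C =
     {free_gen (b + b') c - free_gen b c - free_gen b' c | b b' c. b \<in> B \<and> b' \<in> B \<and> c \<in> C}
   \<union> {free_gen b (c + c') - free_gen b c - free_gen b c' | b c c'. b \<in> B \<and> c \<in> C \<and> c' \<in> C}
   \<union> {free_gen (sb l b) c - (\<lambda>p. l * free_gen b c p) | l b c. b \<in> B \<and> c \<in> C}
   \<union> {free_gen b (sc l c) - (\<lambda>p. l * free_gen b c p) | l b c. b \<in> B \<and> c \<in> C}"

definition tensor_eq ::
  "('a::field \<Rightarrow> 'b::ab_group_add \<Rightarrow> 'b) \<Rightarrow> ('a \<Rightarrow> 'c::ab_group_add \<Rightarrow> 'c) \<Rightarrow>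
   'b set \<Rightarrow> 'c set \<Rightarrow> ('b \<times> 'c \<Rightarrow> 'a) \<Rightarrow> ('b \<times> 'c \<Rightarrow> 'a) \<Rightarrow> bool" where
  "tensor_eq sb sc B C u v \<longleftrightarrow>
     u - v \<in> module.span (\<lambda>l f p. l * f p) (tensor_rels sb sc B C)"


section \<open>Curves, line bundles and morphisms via function fields\<close>

text \<open>
  The regular proper curve \<open>Y\<close> over a field \<open>'l\<close> is encoded by its function field: a type \<open>'k\<close>
  with an embedding \<open>\<iota> :: 'l \<Rightarrow> 'k\<close>.  A closed point is identified with its local ring, and the
  closed points are all the valuation rings of \<open>'k\<close> over \<open>'l\<close> other than \<open>'k\<close> itself.
  Nonempty open sets are identified with their (cofinite) sets of closed points.
\<close>

definition closed_points :: "('l::field \<Rightarrow> 'k::field) \<Rightarrow> 'k set set" where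
  "closed_points \<iota> = {q. range \<iota> \<subseteq> q \<and> q \<noteq> UNIV \<and>
     (\<forall>a\<in>q. \<forall>b\<in>q. a - b \<in> q \<and> a * b \<in> q) \<and> (\<forall>a. a \<in> q \<or> inverse a \<in> q)}"

definition nonempty_open :: "('l::field \<Rightarrow> 'k::field) \<Rightarrow> 'k set set \<Rightarrow> bool" where
  "nonempty_open \<iota> U \<longleftrightarrow> U \<subseteq> closed_points \<iota> \<and> finite (closed_points \<iota> - U)"

definition max_ideal :: "'k::field set \<Rightarrow> 'k set" where
  "max_ideal q = {a \<in> q. a = 0 \<or> inverse a \<notin> q}"

fun ideal_power :: "'k::field set \<Rightarrow> nat \<Rightarrow> 'k set" where
  "ideal_power q 0 = q"
| "ideal_power q (Suc n) =
     {\<Sum>(a, b)\<leftarrow>xs. a * b | xs. set xs \<subseteq> max_ideal q \<times> ideal_power q n}"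

text \<open>
  A coherent subsheaf of a constant sheaf: \<open>gen\<close> is the generic stalk, a \<open>'k\<close>-vector space with
  scalar multiplication \<open>smul\<close>, and \<open>stalk q \<subseteq> gen\<close> the stalk at the closed point \<open>q\<close>.  Every line
  bundle on an integral curve is of this form; its sections over \<open>U\<close> are \<open>\<Inter>q\<in>U. stalk q\<close>.
\<close>

record ('k, 'v) vsheaf =
  gen :: "'v set"
  smul :: "'k \<Rightarrow> 'v \<Rightarrow> 'v"
  stalk :: "'k set \<Rightarrow> 'v set"

definition sections :: "('k::field, 'v::ab_group_add) vsheaf \<Rightarrow> 'k set set \<Rightarrow> 'v set" where
  "sections E U = (\<Inter>q\<in>U. stalk E q)"

definition generates :: "('k::field, 'v::ab_group_add) vsheaf \<Rightarrow> 'k set \<Rightarrow> 'v \<Rightarrow> bool" where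
  "generates E q v \<longleftrightarrow> v \<in> gen E \<and> v \<noteq> 0 \<and> stalk E q = {smul E a v | a. a \<in> q}"

definition line_bundle ::
  "('l::field \<Rightarrow> 'k::field) \<Rightarrow> ('k, 'v::ab_group_add) vsheaf \<Rightarrow> bool" where
  "line_bundle \<iota> E \<longleftrightarrow>
     (\<forall>v\<in>gen E. \<forall>w\<in>gen E. v + w \<in> gen E \<and> (\<forall>a. smul E a (v + w) = smul E a v + smul E a w)) \<and>
     (\<forall>v\<in>gen E. \<forall>a b. smul E a v \<in> gen E \<and> smul E (a + b) v = smul E a v + smul E b v \<and>
        smul E (a * b) v = smul E a (smul E b v) \<and> smul E 1 v = v) \<and>
     (\<exists>v\<in>gen E. v \<noteq> 0 \<and> gen E = {smul E a v | a. True}) \<and>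
     (\<forall>q\<in>closed_points \<iota>. \<exists>U v. nonempty_open \<iota> U \<and> q \<in> U \<and> (\<forall>q'\<in>U. generates E q' v))"

text \<open>\<open>m\<^sub>q\<^sup>n E\<^sub>q\<close> for a line bundle \<open>E\<close>.\<close>

definition stalk_power ::
  "('k::field, 'v::ab_group_add) vsheaf \<Rightarrow> 'k set \<Rightarrow> nat \<Rightarrow> 'v set" where
  "stalk_power E q n = {smul E a v | a v. a \<in> ideal_power q n \<and> v \<in> stalk E q}"

definition zeros ::
  "('l::field \<Rightarrow> 'k::field) \<Rightarrow> ('k, 'v::ab_group_add) vsheaf \<Rightarrow> 'v \<Rightarrow> 'k set set" where
  "zeros \<iota> E \<sigma> = {q \<in> closed_points \<iota>. \<sigma> \<in> stalk_power E q 1}"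

text \<open>
  A dominant morphism \<open>f\<close> from \<open>Y\<close> to \<open>X\<close> is encoded by its comorphism \<open>fs\<close> on function fields;
  it maps the closed point \<open>q\<close> to \<open>fs -` q\<close>.  For line bundles \<open>E\<close> on \<open>X\<close> and \<open>F\<close> on \<open>Y\<close>,
  \<open>hom_pullback fs E F\<close> is \<open>Hom(f\<^sup>*E, F)\<close>, whose sections are by adjunction the \<open>fs\<close>-semilinear
  maps.  Maps are extended by \<open>0\<close> outside the generic stalk, so that equality is extensional.
\<close>

definition hom_pullback ::
  "('kx::field \<Rightarrow> 'ky::field) \<Rightarrow> ('kx, 'v::ab_group_add) vsheaf \<Rightarrow> ('ky, 'w::ab_group_add) vsheaf
   \<Rightarrow> ('ky, 'v \<Rightarrow> 'w) vsheaf" where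
  "hom_pullback fs E F =
     (let H = {h. (\<forall>v\<in>gen E. \<forall>w\<in>gen E. h (v + w) = h v + h w) \<and>
                  (\<forall>a. \<forall>v\<in>gen E. h (smul E a v) = smul F (fs a) (h v)) \<and>
                  h ` gen E \<subseteq> gen F \<and> (\<forall>v. v \<notin> gen E \<longrightarrow> h v = 0)}
      in \<lparr>gen = H,
          smul = (\<lambda>a h v. smul F a (h v)),
          stalk = (\<lambda>q. {h \<in> H. h ` stalk E (fs -` q) \<subseteq> stalk F q})\<rparr>)"

definition hom_bundle ::
  "('k::field, 'v::ab_group_add) vsheaf \<Rightarrow> ('k, 'w::ab_group_add) vsheaf \<Rightarrow> ('k, 'v \<Rightarrow> 'w) vsheaf"
  where "hom_bundle E F = hom_pullback id E F"

definition structure_sheaf :: "('k::field, 'k) vsheaf" where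
  "structure_sheaf = \<lparr>gen = UNIV, smul = (*), stalk = (\<lambda>q. q)\<rparr>"

definition derivations :: "('l::field \<Rightarrow> 'k::field) \<Rightarrow> ('k \<Rightarrow> 'k) set" where
  "derivations \<iota> = {D. (\<forall>a b. D (a + b) = D a + D b) \<and> (\<forall>a b. D (a * b) = a * D b + b * D a) \<and>
     (\<forall>c. D (\<iota> c) = 0)}"

text \<open>The stalk at \<open>q\<close> is \<open>Der(O\<^sub>q, O\<^sub>q)\<close>, a derivation of \<open>O\<^sub>q\<close> extending uniquely to \<open>'k\<close>.\<close>

definition tangent :: "('l::field \<Rightarrow> 'k::field) \<Rightarrow> ('k, 'k \<Rightarrow> 'k) vsheaf" where
  "tangent \<iota> = \<lparr>gen = derivations \<iota>,
     smul = (\<lambda>a D z. a * D z),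
     stalk = (\<lambda>q. {D \<in> derivations \<iota>. D ` q \<subseteq> q})\<rparr>"

definition cotangent :: "('l::field \<Rightarrow> 'k::field) \<Rightarrow> ('k, ('k \<Rightarrow> 'k) \<Rightarrow> 'k) vsheaf" where
  "cotangent \<iota> = hom_bundle (tangent \<iota>) structure_sheaf"

definition differential :: "('l::field \<Rightarrow> 'k::field) \<Rightarrow> 'k \<Rightarrow> (('k \<Rightarrow> 'k) \<Rightarrow> 'k)" where
  "differential \<iota> z = (\<lambda>D. if D \<in> derivations \<iota> then D z else 0)"

definition hom_cotangent ::
  "('l::field \<Rightarrow> 'kx::field) \<Rightarrow> ('l \<Rightarrow> 'ky::field) \<Rightarrow> ('kx \<Rightarrow> 'ky) \<Rightarrow>
   ('ky, (('kx \<Rightarrow> 'kx) \<Rightarrow> 'kx) \<Rightarrow> (('ky \<Rightarrow> 'ky) \<Rightarrow> 'ky)) vsheaf" where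
  "hom_cotangent \<iota>x \<iota>y fs = hom_pullback fs (cotangent \<iota>x) (cotangent \<iota>y)"

text \<open>Pullback of differentials, \<open>f\<^sup>*(a dz) = f\<^sup>*a d(f\<^sup>*z)\<close>.\<close>

definition pullback_differential ::
  "('l::field \<Rightarrow> 'kx::field) \<Rightarrow> ('l \<Rightarrow> 'ky::field) \<Rightarrow> ('kx \<Rightarrow> 'ky) \<Rightarrow>
   ((('kx \<Rightarrow> 'kx) \<Rightarrow> 'kx) \<Rightarrow> (('ky \<Rightarrow> 'ky) \<Rightarrow> 'ky))" where
  "pullback_differential \<iota>x \<iota>y fs =
     (THE h. h \<in> gen (hom_cotangent \<iota>x \<iota>y fs) \<and>
        (\<forall>z. h (differential \<iota>x z) = differential \<iota>y (fs z)))"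

definition morphism_degree :: "('kx::field \<Rightarrow> 'ky::field) \<Rightarrow> nat" where
  "morphism_degree fs = vector_space.dim (\<lambda>a z. fs a * z) UNIV"

definition genus :: "('l::field \<Rightarrow> 'k::field) \<Rightarrow> nat" where
  "genus \<iota> = vector_space.dim (\<lambda>c. smul (cotangent \<iota>) (\<iota> c))
     (sections (cotangent \<iota>) (closed_points \<iota>))"

definition euler_A1 :: "('l::field \<Rightarrow> 'k::field) \<Rightarrow> 'l gw" where
  "euler_A1 \<iota> = zmult (1 - int (genus \<iota>)) gw_hyp"


section \<open>Relative orientations and the local index\<close>

text \<open>
  An isomorphism \<open>N \<otimes> N \<cong> Hom(TY, V)\<close> is given by the corresponding \<open>O\<^sub>Y\<close>-bilinear map
  \<open>\<mu> n n'\<close> (the image of \<open>n \<otimes> n'\<close>).  As \<open>N\<^sub>q \<otimes> N\<^sub>q\<close> is free on \<open>n \<otimes> n\<close> for any generator \<open>n\<close> of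
  \<open>N\<^sub>q\<close>, it induces an isomorphism iff \<open>\<mu> n n\<close> always generates the stalk of the target.
\<close>

definition relative_orientation ::
  "('l::field \<Rightarrow> 'k::field) \<Rightarrow> ('k, 'v::ab_group_add) vsheaf \<Rightarrow>
   ('k, 'n::ab_group_add) vsheaf \<Rightarrow> ('n \<Rightarrow> 'n \<Rightarrow> (('k \<Rightarrow> 'k) \<Rightarrow> 'v)) \<Rightarrow> bool" where
  "relative_orientation \<iota> V N \<mu> \<longleftrightarrow>
     (let H = hom_bundle (tangent \<iota>) V in
      line_bundle \<iota> V \<and> line_bundle \<iota> N \<and>
      (\<forall>m\<in>gen N. \<forall>n\<in>gen N. \<mu> m n \<in> gen H) \<and>
      (\<forall>m\<in>gen N. \<forall>m'\<in>gen N. \<forall>n\<in>gen N.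
         \<mu> (m + m') n = \<mu> m n + \<mu> m' n \<and> \<mu> n (m + m') = \<mu> n m + \<mu> n m') \<and>
      (\<forall>a. \<forall>m\<in>gen N. \<forall>n\<in>gen N.
         \<mu> (smul N a m) n = smul H a (\<mu> m n) \<and> \<mu> m (smul N a n) = smul H a (\<mu> m n)) \<and>
      (\<forall>q\<in>closed_points \<iota>. \<forall>n. generates N q n \<longrightarrow> generates H q (\<mu> n n)))"

definition poly_eval :: "('l::field \<Rightarrow> 'k::field) \<Rightarrow> 'l poly \<Rightarrow> 'k \<Rightarrow> 'k" where
  "poly_eval \<iota> a x = poly (map_poly \<iota> a) x"

text \<open>
  Value at \<open>x\<close> of a rational function without pole at \<open>x\<close>.  If \<open>x\<close> is regular on \<open>U\<close>, this is
  pullback of functions along the map from \<open>U\<close> to the affine line given by \<open>x\<close>.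
\<close>

definition rat_eval :: "('l::field \<Rightarrow> 'k::field) \<Rightarrow> 'k \<Rightarrow> 'l poly fract \<Rightarrow> 'k" where
  "rat_eval \<iota> x r = (THE z. \<exists>a b. r = Fract a b \<and> poly_eval \<iota> b x \<noteq> 0 \<and>
     z = poly_eval \<iota> a x / poly_eval \<iota> b x)"

text \<open>
  The local ring of the affine line \<open>Spec L[s]\<close> at the image of \<open>q\<close> under the map given by \<open>x\<close>,
  inside \<open>L(s)\<close>.
\<close>

definition A1_local_ring ::
  "('l::field \<Rightarrow> 'k::field) \<Rightarrow> 'k \<Rightarrow> 'k set \<Rightarrow> 'l poly fract set" where
  "A1_local_ring \<iota> x q = {Fract a b | a b. poly_eval \<iota> b x \<notin> max_ideal q}"

text \<open>
  \<open>x\<close> is the pullback of the coordinate \<open>s\<close>.  Etale means flat (torsion-free, i.e. \<open>L[s]\<close> injects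
  into \<open>'k\<close>) and unramified (\<open>\<Omega>\<close> of \<open>U\<close> over the affine line vanishes, i.e. \<open>dx\<close> generates the
  cotangent bundle on \<open>U\<close>).  The map on residue fields is an isomorphism iff it is onto.
\<close>

definition nisnevich_coordinates ::
  "('l::field \<Rightarrow> 'k::field) \<Rightarrow> 'k set \<Rightarrow> 'k set set \<Rightarrow> 'k \<Rightarrow> bool" where
  "nisnevich_coordinates \<iota> q U x \<longleftrightarrow>
     nonempty_open \<iota> U \<and> q \<in> U \<and> x \<in> sections structure_sheaf U \<and>
     (\<forall>a. a \<noteq> 0 \<longrightarrow> poly_eval \<iota> a x \<noteq> 0) \<and>
     (\<forall>q'\<in>U. generates (cotangent \<iota>) q' (differential \<iota> x)) \<and>
     (\<forall>z\<in>q. \<exists>r\<in>A1_local_ring \<iota> x q. z - rat_eval \<iota> x r \<in> max_ideal q)"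

text \<open>\<open>v\<close> trivializes \<open>V\<close> on \<open>U\<close> compatibly with the vector field \<open>D\<close> dual to \<open>dx\<close>.\<close>

definition compatible_trivialization ::
  "('l::field \<Rightarrow> 'k::field) \<Rightarrow> ('k, 'v::ab_group_add) vsheaf \<Rightarrow>
   ('k, 'n::ab_group_add) vsheaf \<Rightarrow> ('n \<Rightarrow> 'n \<Rightarrow> (('k \<Rightarrow> 'k) \<Rightarrow> 'v)) \<Rightarrow>
   'k set set \<Rightarrow> 'k \<Rightarrow> 'v \<Rightarrow> bool" where
  "compatible_trivialization \<iota> V N \<mu> U x v \<longleftrightarrow>
     (\<forall>q\<in>U. generates V q v) \<and>
     (\<exists>D\<in>derivations \<iota>. D x = 1 \<and> (\<exists>l\<in>sections N U. \<mu> l l D = v))"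

definition const_fract :: "'l::field \<Rightarrow> 'l poly fract" where
  "const_fract c = Fract [:c:] 1"

definition coord_fract :: "'l::field poly fract" where
  "coord_fract = Fract [:0, 1:] 1"

text \<open>
  The class of the form \<open>(b, c) \<mapsto> \<eta>(bc)\<close> on \<open>Q = R/(F)\<close>, where \<open>R \<subseteq> L(s)\<close>.  The pairs in \<open>ts\<close>
  represent \<open>a = \<Sum> b\<^sub>i \<otimes> c\<^sub>i\<close> in \<open>R \<otimes> R\<close>; elements of \<open>Q\<close> are represented in \<open>R\<close>, and
  functionals on \<open>Q\<close> by functionals on \<open>R\<close> that vanish on \<open>(F)\<close>.  Then \<open>\<Theta> \<eta> = \<Sum> \<eta>(b\<^sub>i) c\<^sub>i\<close>.
\<close>

definition bezout_gw_class ::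
  "'l::field poly fract set \<Rightarrow> 'l poly fract \<Rightarrow> 'l gw \<Rightarrow> bool" where
  "bezout_gw_class R F \<gamma> \<longleftrightarrow>
     (let sc = (\<lambda>c r. const_fract c * r); s = coord_fract; I = {F * r | r. r \<in> R} in
      \<exists>ts \<eta>. set ts \<subseteq> R \<times> R \<and>
        tensor_eq sc sc R R (free_gen F 1 - free_gen 1 F)
          (\<Sum>(b, c)\<leftarrow>ts. free_gen (b * s) c - free_gen b (c * s)) \<and>
        (\<forall>b\<in>R. \<forall>c\<in>R. \<eta> (b + c) = \<eta> b + \<eta> c) \<and>
        (\<forall>l. \<forall>b\<in>R. \<eta> (sc l b) = l * \<eta> b) \<and>
        (\<forall>b\<in>I. \<eta> b = 0) \<and>
        (\<Sum>(b, c)\<leftarrow>ts. sc (\<eta> b) c) - 1 \<in> I \<and>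
        has_gw_class sc R I (\<lambda>b c. \<eta> (b * c)) \<gamma>)"

text \<open>\<open>\<gamma>\<close> results from some admissible choices in the construction of the local index.\<close>

definition is_local_index ::
  "('l::field \<Rightarrow> 'k::field) \<Rightarrow> ('k, 'v::ab_group_add) vsheaf \<Rightarrow>
   ('k, 'n::ab_group_add) vsheaf \<Rightarrow> ('n \<Rightarrow> 'n \<Rightarrow> (('k \<Rightarrow> 'k) \<Rightarrow> 'v)) \<Rightarrow>
   'v \<Rightarrow> 'k set \<Rightarrow> 'l gw \<Rightarrow> bool" where
  "is_local_index \<iota> V N \<mu> \<sigma> q \<gamma> \<longleftrightarrow>
     (\<exists>n U x v \<sigma>0 N0 g F.
        1 \<le> n \<and> \<sigma> \<in> stalk_power V q n \<and> \<sigma> \<notin> stalk_power V q (Suc n) \<and>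
        nisnevich_coordinates \<iota> q U x \<and>
        compatible_trivialization \<iota> V N \<mu> U x v \<and>
        \<sigma>0 \<in> q \<and> \<sigma> = smul V \<sigma>0 v \<and>
        2 * n \<le> N0 \<and> g \<in> ideal_power q N0 \<and>
        F \<in> A1_local_ring \<iota> x q \<and> \<sigma>0 + g = rat_eval \<iota> x F \<and>
        bezout_gw_class (A1_local_ring \<iota> x q) F \<gamma>)"

text \<open>\<open>THE\<close> is appropriate as the class is independent of the choices.\<close>

definition local_index ::
  "('l::field \<Rightarrow> 'k::field) \<Rightarrow> ('k, 'v::ab_group_add) vsheaf \<Rightarrow>
   ('k, 'n::ab_group_add) vsheaf \<Rightarrow> ('n \<Rightarrow> 'n \<Rightarrow> (('k \<Rightarrow> 'k) \<Rightarrow> 'v)) \<Rightarrow>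
   'v \<Rightarrow> 'k set \<Rightarrow> 'l gw" where
  "local_index \<iota> V N \<mu> \<sigma> q = (THE \<gamma>. is_local_index \<iota> V N \<mu> \<sigma> q \<gamma>)"


section \<open>The projective line\<close>

text \<open>
  The projective line over \<open>'l\<close> is the curve with function field \<open>'l poly fract\<close> over
  \<open>const_fract\<close>, with affine coordinate \<open>coord_fract\<close>.
\<close>

definition infinity_P1 :: "'l::field poly fract set" where
  "infinity_P1 = {Fract a b | a b. b \<noteq> 0 \<and> degree a \<le> degree b}"

text \<open>The comorphism of the self-map of the projective line given by \<open>y \<mapsto> g(y)\<close>.\<close>

definition P1_comorphism :: "'l::field poly fract \<Rightarrow> 'l poly fract \<Rightarrow> 'l poly fract" where
  "P1_comorphism g = rat_eval const_fract g"

end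

theory Submission
  imports Defs
begin

text \<open>
  On the affine line \<open>d(y\<^sup>p - y) = - dy\<close> vanishes nowhere, so \<open>df\<close> has its only zero at infinity; in
  \<open>z = 1/y\<close> it is \<open>- z\<^bsup>2p-2\<^esup>\<close> times a generator of \<open>V \<cong> O(2p - 2)\<close>.  Since \<open>Hom(TY, V) \<cong> O(2(p - 2))\<close>,
  the square of \<open>N = O(p - 2)\<close> is a relative orientation.  Whatever choices enter the local index at
  infinity, \<open>Q \<cong> L[s]/(s - c)\<^bsup>2(p-1)\<^esup>\<close> and the form is \<open>\<eta>(bc)\<close> for some functional \<open>\<eta>\<close>.  It vanishes on the
  ideal generated by \<open>(s - c)\<^bsup>p-1\<^esup>\<close>, a subspace of half the dimension, so the form is \<open>p - 1\<close> times
  hyperbolic.  The formula then reads \<open>h = p h - (p - 1) h\<close>.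
\<close>

section \<open>Grothendieck--Witt classes of metabolic forms\<close>

text \<open>\<open>local_index\<close> is a definite description, so its value needs both a
  uniqueness argument and a witness. Uniqueness rests on parity: at a rational point where the
  section has even order 2m, every admissible choice forces the class to be m times
  \<open>gw_hyp\<close>. The witness is one explicit choice, the coordinate 1/y with F = s^(2p-2),
  whose Bezoutian telescopes. All geometry takes place inside the function field. A coordinate
  \<tau> with a derivation D satisfying D \<tau> = 1 is treated abstractly, and the same lemmas are
  then read for 1/\<tau> and - \<tau>^2 D, which gives the second chart. The characteristic enters
  through D (\<tau>^p - \<tau>) = - 1, and its oddness makes 2 invertible when hyperbolic planes are
  diagonalized. The numbers in the formula are vector space dimensions: the genus is 0 because a
  nonzero differential regular on the affine line is a polynomial multiple of dy and has a pole at
  infinity, and the degree is p because the first p powers of y form a basis over the image of the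
  comorphism.\<close>

lemma gw_class_eq: "isometric A B \<Longrightarrow> gw_class A = gw_class B"
  unfolding gw_class_def by (simp add: Quotient3_rel_abs[OF Quotient3_form_class])

lemma gw_class_orth_sum:
  assumes "is_form A" "is_form B"
  shows "gw_class (orth_sum A B) = gw_class A + gw_class B"
proof -
  have "abs_form_class A + abs_form_class B = abs_form_class (orth_sum A B)"
    using assms by (intro plus_form_class.abs_eq) (simp_all add: isometric_refl)
  thus ?thesis by (simp add: gw_class_def plus_gw.abs_eq)
qed

lemma zmult_of_nat: "zmult (int m) x = (\<Sum>i<m. x)"
  by (simp add: zmult_def)

lemma gw_class_scalar:
  fixes c :: "'a::field"
  assumes "c \<noteq> 0"
  shows "is_form (c \<cdot>\<^sub>m 1\<^sub>m m) \<and> gw_class (c \<cdot>\<^sub>m 1\<^sub>m m) = (\<Sum>i<m. gw_unary c)"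
proof (induction m)
  case 0
  have "c \<cdot>\<^sub>m 1\<^sub>m 0 = (1\<^sub>m 0 :: 'a mat)" by (rule eq_matI) auto
  moreover have "is_form (1\<^sub>m 0 :: 'a mat)" by (simp add: is_form_def)
  ultimately show ?case
    by (simp add: gw_class_def zero_gw_def zero_form_class_def)
next
  case (Suc m)
  let ?u = "mat 1 1 (\<lambda>_. c)"
  have u: "is_form ?u" using assms by (auto simp: is_form_def det_single intro!: eq_matI)
  have e: "c \<cdot>\<^sub>m 1\<^sub>m (Suc m) = orth_sum ?u (c \<cdot>\<^sub>m 1\<^sub>m m)"
    by (rule eq_matI) (auto simp: orth_sum_def four_block_mat_def)
  show ?case unfolding e using Suc u
    by (simp add: is_form_orth_sum gw_class_orth_sum gw_unary_def add.commute)
qed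

text \<open>The last m basis vectors span a totally isotropic subspace of half the dimension, so the
  Gram matrix has blocks A1, B, B^T, 0 with B invertible. Adding suitable combinations of these
  vectors to the first m removes A1, a change of basis among them turns B into the identity, and the
  resulting m hyperbolic planes are diagonalized. Halves occur when A1 is removed and in the
  diagonalization.\<close>

lemma gw_class_metabolic:
  fixes A :: "'a::field mat"
  assumes A: "A \<in> carrier_mat (m + m) (m + m)" "is_form A" and two: "(2::'a) \<noteq> 0"
    and iso: "\<And>i j. m \<le> i \<Longrightarrow> i < m + m \<Longrightarrow> m \<le> j \<Longrightarrow> j < m + m \<Longrightarrow> A $$ (i, j) = 0"
  shows "gw_class A = zmult (int m) gw_hyp"
proof -
  obtain A1 B C D where sp: "split_block A m m = (A1, B, C, D)"
    by (metis prod_cases4)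
  have c: "A1 \<in> carrier_mat m m" "B \<in> carrier_mat m m" "C \<in> carrier_mat m m" "D \<in> carrier_mat m m"
    and A_eq: "A = four_block_mat A1 B C D"
    using split_block[OF sp] A by auto
  have D: "D = 0\<^sub>m m m"
  proof (rule eq_matI)
    fix i j assume "i < dim_row (0\<^sub>m m m :: 'a mat)" "j < dim_col (0\<^sub>m m m :: 'a mat)"
    moreover from this have "A $$ (i + m, j + m) = D $$ (i, j)"
      unfolding A_eq using c by (subst index_mat_four_block) auto
    ultimately show "D $$ (i, j) = 0\<^sub>m m m $$ (i, j)" using iso[of "i + m" "j + m"] by simp
  qed (use c in auto)
  have symA: "transpose_mat A = A" using A by (simp add: is_form_def)
  have sym: "A1 $$ (i, j) = A1 $$ (j, i)" "C $$ (i, j) = B $$ (j, i)" if "i < m" "j < m" for i j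
  proof -
    have e: "A $$ (a, b) = A $$ (b, a)" if "a < m + m" "b < m + m" for a b
      using arg_cong[OF symA, of "\<lambda>M. M $$ (a, b)"] that A by simp
    show "A1 $$ (i, j) = A1 $$ (j, i)"
      using e[of i j] that c unfolding A_eq by simp
    show "C $$ (i, j) = B $$ (j, i)"
      using e[of "i + m" j] that c unfolding A_eq by simp
  qed
  have symA1: "transpose_mat A1 = A1" and C: "C = transpose_mat B"
    using c sym by (auto intro!: eq_matI)
  \<comment> \<open>\<open>J\<close> interchanges the two halves, which makes \<open>A * J\<close>
    block triangular; hence the determinant of B divides that of A up to a nonzero scalar.\<close>
  define J :: "'a mat" where "J = four_block_mat (0\<^sub>m m m) (1\<^sub>m m) (1\<^sub>m m) (0\<^sub>m m m)"
  have J: "J \<in> carrier_mat (m + m) (m + m)"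
    unfolding J_def by (rule carrier_matI) auto
  have "A * J = four_block_mat B A1 (0\<^sub>m m m) C"
    unfolding A_eq J_def D using c
    by (subst mult_four_block_mat[of _ m m _ m _ m _ _ m _ m]) auto
  hence "det (A * J) = det B * det C"
    using c det_four_block_mat_lower_left_zero[of B m A1 m "0\<^sub>m m m" C] by simp
  moreover have "J * J = 1\<^sub>m (m + m)"
    unfolding J_def by (subst mult_four_block_mat[of _ m m _ m _ m _ _ m _ m]) auto
  hence "det J * det J = 1" using det_mult[OF J J] by simp
  hence "det J \<noteq> 0" by auto
  ultimately have detB: "det B \<noteq> 0"
    using det_mult[OF A(1) J] A(2) by (auto simp: is_form_def)
  then obtain Y where Y: "Y \<in> carrier_mat m m" "B * Y = 1\<^sub>m m" "Y * B = 1\<^sub>m m"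
    using det_non_zero_imp_unit[OF c(2) detB, of "TYPE('a)"] unfolding Units_def ring_mat_def
    by auto
  have CY: "transpose_mat Y * C = 1\<^sub>m m"
    using Y c unfolding C by (metis transpose_mult transpose_one)
  define h :: 'a where "h = 1 / 2"
  have h: "h + h = 1" using two unfolding h_def by (simp add: field_simps)
  \<comment> \<open>X is - B^-1 A1 / 2, so that the two cross terms B X and X^T C each cancel one
    half of A1.\<close>
  define X where "X = (- h) \<cdot>\<^sub>m (Y * A1)"
  have X: "X \<in> carrier_mat m m" unfolding X_def using Y c by auto
  have BX: "B * X = (- h) \<cdot>\<^sub>m A1"
  proof -
    have "B * X = (- h) \<cdot>\<^sub>m (B * (Y * A1))"
      unfolding X_def using Y(1) c by (intro mult_smult_distrib[of _ m m]) auto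
    also have "B * (Y * A1) = B * Y * A1"
      using Y(1) c by (intro assoc_mult_mat[symmetric]) auto
    finally show ?thesis using Y c by simp
  qed
  have XC: "transpose_mat X * C = (- h) \<cdot>\<^sub>m A1"
  proof -
    have "transpose_mat X * C = transpose_mat (B * X)"
      unfolding C using X c by (intro transpose_mult[symmetric]) auto
    also have "\<dots> = (- h) \<cdot>\<^sub>m A1"
      unfolding BX using c symA1 sym by (auto intro!: eq_matI)
    finally show ?thesis .
  qed
  define H :: "'a mat" where "H = four_block_mat (0\<^sub>m m m) (1\<^sub>m m) (1\<^sub>m m) (0\<^sub>m m m)"
  define P where "P = four_block_mat (1\<^sub>m m) (0\<^sub>m m m) X Y"
  have P: "P \<in> carrier_mat (m + m) (m + m)"
    unfolding P_def using Y X by (intro carrier_matI) auto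
  have PT: "transpose_mat P = four_block_mat (1\<^sub>m m) (transpose_mat X) (0\<^sub>m m m) (transpose_mat Y)"
    unfolding P_def using X Y by (subst transpose_four_block_mat[of _ m m _ m _ m]) auto
  have hh: "A1 + (- h) \<cdot>\<^sub>m A1 + (- h) \<cdot>\<^sub>m A1 = 0\<^sub>m m m"
  proof (rule eq_matI)
    fix i j assume "i < dim_row (0\<^sub>m m m :: 'a mat)" "j < dim_col (0\<^sub>m m m :: 'a mat)"
    moreover have "x + - h * x + - h * x = x * (1 - (h + h))" for x
      by (simp add: algebra_simps)
    hence "x + - h * x + - h * x = 0" for x using h by simp
    ultimately show "(A1 + (- h) \<cdot>\<^sub>m A1 + (- h) \<cdot>\<^sub>m A1) $$ (i, j) = 0\<^sub>m m m $$ (i, j)"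
      using c by simp
  qed (use c in auto)
  have "transpose_mat P * A = four_block_mat (A1 + (- h) \<cdot>\<^sub>m A1) B (transpose_mat Y * C) (0\<^sub>m m m)"
    unfolding PT A_eq D using c X Y XC
    by (subst mult_four_block_mat[of _ m m _ m _ m _ _ m _ m]) auto
  also have "\<dots> * P = H"
    unfolding P_def H_def using c X Y CY BX hh
    by (subst mult_four_block_mat[of _ m m _ m _ m _ _ m _ m]) auto
  finally have HP: "H = transpose_mat P * A * P" by simp
  \<comment> \<open>The inverse of P in block form: since Y is inverse to B, the lower left entry X
    - Y B X vanishes.\<close>
  have "P * four_block_mat (1\<^sub>m m) (0\<^sub>m m m) (- (B * X)) B = 1\<^sub>m (m + m)"
  proof -
    have "Y * (B * X) = Y * B * X"
      using X Y c by (intro assoc_mult_mat[symmetric]) auto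
    also have "\<dots> = X" using X Y by simp
    finally have "Y * - (B * X) = - X"
      using uminus_mult_right_mat[of Y "B * X"] X Y c by simp
    hence "X + Y * - (B * X) = 0\<^sub>m m m" using X by (auto intro!: eq_matI)
    moreover have "1\<^sub>m m + - 0\<^sub>m m m = (1\<^sub>m m :: 'a mat)" by (auto intro!: eq_matI)
    ultimately show ?thesis
      unfolding P_def using X Y c
      by (subst mult_four_block_mat[of _ m m _ m _ m _ _ m _ m]) auto
  qed
  moreover have "four_block_mat (1\<^sub>m m) (0\<^sub>m m m) (- (B * X)) B \<in> carrier_mat (m + m) (m + m)"
    using c by (intro carrier_matI) auto
  ultimately have 1: "isometric A H"
    using isometricI[OF A P _ _ HP] by blast
  \<comment> \<open>For hyperbolic pairs e_i, f_i the columns of S are e_i + f_i / 2 and e_i - f_i /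
    2; these are orthogonal and have norms 1 and - 1.\<close>
  define S where "S = four_block_mat (1\<^sub>m m) (1\<^sub>m m) (h \<cdot>\<^sub>m 1\<^sub>m m) ((- h) \<cdot>\<^sub>m 1\<^sub>m m)"
  have S: "S \<in> carrier_mat (m + m) (m + m)"
    unfolding S_def by (rule carrier_matI) auto
  have ST: "transpose_mat S = four_block_mat (1\<^sub>m m) (h \<cdot>\<^sub>m 1\<^sub>m m) (1\<^sub>m m) ((- h) \<cdot>\<^sub>m 1\<^sub>m m)"
    unfolding S_def by (subst transpose_four_block_mat[of _ m m _ m _ m])
      (auto intro!: cong_four_block_mat eq_matI)
  let ?E = "orth_sum (1 \<cdot>\<^sub>m 1\<^sub>m m) ((- 1) \<cdot>\<^sub>m 1\<^sub>m m) :: 'a mat"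
  have hm: "h \<cdot>\<^sub>m 1\<^sub>m m + h \<cdot>\<^sub>m 1\<^sub>m m = (1\<^sub>m m :: 'a mat)"
    "h \<cdot>\<^sub>m 1\<^sub>m m + (- h) \<cdot>\<^sub>m 1\<^sub>m m = (0\<^sub>m m m :: 'a mat)"
    "(- h) \<cdot>\<^sub>m 1\<^sub>m m + h \<cdot>\<^sub>m 1\<^sub>m m = (0\<^sub>m m m :: 'a mat)"
    "(- h) \<cdot>\<^sub>m 1\<^sub>m m + (- h) \<cdot>\<^sub>m 1\<^sub>m m = ((- 1) \<cdot>\<^sub>m 1\<^sub>m m :: 'a mat)"
    "1 \<cdot>\<^sub>m 1\<^sub>m m = (1\<^sub>m m :: 'a mat)"
    using h by (auto intro!: eq_matI simp: minus_add_distrib[symmetric] simp del: minus_add_distrib)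
  have "transpose_mat S * H =
      four_block_mat (h \<cdot>\<^sub>m 1\<^sub>m m) (1\<^sub>m m) ((- h) \<cdot>\<^sub>m 1\<^sub>m m) (1\<^sub>m m)"
    unfolding ST H_def
    by (subst mult_four_block_mat[of _ m m _ m _ m _ _ m _ m]) auto
  also have "\<dots> * S = ?E"
    unfolding S_def orth_sum_def using hm
    by (subst mult_four_block_mat[of _ m m _ m _ m _ _ m _ m]) auto
  finally have E: "?E = transpose_mat S * H * S" by simp
  have "four_block_mat (h \<cdot>\<^sub>m 1\<^sub>m m) (1\<^sub>m m) (h \<cdot>\<^sub>m 1\<^sub>m m) ((- 1) \<cdot>\<^sub>m 1\<^sub>m m) \<in> carrier_mat (m + m) (m + m)"
    by (rule carrier_matI) auto
  moreover have "S * four_block_mat (h \<cdot>\<^sub>m 1\<^sub>m m) (1\<^sub>m m) (h \<cdot>\<^sub>m 1\<^sub>m m) ((- 1) \<cdot>\<^sub>m 1\<^sub>m m) = 1\<^sub>m (m + m)"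
  proof -
    have "h \<cdot>\<^sub>m (h \<cdot>\<^sub>m 1\<^sub>m m) + h \<cdot>\<^sub>m ((- h) \<cdot>\<^sub>m 1\<^sub>m m) = (0\<^sub>m m m :: 'a mat)"
      "h \<cdot>\<^sub>m 1\<^sub>m m + (- 1) \<cdot>\<^sub>m ((- h) \<cdot>\<^sub>m 1\<^sub>m m) = (1\<^sub>m m :: 'a mat)"
      "1\<^sub>m m + (- 1) \<cdot>\<^sub>m 1\<^sub>m m = (0\<^sub>m m m :: 'a mat)"
      using h by (auto intro!: eq_matI)
    thus ?thesis
      unfolding S_def using hm
      by (subst mult_four_block_mat[of _ m m _ m _ m _ _ m _ m])
        (auto simp: mult_smult_assoc_mat[of _ m m _ m] mult_smult_distrib[of _ m m _ m])
  qed
  moreover have "H \<in> carrier_mat (m + m) (m + m)"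
    unfolding H_def by (rule carrier_matI) auto
  ultimately have 2: "isometric H ?E"
    using isometricI[OF _ isometricD(2)[OF 1] S _ _ E] by blast
  have "gw_class A = gw_class ?E"
    using gw_class_eq[OF 1] gw_class_eq[OF 2] by simp
  also have "\<dots> = zmult (int m) gw_hyp"
    using gw_class_scalar[of "1::'a" m] gw_class_scalar[of "- 1::'a" m]
    by (simp add: gw_class_orth_sum zmult_of_nat gw_hyp_def sum.distrib)
  finally show ?thesis .
qed

section \<open>Bases of quotient spaces\<close>

text \<open>Zero padding makes both matrices square of size n without changing the product. If m <
  n, the padded P has a zero column, although its determinant is nonzero.\<close>

lemma dim_le_of_right_inverse:
  fixes P Q :: "'a::field mat"
  assumes P: "P \<in> carrier_mat n m" and Q: "Q \<in> carrier_mat m n" and PQ: "P * Q = 1\<^sub>m n"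
  shows "n \<le> m"
proof (rule ccontr)
  assume "\<not> n \<le> m"
  then obtain k where k: "n = m + k" "0 < k" using less_imp_add_positive[of m n] by auto
  define P' where "P' = mat n n (\<lambda>(i, j). if j < m then P $$ (i, j) else 0)"
  define Q' where "Q' = mat n n (\<lambda>(i, j). if i < m then Q $$ (i, j) else 0)"
  have "P' * Q' = P * Q"
  proof (rule eq_matI)
    fix i j assume ij: "i < dim_row (P * Q)" "j < dim_col (P * Q)"
    have "(P' * Q') $$ (i, j) = (\<Sum>l<n. P' $$ (i, l) * Q' $$ (l, j))"
      using ij P Q by (simp add: P'_def Q'_def scalar_prod_def atLeast0LessThan)
    also have "\<dots> = (\<Sum>l<m. P $$ (i, l) * Q $$ (l, j))"
      using ij P Q k by (intro sum.mono_neutral_cong_right) (auto simp: P'_def Q'_def)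
    also have "\<dots> = (P * Q) $$ (i, j)"
      using ij P Q by (simp add: scalar_prod_def atLeast0LessThan)
    finally show "(P' * Q') $$ (i, j) = (P * Q) $$ (i, j)" .
  qed (use P Q in \<open>auto simp: P'_def Q'_def\<close>)
  hence "P' * Q' = 1\<^sub>m n" using PQ by simp
  hence "det P' * det Q' = 1"
    using det_mult[of P' n Q'] by (simp add: P'_def Q'_def)
  hence "det P' \<noteq> 0" by auto
  moreover have "P' *\<^sub>v unit_vec n m = 0\<^sub>v n"
    using k by (intro eq_vecI) (auto simp: P'_def)
  moreover have "unit_vec n m \<noteq> (0\<^sub>v n :: 'a vec)"
    using k by (metis index_unit_vec(2) index_zero_vec(1) less_add_same_cancel1 zero_neq_one)
  ultimately show False
    using det_0_iff_vec_prod_zero_field[of P' n] unit_vec_carrier[of n m]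
    by (metis P'_def mat_carrier)
qed

lemma quot_basisI:
  fixes sc :: "'a::field \<Rightarrow> 'v::ab_group_add \<Rightarrow> 'v"
  assumes "vector_space sc" "module.subspace sc W" "set bs \<subseteq> V"
    and span: "\<And>v. v \<in> V \<Longrightarrow> \<exists>c. v - (\<Sum>i<length bs. sc (c i) (bs ! i)) \<in> W"
    and indep: "\<And>c i. (\<Sum>i<length bs. sc (c i) (bs ! i)) \<in> W \<Longrightarrow> i < length bs \<Longrightarrow> c i = 0"
  shows "quot_basis sc V W bs"
  unfolding quot_basis_def
proof (intro conjI ballI)
  interpret vector_space sc by fact
  fix v assume v: "v \<in> V"
  let ?P = "\<lambda>cs. length cs = length bs \<and> v - (\<Sum>i<length bs. sc (cs ! i) (bs ! i)) \<in> W"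
  obtain c where c: "v - (\<Sum>i<length bs. sc (c i) (bs ! i)) \<in> W" using span[OF v] by blast
  show "\<exists>!cs. ?P cs"
  proof (rule ex1I[of _ "map c [0..<length bs]"])
    show "?P (map c [0..<length bs])" using c by simp
    fix cs assume cs: "?P cs"
    have "(v - (\<Sum>i<length bs. sc (cs ! i) (bs ! i))) - (v - (\<Sum>i<length bs. sc (c i) (bs ! i))) \<in> W"
      using subspace_diff[OF assms(2) conjunct2[OF cs] c] .
    hence "(\<Sum>i<length bs. sc (c i - cs ! i) (bs ! i)) \<in> W"
      by (simp add: scale_left_diff_distrib sum_subtractf)
    hence "c i = cs ! i" if "i < length bs" for i
      using indep[of "\<lambda>i. c i - cs ! i" i] that by simp
    thus "cs = map c [0..<length bs]" using cs by (intro nth_equalityI) auto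
  qed
qed fact

lemma quot_basis_span:
  assumes "quot_basis sc V W bs" "v \<in> V"
  shows "\<exists>c. v - (\<Sum>i<length bs. sc (c i) (bs ! i)) \<in> W"
proof -
  obtain cs where "v - (\<Sum>i<length bs. sc (cs ! i) (bs ! i)) \<in> W"
    using assms unfolding quot_basis_def by blast
  thus ?thesis by blast
qed

text \<open>\<open>quot_basis\<close> speaks of coordinate lists, the arguments below of coordinate
  functions; cutting the functions down to lists transfers uniqueness.\<close>

lemma quot_basis_unique:
  fixes sc :: "'a::field \<Rightarrow> 'v::ab_group_add \<Rightarrow> 'v"
  assumes bs: "quot_basis sc V W bs" and v: "v \<in> V"
    and c: "v - (\<Sum>i<length bs. sc (c i) (bs ! i)) \<in> W"
    and d: "v - (\<Sum>i<length bs. sc (d i) (bs ! i)) \<in> W" and i: "i < length bs"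
  shows "c i = d i"
proof -
  have "\<exists>!cs. length cs = length bs \<and> v - (\<Sum>i<length bs. sc (cs ! i) (bs ! i)) \<in> W"
    using bs v by (auto simp: quot_basis_def)
  moreover have "length (map e [0..<length bs]) = length bs \<and>
      v - (\<Sum>i<length bs. sc (map e [0..<length bs] ! i) (bs ! i)) \<in> W"
    if "v - (\<Sum>i<length bs. sc (e i) (bs ! i)) \<in> W" for e
    using that by simp
  ultimately have "map c [0..<length bs] = map d [0..<length bs]"
    using c d by blast
  thus ?thesis using i by (simp add: map_eq_conv)
qed

text \<open>Expanding \<open>bs ! j\<close> in \<open>cs\<close> and the result in \<open>bs\<close>
  again gives coordinates of \<open>bs ! j\<close>, which must be those of a unit vector. The
  lengths may differ at this stage; the one-sided inverse is what yields their equality in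
  \<open>quot_basis_length\<close>.\<close>

lemma quot_basis_change:
  fixes sc :: "'a::field \<Rightarrow> 'v::ab_group_add \<Rightarrow> 'v"
  assumes sc: "vector_space sc" and W: "module.subspace sc W"
    and bs: "quot_basis sc V W bs" and cs: "quot_basis sc V W cs"
  obtains P Q where "P \<in> carrier_mat (length bs) (length cs)"
    "Q \<in> carrier_mat (length cs) (length bs)" "P * Q = 1\<^sub>m (length bs)"
    "\<And>j. j < length cs \<Longrightarrow> cs ! j - (\<Sum>i<length bs. sc (P $$ (i, j)) (bs ! i)) \<in> W"
    "\<And>j. j < length bs \<Longrightarrow> bs ! j - (\<Sum>i<length cs. sc (Q $$ (i, j)) (cs ! i)) \<in> W"
proof -
  interpret vector_space sc by fact
  let ?n = "length bs" and ?m = "length cs"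
  have bV: "bs ! j \<in> V" if "j < ?n" for j
    using bs nth_mem[OF that] by (auto simp: quot_basis_def)
  have cV: "cs ! j \<in> V" if "j < ?m" for j
    using cs nth_mem[OF that] by (auto simp: quot_basis_def)
  have "\<forall>j. \<exists>c. j < ?m \<longrightarrow> cs ! j - (\<Sum>i<?n. sc (c i) (bs ! i)) \<in> W"
    using quot_basis_span[OF bs cV] by blast
  then obtain p where p: "\<And>j. j < ?m \<Longrightarrow> cs ! j - (\<Sum>i<?n. sc (p j i) (bs ! i)) \<in> W"
    by metis
  have "\<forall>j. \<exists>c. j < ?n \<longrightarrow> bs ! j - (\<Sum>i<?m. sc (c i) (cs ! i)) \<in> W"
    using quot_basis_span[OF cs bV] by blast
  then obtain q where q: "\<And>j. j < ?n \<Longrightarrow> bs ! j - (\<Sum>i<?m. sc (q j i) (cs ! i)) \<in> W"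
    by metis
  define P where "P = mat ?n ?m (\<lambda>(i, j). p j i)"
  define Q where "Q = mat ?m ?n (\<lambda>(i, j). q j i)"
  have "P * Q = 1\<^sub>m ?n"
  proof (rule eq_matI)
    fix i j assume "i < dim_row (1\<^sub>m ?n :: 'a mat)" "j < dim_col (1\<^sub>m ?n :: 'a mat)"
    hence ij: "i < ?n" "j < ?n" by auto
    define e where "e i = (\<Sum>l<?m. q j l * p l i)" for i
    have "bs ! j - (\<Sum>l<?m. sc (q j l) (cs ! l))
        + (\<Sum>l<?m. sc (q j l) (cs ! l - (\<Sum>i<?n. sc (p l i) (bs ! i)))) \<in> W"
      using W q[OF ij(2)] p by (intro subspace_add subspace_sum subspace_scale) auto
    also have "(\<Sum>l<?m. sc (q j l) (cs ! l - (\<Sum>i<?n. sc (p l i) (bs ! i)))) =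
        (\<Sum>l<?m. sc (q j l) (cs ! l)) - (\<Sum>l<?m. \<Sum>i<?n. sc (q j l * p l i) (bs ! i))"
      by (simp add: scale_right_diff_distrib sum_subtractf scale_sum_right)
    also have "(\<Sum>l<?m. \<Sum>i<?n. sc (q j l * p l i) (bs ! i)) = (\<Sum>i<?n. sc (e i) (bs ! i))"
      unfolding e_def by (subst sum.swap) (simp add: scale_sum_left)
    finally have 1: "bs ! j - (\<Sum>i<?n. sc (e i) (bs ! i)) \<in> W" by simp
    have "(\<Sum>i<?n. sc (if i = j then 1 else 0) (bs ! i)) = bs ! j"
      using ij by (simp add: if_distrib[of "\<lambda>c. sc c _"] sum.delta cong: if_cong)
    hence 2: "bs ! j - (\<Sum>i<?n. sc (if i = j then 1 else 0) (bs ! i)) \<in> W"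
      using W by (simp add: subspace_0)
    have "e i = (if i = j then 1 else 0)"
      by (rule quot_basis_unique[OF bs bV[OF ij(2)] 1 2 ij(1)])
    moreover have "(P * Q) $$ (i, j) = e i"
      using ij by (simp add: P_def Q_def e_def scalar_prod_def atLeast0LessThan mult.commute)
    ultimately show "(P * Q) $$ (i, j) = 1\<^sub>m ?n $$ (i, j)" using ij by auto
  qed (auto simp: P_def Q_def)
  moreover have "cs ! j - (\<Sum>i<?n. sc (P $$ (i, j)) (bs ! i)) \<in> W" if "j < ?m" for j
    using p[OF that] that by (simp add: P_def)
  moreover have "bs ! j - (\<Sum>i<?m. sc (Q $$ (i, j)) (cs ! i)) \<in> W" if "j < ?n" for j
    using q[OF that] that by (simp add: Q_def)
  moreover have "P \<in> carrier_mat ?n ?m" "Q \<in> carrier_mat ?m ?n" by (simp_all add: P_def Q_def)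
  ultimately show thesis using that[of P Q] by blast
qed

lemma quot_basis_length:
  assumes "vector_space sc" "module.subspace sc W" "quot_basis sc V W bs" "quot_basis sc V W cs"
  shows "length bs = length cs"
proof (rule antisym)
  show "length bs \<le> length cs"
    by (rule quot_basis_change[OF assms]) (rule dim_le_of_right_inverse)
  show "length cs \<le> length bs"
    by (rule quot_basis_change[OF assms(1,2,4,3)]) (rule dim_le_of_right_inverse)
qed

abbreviation gram :: "('v \<Rightarrow> 'v \<Rightarrow> 'a) \<Rightarrow> 'v list \<Rightarrow> 'a mat" where
  "gram \<beta> bs \<equiv> mat (length bs) (length bs) (\<lambda>(i, j). \<beta> (bs ! i) (bs ! j))"

text \<open>\<open>has_gw_class\<close> allows any basis of the quotient; this shows that the choice
  does not affect the class. The change of basis P holds only modulo W, but W lies in the radical,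
  so the congruence of Gram matrices by P is exact.\<close>

lemma gram_isometric:
  fixes sc :: "'a::field \<Rightarrow> 'v::ab_group_add \<Rightarrow> 'v"
  assumes sc: "vector_space sc" and W: "module.subspace sc W" and V: "module.subspace sc V"
    and WV: "W \<subseteq> V"
    and bs: "quot_basis sc V W bs" and cs: "quot_basis sc V W cs"
    and add: "\<And>u v w. u \<in> V \<Longrightarrow> v \<in> V \<Longrightarrow> w \<in> V \<Longrightarrow> \<beta> (u + v) w = \<beta> u w + \<beta> v w"
    and scl: "\<And>c u w. u \<in> V \<Longrightarrow> w \<in> V \<Longrightarrow> \<beta> (sc c u) w = c * \<beta> u w"
    and sym: "\<And>u w. u \<in> V \<Longrightarrow> w \<in> V \<Longrightarrow> \<beta> u w = \<beta> w u"
    and rad: "\<And>u w. u \<in> W \<Longrightarrow> w \<in> V \<Longrightarrow> \<beta> u w = 0"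
    and form: "is_form (gram \<beta> bs)"
  shows "isometric (gram \<beta> bs) (gram \<beta> cs)"
proof -
  interpret vector_space sc by fact
  let ?n = "length bs"
  have len: "length cs = ?n" using quot_basis_length[OF sc W cs bs] .
  have bV: "bs ! j \<in> V" if "j < ?n" for j
    using bs nth_mem[OF that] by (auto simp: quot_basis_def)
  have cV: "cs ! j \<in> V" if "j < ?n" for j
    using cs len nth_mem[of j cs] that by (auto simp: quot_basis_def)
  obtain P Q where P: "P \<in> carrier_mat ?n ?n" and Q: "Q \<in> carrier_mat ?n ?n"
    and PQ: "P * Q = 1\<^sub>m ?n"
    and p: "\<And>j. j < ?n \<Longrightarrow> cs ! j - (\<Sum>i<?n. sc (P $$ (i, j)) (bs ! i)) \<in> W"
    by (rule quot_basis_change[OF sc W bs cs, unfolded len]) blast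
  have lin: "\<beta> (\<Sum>i<k. sc (c i) (bs ! i)) w = (\<Sum>i<k. c i * \<beta> (bs ! i) w)"
    if "w \<in> V" "k \<le> ?n" for c w k
    using that(2)
  proof (induction k)
    case 0
    show ?case using rad[OF subspace_0[OF W] that(1)] by simp
  next
    case (Suc k)
    have "(\<Sum>i<k. sc (c i) (bs ! i)) \<in> V"
      using Suc.prems V bV by (intro subspace_sum subspace_scale) auto
    thus ?case using Suc that(1) V bV by (simp add: add scl subspace_scale)
  qed
  have red: "\<beta> (cs ! j) w = (\<Sum>i<?n. P $$ (i, j) * \<beta> (bs ! i) w)" if "j < ?n" "w \<in> V" for j w
  proof -
    let ?s = "\<Sum>i<?n. sc (P $$ (i, j)) (bs ! i)"
    have s: "?s \<in> V" using V bV by (intro subspace_sum subspace_scale) auto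
    have "\<beta> (cs ! j) w = \<beta> ((cs ! j - ?s) + ?s) w" by simp
    also have "\<dots> = \<beta> (cs ! j - ?s) w + \<beta> ?s w"
      using p[OF that(1)] WV s that by (intro add) auto
    also have "\<beta> (cs ! j - ?s) w = 0" using p[OF that(1)] that by (intro rad) auto
    finally show ?thesis using lin[OF that(2), of ?n] by simp
  qed
  have "gram \<beta> cs = transpose_mat P * gram \<beta> bs * P"
  proof (rule eq_matI)
    fix i j assume "i < dim_row (transpose_mat P * gram \<beta> bs * P)"
      "j < dim_col (transpose_mat P * gram \<beta> bs * P)"
    hence ij: "i < ?n" "j < ?n" using P by auto
    have "\<beta> (cs ! i) (cs ! j) = (\<Sum>l<?n. P $$ (l, i) * \<beta> (cs ! j) (bs ! l))"
      using red[OF ij(1) cV[OF ij(2)]] sym bV cV ij by simp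
    also have "\<dots> = (\<Sum>l<?n. \<Sum>k<?n. P $$ (l, i) * (P $$ (k, j) * \<beta> (bs ! l) (bs ! k)))"
      using red ij bV sym by (simp add: sum_distrib_left)
    also have "\<dots> = (\<Sum>k<?n. \<Sum>l<?n. P $$ (l, i) * (P $$ (k, j) * \<beta> (bs ! l) (bs ! k)))"
      by (rule sum.swap)
    also have "\<dots> = (\<Sum>k<?n. (\<Sum>l<?n. P $$ (l, i) * \<beta> (bs ! l) (bs ! k)) * P $$ (k, j))"
      by (intro sum.cong refl) (simp add: sum_distrib_left mult_ac)
    also have "\<dots> = (transpose_mat P * gram \<beta> bs * P) $$ (i, j)"
      using ij P by (simp add: scalar_prod_def atLeast0LessThan)
    finally show "gram \<beta> cs $$ (i, j) = (transpose_mat P * gram \<beta> bs * P) $$ (i, j)"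
      using ij len by simp
  qed (use P len in auto)
  thus ?thesis using form P Q PQ by (intro isometricI[of _ ?n P Q]) auto
qed

section \<open>Valuation rings of a rational function field\<close>

text \<open>A closed point without the demand that it differ from the whole field. In this form the
  notion passes to preimages under a comorphism by a direct check of the ring axioms.\<close>

definition valuation_ring :: "('l::field \<Rightarrow> 'k::field) \<Rightarrow> 'k set \<Rightarrow> bool" where
  "valuation_ring \<iota> q \<longleftrightarrow> range \<iota> \<subseteq> q \<and>
     (\<forall>a\<in>q. \<forall>b\<in>q. a - b \<in> q \<and> a * b \<in> q) \<and> (\<forall>a. a \<in> q \<or> inverse a \<in> q)"

definition units :: "'k::field set \<Rightarrow> 'k set" where
  "units q = {a \<in> q. a \<noteq> 0 \<and> inverse a \<in> q}"

lemma closed_points_iff: "q \<in> closed_points \<iota> \<longleftrightarrow> valuation_ring \<iota> q \<and> q \<noteq> UNIV"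
  by (auto simp: closed_points_def valuation_ring_def)

section \<open>Evaluation of polynomials along a field embedding\<close>

context field_hom
begin

lemma poly_eval_0 [simp]: "poly_eval hom 0 x = 0"
  by (simp add: poly_eval_def)

lemma poly_eval_pCons [simp]: "poly_eval hom (pCons c a) x = hom c + x * poly_eval hom a x"
  by (cases "a = 0 \<and> c = 0") (auto simp: poly_eval_def map_poly_pCons)

lemma poly_eval_1 [simp]: "poly_eval hom 1 x = 1"
  unfolding one_pCons by simp

lemma poly_eval_add: "poly_eval hom (a + b) x = poly_eval hom a x + poly_eval hom b x"
proof (induction a arbitrary: b)
  case IH: (pCons c a)
  show ?case
  proof (cases b)
    case (pCons d b')
    thus ?thesis using IH.IH[of b'] by (simp add: hom_add algebra_simps)
  qed
qed simp

lemma poly_eval_smult: "poly_eval hom (smult c a) x = hom c * poly_eval hom a x"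
  by (induction a) (simp_all add: hom_mult algebra_simps)

lemma poly_eval_mult: "poly_eval hom (a * b) x = poly_eval hom a x * poly_eval hom b x"
  by (induction a) (simp_all add: poly_eval_add poly_eval_smult algebra_simps)

lemma poly_eval_minus: "poly_eval hom (- a) x = - poly_eval hom a x"
  by (induction a) (simp_all add: algebra_simps hom_uminus)

lemma poly_eval_diff: "poly_eval hom (a - b) x = poly_eval hom a x - poly_eval hom b x"
  using poly_eval_add[of a "- b" x] by (simp add: poly_eval_minus)

lemma poly_eval_power: "poly_eval hom (a ^ n) x = poly_eval hom a x ^ n"
  by (induction n) (simp_all add: poly_eval_mult)

lemma poly_eval_pcompose: "poly_eval hom (a \<circ>\<^sub>p b) x = poly_eval hom a (poly_eval hom b x)"
  by (induction a) (simp_all add: pcompose_pCons poly_eval_add poly_eval_mult)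

lemma poly_eval_reflect:
  assumes "x \<noteq> 0"
  shows "poly_eval hom (reflect_poly a) x = x ^ degree a * poly_eval hom a (inverse x)"
proof -
  have d: "degree (map_poly hom a) = degree a" by (rule degree_map_poly) simp
  have "map_poly hom (reflect_poly a) = reflect_poly (map_poly hom a)"
    by (rule poly_eqI) (simp add: coeff_map_poly coeff_reflect_poly d)
  thus ?thesis using assms by (simp add: poly_eval_def poly_reflect_poly_nz d)
qed

lemma poly_eval_taylor: "\<exists>b. poly_eval hom a x = hom (poly a c) + (x - hom c) * poly_eval hom b x"
proof -
  have "poly (a - [:poly a c:]) c = 0" by simp
  then obtain b where b: "a - [:poly a c:] = [:- c, 1:] * b"
    by (metis dvd_def poly_eq_0_iff_dvd)
  have "poly_eval hom a x = poly_eval hom ((a - [:poly a c:]) + [:poly a c:]) x" by simp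
  also have "\<dots> = hom (poly a c) + (x - hom c) * poly_eval hom b x"
    unfolding b poly_eval_add poly_eval_mult by (simp add: hom_uminus)
  finally show ?thesis by blast
qed

end

section \<open>Rules of calculus for derivations\<close>

lemma derivations_0:
  assumes "E \<in> derivations \<iota>"
  shows "E 0 = 0" "E 1 = 0" "E (- a) = - E a" "E (a - b) = E a - E b"
proof -
  have add: "E (x + y) = E x + E y" for x y using assms by (simp add: derivations_def)
  have "E (x * y) = x * E y + y * E x" for x y using assms by (simp add: derivations_def)
  from this[of 1 1] have "E 1 = E 1 + E 1" by simp
  thus "E 1 = 0" by (metis add_cancel_right_right)
  show 0: "E 0 = 0" using add[of 0 0] by (metis add.right_neutral add_cancel_right_right)
  show m: "E (- a) = - E a" for a using add[of a "- a"] 0 by (simp add: eq_neg_iff_add_eq_0 add.commute)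
  show "E (a - b) = E a - E b" using add[of a "- b"] m by simp
qed

lemma derivations_scale:
  assumes "E \<in> derivations \<iota>"
  shows "(\<lambda>z. c * E z) \<in> derivations \<iota>"
proof -
  have "c * E (a + b) = c * E a + c * E b" "c * E (a * b) = a * (c * E b) + b * (c * E a)"
    "c * E (\<iota> d) = 0" for a b d
    using assms by (simp_all add: derivations_def distrib_left mult.left_commute)
  thus ?thesis by (simp add: derivations_def)
qed

lemma derivations_divide:
  assumes "E \<in> derivations \<iota>" "v \<noteq> 0"
  shows "E (u / v) = (v * E u - u * E v) / v ^ 2"
proof -
  have "E (u / v * v) = (u / v) * E v + v * E (u / v)"
    using assms(1) unfolding derivations_def by blast
  hence "v * E u = u * E v + v ^ 2 * E (u / v)"
    using assms(2) by (simp add: field_simps power2_eq_square)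
  thus ?thesis using assms(2) by (simp add: field_simps)
qed

lemma derivations_power:
  assumes "E \<in> derivations \<iota>"
  shows "E (u ^ n) = of_nat n * u ^ (n - 1) * E u"
proof (induction n)
  case 0 show ?case using derivations_0[OF assms] by simp
next
  case (Suc n)
  have "E (u * u ^ n) = u * E (u ^ n) + u ^ n * E u"
    using assms by (simp add: derivations_def)
  thus ?case using Suc by (cases n) (simp_all add: algebra_simps)
qed

lemma (in field_hom) derivations_poly_eval:
  assumes "E \<in> derivations hom"
  shows "E (poly_eval hom a x) = poly_eval hom (pderiv a) x * E x"
proof (induction a)
  case 0 show ?case using derivations_0[OF assms] by simp
next
  case (pCons c a)
  have "E (hom c + x * poly_eval hom a x) = x * E (poly_eval hom a x) + poly_eval hom a x * E x"
    using assms by (simp add: derivations_def)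
  thus ?case using pCons by (simp add: pderiv_pCons poly_eval_add algebra_simps)
qed

section \<open>Units and the maximal ideal of a valuation ring\<close>

context
  fixes \<iota> :: "'l::field \<Rightarrow> 'k::field" and q :: "'k set"
  assumes q: "valuation_ring \<iota> q"
begin

lemma valuation_ring_const: "\<iota> c \<in> q"
  using q by (auto simp: valuation_ring_def)

lemma valuation_ring_diff: "a \<in> q \<Longrightarrow> b \<in> q \<Longrightarrow> a - b \<in> q"
  using q by (auto simp: valuation_ring_def)

lemma valuation_ring_mult: "a \<in> q \<Longrightarrow> b \<in> q \<Longrightarrow> a * b \<in> q"
  using q by (auto simp: valuation_ring_def)

lemma valuation_ring_cases: "a \<in> q \<or> inverse a \<in> q"
  using q by (auto simp: valuation_ring_def)

lemma valuation_ring_0: "0 \<in> q"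
  using valuation_ring_diff[OF valuation_ring_const[of undefined] valuation_ring_const[of undefined]]
  by simp

lemma valuation_ring_1: "1 \<in> q"
  using valuation_ring_cases[of 1] by simp

lemma valuation_ring_minus: "a \<in> q \<Longrightarrow> - a \<in> q"
  using valuation_ring_diff[OF valuation_ring_0] by force

lemma valuation_ring_add: "a \<in> q \<Longrightarrow> b \<in> q \<Longrightarrow> a + b \<in> q"
  using valuation_ring_diff[OF _ valuation_ring_minus] by force

lemma valuation_ring_power: "a \<in> q \<Longrightarrow> a ^ n \<in> q"
  by (induction n) (auto intro: valuation_ring_1 valuation_ring_mult)

lemmas valuation_ring_closed = valuation_ring_0 valuation_ring_1 valuation_ring_const
  valuation_ring_add valuation_ring_diff valuation_ring_minus valuation_ring_mult
  valuation_ring_power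

lemma max_ideal_mult:
  assumes "r \<in> q" "a \<in> max_ideal q"
  shows "r * a \<in> max_ideal q"
proof -
  have "inverse (r * a) \<notin> q" if "r * a \<noteq> 0"
  proof
    assume "inverse (r * a) \<in> q"
    hence "r * inverse (r * a) \<in> q" using assms(1) by (rule valuation_ring_mult[rotated])
    also have "r * inverse (r * a) = inverse a" using that by simp
    finally show False using assms(2) that by (simp add: max_ideal_def)
  qed
  moreover have "r * a \<in> q" using assms by (auto simp: max_ideal_def intro: valuation_ring_mult)
  ultimately show ?thesis by (auto simp: max_ideal_def)
qed

lemma max_ideal_mult_right: "a \<in> max_ideal q \<Longrightarrow> r \<in> q \<Longrightarrow> a * r \<in> max_ideal q"
  by (subst mult.commute) (rule max_ideal_mult)

lemma max_ideal_subset: "a \<in> max_ideal q \<Longrightarrow> a \<in> q"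
  by (simp add: max_ideal_def)

text \<open>For nonzero a and b, one of a / b and b / a lies in q, so a + b is a multiple of b or of
  a with a factor in q.\<close>

lemma max_ideal_add:
  assumes "a \<in> max_ideal q" "b \<in> max_ideal q"
  shows "a + b \<in> max_ideal q"
proof -
  have *: "a + b \<in> max_ideal q" if "a \<in> max_ideal q" "b \<in> max_ideal q" "b \<noteq> 0" "a / b \<in> q" for a b
  proof -
    have "(a / b + 1) * b \<in> max_ideal q"
      using that by (intro max_ideal_mult valuation_ring_closed)
    moreover have "(a / b + 1) * b = a + b" using that by (simp add: distrib_right)
    ultimately show ?thesis by simp
  qed
  show ?thesis
  proof (cases "a = 0 \<or> b = 0")
    case False
    have "a / b \<in> q \<or> b / a \<in> q" using valuation_ring_cases[of "a / b"] by simp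
    thus ?thesis using *[of a b] *[of b a] assms False by (auto simp: add.commute)
  qed (use assms in auto)
qed

lemma max_ideal_diff:
  assumes "a \<in> max_ideal q" "b \<in> max_ideal q"
  shows "a - b \<in> max_ideal q"
  using max_ideal_add[OF assms(1) max_ideal_mult[OF valuation_ring_minus[OF valuation_ring_1] assms(2)]]
  by simp

lemma max_ideal_0: "0 \<in> max_ideal q"
  by (simp add: max_ideal_def valuation_ring_0)

lemma max_ideal_1: "1 \<notin> max_ideal q"
  by (simp add: max_ideal_def valuation_ring_1)

lemma units_iff: "a \<in> units q \<longleftrightarrow> a \<in> q \<and> a \<notin> max_ideal q"
  by (auto simp: units_def max_ideal_def)

lemma units_const: "\<iota> c \<in> units q \<longleftrightarrow> \<iota> c \<noteq> 0" if "field_hom \<iota>"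
proof -
  interpret field_hom \<iota> by fact
  have "inverse (\<iota> c) \<in> q" using valuation_ring_const[of "inverse c"] by (simp add: hom_inverse)
  thus ?thesis by (auto simp: units_def valuation_ring_const)
qed

lemma units_mult: "a \<in> units q \<Longrightarrow> b \<in> units q \<Longrightarrow> a * b \<in> units q"
  by (auto simp: units_def valuation_ring_mult)

lemma units_1: "1 \<in> units q"
  by (simp add: units_def valuation_ring_1)

lemma units_power: "a \<in> units q \<Longrightarrow> a ^ n \<in> units q"
  by (induction n) (auto intro: units_mult units_1)

lemma units_inverse: "a \<in> units q \<Longrightarrow> inverse a \<in> units q"
  by (auto simp: units_def)

lemma units_minus: "a \<in> units q \<Longrightarrow> - a \<in> units q"
  by (auto simp: units_def intro: valuation_ring_minus)

lemma units_add_max_ideal: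
  assumes "a \<in> units q" "b \<in> max_ideal q"
  shows "a + b \<in> units q"
  using assms max_ideal_diff[of "a + b" b] valuation_ring_add max_ideal_subset
  by (auto simp: units_iff)

lemma units_cancel_right: "a * u \<in> q \<longleftrightarrow> a \<in> q" if "u \<in> units q"
proof
  assume "a * u \<in> q"
  hence "a * u * inverse u \<in> q" by (rule valuation_ring_mult) (use that in \<open>simp add: units_def\<close>)
  moreover have "a * u * inverse u = a" using that by (simp add: units_def)
  ultimately show "a \<in> q" by simp
qed (use that in \<open>auto simp: units_def intro: valuation_ring_mult\<close>)

lemma poly_eval_closed:
  assumes "field_hom \<iota>" "x \<in> q"
  shows "poly_eval \<iota> a x \<in> q"
proof -
  interpret field_hom \<iota> by fact
  show ?thesis using assms(2) by (induction a) (auto intro!: valuation_ring_closed)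
qed

end

text \<open>The residue of x is c, so b(x) differs from the constant b(c) by an element of the
  maximal ideal, and a constant is a unit unless it is zero.\<close>

lemma (in field_hom) poly_eval_unit_iff:
  assumes q: "valuation_ring hom q" and xq: "x \<in> q" and x: "x - hom c \<in> max_ideal q"
  shows "poly_eval hom b x \<in> units q \<longleftrightarrow> poly b c \<noteq> 0"
proof -
  obtain b' where b': "poly_eval hom b x = hom (poly b c) + (x - hom c) * poly_eval hom b' x"
    using poly_eval_taylor by blast
  have m: "(x - hom c) * poly_eval hom b' x \<in> max_ideal q"
    by (intro max_ideal_mult_right[OF q x] poly_eval_closed[OF q field_hom_axioms xq])
  show ?thesis
  proof
    assume "poly_eval hom b x \<in> units q"
    thus "poly b c \<noteq> 0" using m b' units_iff[OF q] by force
  next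
    assume "poly b c \<noteq> 0"
    hence "hom (poly b c) \<in> units q" using units_const[OF q field_hom_axioms] by simp
    thus "poly_eval hom b x \<in> units q" unfolding b' using m by (rule units_add_max_ideal[OF q])
  qed
qed

text \<open>The field L(\<tau>) with the derivation d/d\<tau>. The coordinate is left abstract so
  that every statement can be read again for 1/\<tau>, which turns results at the zero of \<tau>
  into results at infinity.\<close>

locale rational_function_field = field_hom \<iota> for \<iota> :: "'l::field \<Rightarrow> 'k::field" +
  fixes \<tau> :: 'k and D :: "'k \<Rightarrow> 'k"
  assumes transcendental: "a \<noteq> 0 \<Longrightarrow> poly_eval \<iota> a \<tau> \<noteq> 0"
    and generated: "\<exists>a b. b \<noteq> 0 \<and> z = poly_eval \<iota> a \<tau> / poly_eval \<iota> b \<tau>"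
    and derivation: "D \<in> derivations \<iota>"
    and derivation_coordinate: "D \<tau> = 1"
begin

lemma coordinate_nonzero: "\<tau> \<noteq> 0"
  using transcendental[of "[:0, 1:]"] by simp

text \<open>By the quotient and chain rules a derivation trivial on constants is determined by its
  value at \<tau>; hence the tangent sheaf has rank one.\<close>

lemma derivation_multiple:
  assumes "E \<in> derivations \<iota>"
  shows "E = (\<lambda>z. E \<tau> * D z)"
proof
  fix z
  obtain a b where b: "b \<noteq> 0" and z: "z = poly_eval \<iota> a \<tau> / poly_eval \<iota> b \<tau>"
    using generated by blast
  show "E z = E \<tau> * D z"
    unfolding z derivations_divide[OF assms transcendental[OF b]]
      derivations_divide[OF derivation transcendental[OF b]]
      derivations_poly_eval[OF assms] derivations_poly_eval[OF derivation] derivation_coordinate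
    by (simp add: field_simps)
qed

text \<open>A fraction with denominator of minimal degree works: otherwise a nonunit \<open>\<pi>\<close> of minimal
  degree among the polynomials could be cancelled.\<close>

lemma valuation_ring_fraction:
  assumes q: "valuation_ring \<iota> q" and \<tau>: "\<tau> \<in> q" and z: "z \<in> q"
  shows "\<exists>a b. z = poly_eval \<iota> a \<tau> / poly_eval \<iota> b \<tau> \<and> poly_eval \<iota> b \<tau> \<in> units q"
proof -
  have cl: "poly_eval \<iota> a \<tau> \<in> q" for a by (rule poly_eval_closed[OF q field_hom_axioms \<tau>])
  define rep where "rep b \<longleftrightarrow> b \<noteq> 0 \<and> (\<exists>a. z = poly_eval \<iota> a \<tau> / poly_eval \<iota> b \<tau>)" for b
  have "\<exists>b. rep b" using generated[of z] by (auto simp: rep_def)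
  then obtain b where b: "rep b" and b_min: "\<And>b'. rep b' \<Longrightarrow> degree b \<le> degree b'"
    using ex_has_least_nat[of rep _ degree] by blast
  then obtain a where b0: "b \<noteq> 0" and za: "z = poly_eval \<iota> a \<tau> / poly_eval \<iota> b \<tau>"
    by (auto simp: rep_def)
  show ?thesis
  proof (cases "poly_eval \<iota> b \<tau> \<in> units q")
    case False
    define nonunit where "nonunit c \<longleftrightarrow> c \<noteq> 0 \<and> poly_eval \<iota> c \<tau> \<in> max_ideal q" for c
    have nb: "nonunit b" using False cl b0 by (simp add: nonunit_def units_iff[OF q])
    then obtain \<pi> where \<pi>: "nonunit \<pi>" and \<pi>_min: "\<And>c. nonunit c \<Longrightarrow> degree \<pi> \<le> degree c"
      using ex_has_least_nat[of nonunit _ degree] by blast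
    have "degree \<pi> \<noteq> 0"
    proof
      assume "degree \<pi> = 0"
      then obtain c where "\<pi> = [:c:]" by (rule degree_eq_zeroE)
      with \<pi> have "\<iota> c \<noteq> 0" "\<iota> c \<in> max_ideal q" by (auto simp: nonunit_def)
      thus False using units_const[OF q field_hom_axioms, of c] units_iff[OF q] by blast
    qed
    have dvd: "\<pi> dvd c" if "poly_eval \<iota> c \<tau> \<in> max_ideal q" for c
    proof (rule ccontr)
      assume "\<not> \<pi> dvd c"
      hence n0: "c mod \<pi> \<noteq> 0" by (simp add: mod_eq_0_iff_dvd)
      have "poly_eval \<iota> (c - c div \<pi> * \<pi>) \<tau> \<in> max_ideal q"
        unfolding poly_eval_diff poly_eval_mult using that \<pi> cl
        by (intro max_ideal_diff[OF q] max_ideal_mult[OF q]) (auto simp: nonunit_def)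
      hence "nonunit (c mod \<pi>)" using n0 by (simp add: nonunit_def minus_div_mult_eq_mod)
      thus False using \<pi>_min[of "c mod \<pi>"] n0 degree_mod_less'[of \<pi> c] \<pi>
        by (auto simp: nonunit_def)
    qed
    have "poly_eval \<iota> a \<tau> = z * poly_eval \<iota> b \<tau>" using za transcendental[OF b0] by simp
    also have "\<dots> \<in> max_ideal q" using nb z by (intro max_ideal_mult[OF q]) (auto simp: nonunit_def)
    finally obtain a1 where a1: "a = \<pi> * a1" using dvd by blast
    obtain b1 where b1: "b = \<pi> * b1" using dvd nb by (auto simp: nonunit_def)
    have "poly_eval \<iota> \<pi> \<tau> \<noteq> 0" using transcendental \<pi> by (simp add: nonunit_def)
    hence "rep b1" using b0 za unfolding rep_def a1 b1 poly_eval_mult by auto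
    hence "degree b \<le> degree b1" by (rule b_min)
    thus ?thesis using b0 \<open>degree \<pi> \<noteq> 0\<close> unfolding b1 by (auto simp: degree_mult_eq)
  qed (use za in blast)
qed

text \<open>With z written over a denominator that is a unit, the quotient rule produces the square
  of that unit as denominator and a polynomial in \<tau> as numerator.\<close>

lemma derivation_closed:
  assumes q: "valuation_ring \<iota> q" and \<tau>: "\<tau> \<in> q" and z: "z \<in> q"
  shows "D z \<in> q"
proof -
  obtain a b where z: "z = poly_eval \<iota> a \<tau> / poly_eval \<iota> b \<tau>" and b: "poly_eval \<iota> b \<tau> \<in> units q"
    using valuation_ring_fraction[OF assms] by blast
  have cl: "poly_eval \<iota> a \<tau> \<in> q" for a by (rule poly_eval_closed[OF q field_hom_axioms \<tau>])
  have b0: "poly_eval \<iota> b \<tau> \<noteq> 0" using b by (simp add: units_def)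
  have b2: "inverse (poly_eval \<iota> b \<tau> ^ 2) \<in> q"
    using units_inverse[OF q units_power[OF q b]] by (simp add: units_def)
  show ?thesis
    unfolding z derivations_divide[OF derivation b0] derivations_poly_eval[OF derivation]
    unfolding divide_inverse derivation_coordinate
    by (intro valuation_ring_mult[OF q] valuation_ring_diff[OF q] cl valuation_ring_1[OF q] b2)
qed

lemma poly_eval_coordinate_unit_iff:
  assumes q: "valuation_ring \<iota> q" and \<tau>: "\<tau> \<in> max_ideal q"
  shows "poly_eval \<iota> b \<tau> \<in> units q \<longleftrightarrow> poly b 0 \<noteq> 0"
  using poly_eval_unit_iff[OF q max_ideal_subset[OF q \<tau>], of 0] \<tau> by simp

text \<open>The zero of \<tau> is a rational point: for z = a(\<tau>)/b(\<tau>) with b(\<tau>) a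
  unit, b(0) is nonzero and the residue is a(0)/b(0).\<close>

lemma residue_decomposition:
  assumes q: "valuation_ring \<iota> q" and \<tau>: "\<tau> \<in> max_ideal q" and z: "z \<in> q"
  shows "\<exists>c. \<exists>w\<in>q. z = \<iota> c + \<tau> * w"
proof -
  have \<tau>q: "\<tau> \<in> q" using \<tau> by (simp add: max_ideal_def)
  have cl: "poly_eval \<iota> a \<tau> \<in> q" for a by (rule poly_eval_closed[OF q field_hom_axioms \<tau>q])
  obtain a b where z: "z = poly_eval \<iota> a \<tau> / poly_eval \<iota> b \<tau>" and b: "poly_eval \<iota> b \<tau> \<in> units q"
    using valuation_ring_fraction[OF q \<tau>q z] by blast
  obtain a' where a': "poly_eval \<iota> a \<tau> = \<iota> (poly a 0) + \<tau> * poly_eval \<iota> a' \<tau>"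
    using poly_eval_taylor[of a \<tau> 0] by auto
  obtain b' where b': "poly_eval \<iota> b \<tau> = \<iota> (poly b 0) + \<tau> * poly_eval \<iota> b' \<tau>"
    using poly_eval_taylor[of b \<tau> 0] by auto
  have b0: "poly b 0 \<noteq> 0" using b poly_eval_coordinate_unit_iff[OF q \<tau>] by simp
  define c where "c = poly a 0 / poly b 0"
  have c: "\<iota> c * \<iota> (poly b 0) = \<iota> (poly a 0)" using b0 by (simp add: c_def hom_div)
  define w where "w = (poly_eval \<iota> a' \<tau> - \<iota> c * poly_eval \<iota> b' \<tau>) * inverse (poly_eval \<iota> b \<tau>)"
  have "w \<in> q" unfolding w_def using b cl
    by (intro valuation_ring_mult[OF q] valuation_ring_diff[OF q] valuation_ring_const[OF q])
      (auto simp: units_def)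
  moreover have "z = \<iota> c + \<tau> * w"
  proof -
    have nz: "poly_eval \<iota> b \<tau> \<noteq> 0" using b by (simp add: units_def)
    have "(\<iota> c + \<tau> * w) * poly_eval \<iota> b \<tau> =
        \<iota> c * poly_eval \<iota> b \<tau> + \<tau> * (poly_eval \<iota> a' \<tau> - \<iota> c * poly_eval \<iota> b' \<tau>)"
      unfolding w_def using nz by (simp add: algebra_simps)
    also have "\<dots> = poly_eval \<iota> a \<tau>" unfolding a' b' using c by (simp add: algebra_simps)
    finally show ?thesis unfolding z using nz by (simp add: field_simps)
  qed
  ultimately show ?thesis by blast
qed

lemma max_ideal_principal:
  assumes q: "valuation_ring \<iota> q" and \<tau>: "\<tau> \<in> max_ideal q"
  shows "max_ideal q = {\<tau> * w | w. w \<in> q}"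
proof (intro equalityI subsetI)
  fix z assume z: "z \<in> max_ideal q"
  obtain c w where w: "w \<in> q" and e: "z = \<iota> c + \<tau> * w"
    using residue_decomposition[OF q \<tau>, of z] z by (auto simp: max_ideal_def)
  have "\<iota> c = z - \<tau> * w" using e by simp
  also have "\<dots> \<in> max_ideal q" using z w \<tau> by (intro max_ideal_diff[OF q] max_ideal_mult_right[OF q])
  finally have "\<iota> c = 0" using units_const[OF q field_hom_axioms, of c] units_iff[OF q] by blast
  thus "z \<in> {\<tau> * w | w. w \<in> q}" using e w by auto
qed (use max_ideal_mult_right[OF q \<tau>] in auto)

text \<open>Translates powers of the maximal ideal, defined by sums of products, into divisibility
  by powers of \<tau>. Read for the inverse coordinate, it is the tool for orders of vanishing at
  infinity.\<close>

lemma ideal_power_principal: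
  assumes q: "valuation_ring \<iota> q" and \<tau>: "\<tau> \<in> max_ideal q"
  shows "ideal_power q n = {\<tau> ^ n * w | w. w \<in> q}"
proof (induction n)
  case (Suc n)
  show ?case
  proof (intro equalityI subsetI)
    fix z assume "z \<in> ideal_power q (Suc n)"
    then obtain xs where z: "z = (\<Sum>(a, b)\<leftarrow>xs. a * b)"
      and "set xs \<subseteq> max_ideal q \<times> {\<tau> ^ n * w | w. w \<in> q}"
      unfolding ideal_power.simps Suc.IH by blast
    from this(2) have "(\<Sum>(a, b)\<leftarrow>xs. a * b) \<in> {\<tau> ^ Suc n * w | w. w \<in> q}"
    proof (induction xs)
      case Nil
      have "\<tau> ^ Suc n * 0 \<in> {\<tau> ^ Suc n * w | w. w \<in> q}" using valuation_ring_0[OF q] by blast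
      thus ?case by simp
    next
      case (Cons x xs)
      then obtain u v w where "x = (\<tau> * u, \<tau> ^ n * v)" "u \<in> q" "v \<in> q" "w \<in> q"
        "(\<Sum>(a, b)\<leftarrow>xs. a * b) = \<tau> ^ Suc n * w"
        unfolding max_ideal_principal[OF assms] by auto
      hence "(\<Sum>(a, b)\<leftarrow>x # xs. a * b) = \<tau> ^ Suc n * (u * v + w)" "u * v + w \<in> q"
        by (simp add: algebra_simps, intro valuation_ring_add[OF q] valuation_ring_mult[OF q])
      thus ?case by blast
    qed
    thus "z \<in> {\<tau> ^ Suc n * w | w. w \<in> q}" using z by simp
  next
    fix z assume "z \<in> {\<tau> ^ Suc n * w | w. w \<in> q}"
    then obtain w where "w \<in> q" "z = \<tau> * (\<tau> ^ n * w)" by (auto simp: mult.assoc)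
    hence "z = (\<Sum>(a, b)\<leftarrow>[(\<tau>, \<tau> ^ n * w)]. a * b)"
      "set [(\<tau>, \<tau> ^ n * w)] \<subseteq> max_ideal q \<times> ideal_power q n"
      unfolding Suc.IH using \<tau> by auto
    thus "z \<in> ideal_power q (Suc n)" unfolding ideal_power.simps by blast
  qed
qed simp

text \<open>Each ring consists of the fractions whose denominator is a unit in it, and whether
  b(\<tau>) is a unit depends only on b(0).\<close>

lemma valuation_ring_unique:
  assumes q: "valuation_ring \<iota> q" "\<tau> \<in> max_ideal q" and q': "valuation_ring \<iota> q'" "\<tau> \<in> max_ideal q'"
  shows "q = q'"
proof -
  have "q \<subseteq> q'" if q: "valuation_ring \<iota> q" "\<tau> \<in> max_ideal q"
    and q': "valuation_ring \<iota> q'" "\<tau> \<in> max_ideal q'" for q q'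
  proof
    fix z assume "z \<in> q"
    have \<tau>q: "\<tau> \<in> q" "\<tau> \<in> q'" using q q' by (auto simp: max_ideal_def)
    have cl: "poly_eval \<iota> a \<tau> \<in> q" "poly_eval \<iota> a \<tau> \<in> q'" for a
      by (rule poly_eval_closed[OF q(1) field_hom_axioms \<tau>q(1)],
          rule poly_eval_closed[OF q'(1) field_hom_axioms \<tau>q(2)])
    obtain a b where z: "z = poly_eval \<iota> a \<tau> / poly_eval \<iota> b \<tau>" and b: "poly_eval \<iota> b \<tau> \<in> units q"
      using valuation_ring_fraction[OF q(1) \<tau>q(1) \<open>z \<in> q\<close>] by blast
    have "poly_eval \<iota> b \<tau> \<in> units q'"
      using b unfolding poly_eval_coordinate_unit_iff[OF q] poly_eval_coordinate_unit_iff[OF q'] .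
    thus "z \<in> q'" unfolding z divide_inverse
      by (intro valuation_ring_mult[OF q'(1)] cl(2)) (simp add: units_def)
  qed
  from this[OF q q'] this[OF q' q] show ?thesis by (rule equalityI)
qed

lemma finite_points_zero: "finite {q \<in> closed_points \<iota>. \<tau> \<in> max_ideal q}"
proof (cases "{q \<in> closed_points \<iota>. \<tau> \<in> max_ideal q} = {}")
  case False
  then obtain q0 where "q0 \<in> closed_points \<iota>" "\<tau> \<in> max_ideal q0" by blast
  hence "{q \<in> closed_points \<iota>. \<tau> \<in> max_ideal q} \<subseteq> {q0}"
    using valuation_ring_unique by (auto simp: closed_points_iff)
  thus ?thesis by (rule finite_subset) simp
qed (simp only: finite.emptyI)

text \<open>The derivation dual to d(1/\<tau>) is - \<tau>^2 d/d\<tau>. Generation and transcendence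
  pass to the new coordinate through reflected polynomials: a(\<tau>) is \<tau>^(deg a) times the
  reflection of a evaluated at 1/\<tau>.\<close>

lemma inverse_coordinate: "rational_function_field \<iota> (inverse \<tau>) (\<lambda>z. - (\<tau> ^ 2) * D z)"
proof
  show "poly_eval \<iota> a (inverse \<tau>) \<noteq> 0" if "a \<noteq> 0" for a
    using transcendental[of "reflect_poly a"] that poly_eval_reflect[OF coordinate_nonzero, of a]
    by auto
next
  fix z
  obtain a b where b: "b \<noteq> 0" and z: "z = poly_eval \<iota> a \<tau> / poly_eval \<iota> b \<tau>"
    using generated by blast
  have r: "poly_eval \<iota> c \<tau> = \<tau> ^ degree c * poly_eval \<iota> (reflect_poly c) (inverse \<tau>)" for c
    using poly_eval_reflect[of "inverse \<tau>" c] coordinate_nonzero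
    by (simp add: mult.assoc[symmetric] power_mult_distrib[symmetric])
  have m: "poly_eval \<iota> (monom 1 n) x = x ^ n" for n x
    by (induction n) (simp_all add: monom_0 monom_Suc)
  have "poly_eval \<iota> (reflect_poly b) (inverse \<tau>) \<noteq> 0"
    using transcendental[OF b] r[of b] by auto
  \<comment> \<open>The degrees change places because \<tau>^(deg a) / \<tau>^(deg b) equals
    (1/\<tau>)^(deg b) / (1/\<tau>)^(deg a).\<close>
  hence "z = poly_eval \<iota> (monom 1 (degree b) * reflect_poly a) (inverse \<tau>) /
      poly_eval \<iota> (monom 1 (degree a) * reflect_poly b) (inverse \<tau>)"
    unfolding z r[of a] r[of b] poly_eval_mult m using coordinate_nonzero
    by (simp add: divide_inverse power_inverse[symmetric] mult_ac)
  moreover have "monom 1 (degree a) * reflect_poly b \<noteq> 0" using b by (simp add: monom_eq_0_iff)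
  ultimately show "\<exists>a b. b \<noteq> 0 \<and> z = poly_eval \<iota> a (inverse \<tau>) / poly_eval \<iota> b (inverse \<tau>)"
    by blast
next
  show "(\<lambda>z. - (\<tau> ^ 2) * D z) \<in> derivations \<iota>"
    by (rule derivations_scale[OF derivation])
next
  have "D (1 / \<tau>) = - 1 / \<tau> ^ 2"
    using derivations_divide[OF derivation coordinate_nonzero, of 1]
      derivations_0[OF derivation] derivation_coordinate by simp
  thus "- (\<tau> ^ 2) * D (inverse \<tau>) = 1" using coordinate_nonzero by (simp add: divide_inverse)
qed

end

section \<open>Frames of line bundles\<close>

text \<open>The generic part of \<open>line_bundle\<close> with a basis vector e named: a
  one-dimensional vector space carried by a subset of its type. No stalk is involved, so one frame
  serves at all points.\<close>

definition frame :: "('k::field, 'v::ab_group_add) vsheaf \<Rightarrow> 'v \<Rightarrow> bool" where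
  "frame E e \<longleftrightarrow>
     (\<forall>v\<in>gen E. \<forall>w\<in>gen E. v + w \<in> gen E \<and> (\<forall>a. smul E a (v + w) = smul E a v + smul E a w)) \<and>
     (\<forall>v\<in>gen E. \<forall>a b. smul E a v \<in> gen E \<and> smul E (a + b) v = smul E a v + smul E b v \<and>
        smul E (a * b) v = smul E a (smul E b v) \<and> smul E 1 v = v) \<and>
     e \<in> gen E \<and> e \<noteq> 0 \<and> gen E = {smul E a e | a. True}"

definition coordinate :: "('k::field, 'v::ab_group_add) vsheaf \<Rightarrow> 'v \<Rightarrow> 'v \<Rightarrow> 'k" where
  "coordinate E e v = (THE a. v = smul E a e)"

text \<open>The semilinear map sending e to f. Extension by 0 follows the convention of
  \<open>hom_pullback\<close>, so that equality of maps is extensional.\<close>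

definition hom_map ::
  "('kx::field \<Rightarrow> 'ky::field) \<Rightarrow> ('kx, 'v::ab_group_add) vsheaf \<Rightarrow> 'v \<Rightarrow>
   ('ky, 'w::ab_group_add) vsheaf \<Rightarrow> 'w \<Rightarrow> 'v \<Rightarrow> 'w" where
  "hom_map fs E e F f v = (if v \<in> gen E then smul F (fs (coordinate E e v)) f else 0)"

context
  fixes E :: "('k::field, 'v::ab_group_add) vsheaf" and e :: 'v
  assumes E: "frame E e"
begin

lemma frame_add: "v \<in> gen E \<Longrightarrow> w \<in> gen E \<Longrightarrow> v + w \<in> gen E"
  and frame_smul_add: "v \<in> gen E \<Longrightarrow> w \<in> gen E \<Longrightarrow> smul E a (v + w) = smul E a v + smul E a w"
  and frame_smul_closed: "v \<in> gen E \<Longrightarrow> smul E a v \<in> gen E"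
  and frame_add_smul: "v \<in> gen E \<Longrightarrow> smul E (a + b) v = smul E a v + smul E b v"
  and frame_mult_smul: "v \<in> gen E \<Longrightarrow> smul E (a * b) v = smul E a (smul E b v)"
  and frame_smul_1: "v \<in> gen E \<Longrightarrow> smul E 1 v = v"
  and frame_gen: "e \<in> gen E"
  and frame_nonzero: "e \<noteq> 0"
  using E by (auto simp: frame_def)

lemma frame_cases: "v \<in> gen E \<Longrightarrow> \<exists>a. v = smul E a e"
  using E by (auto simp: frame_def)

lemma frame_0_smul: "v \<in> gen E \<Longrightarrow> smul E 0 v = 0"
  using frame_add_smul[of v 0 0] by simp

lemma frame_0: "0 \<in> gen E"
  using frame_0_smul[OF frame_gen] frame_smul_closed[OF frame_gen, of 0] by simp

lemma frame_smul_0: "smul E a 0 = 0"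
  using frame_smul_add[OF frame_0 frame_0, of a] by simp

lemma frame_smul_eq_0: "v \<in> gen E \<Longrightarrow> v \<noteq> 0 \<Longrightarrow> smul E a v = 0 \<longleftrightarrow> a = 0"
  using frame_mult_smul[of v "inverse a" a] frame_smul_1[of v] frame_smul_0 frame_0_smul[of v]
  by (cases "a = 0") auto

lemma frame_minus_smul: "v \<in> gen E \<Longrightarrow> smul E (- a) v = - smul E a v"
  using frame_add_smul[of v a "- a"] frame_0_smul[of v] by (simp add: eq_neg_iff_add_eq_0 add.commute)

lemma frame_cancel: "smul E a e = smul E b e \<longleftrightarrow> a = b"
proof
  assume "smul E a e = smul E b e"
  hence "smul E (a + - b) e = 0"
    by (simp only: frame_add_smul[OF frame_gen] frame_minus_smul[OF frame_gen] add.right_inverse)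
  thus "a = b" using frame_smul_eq_0[OF frame_gen frame_nonzero, of "a + - b"] by simp
qed simp

lemma coordinate_smul: "coordinate E e (smul E a e) = a"
  unfolding coordinate_def by (rule the_equality) (simp_all add: frame_cancel)

lemma frame_smul:
  assumes "a \<noteq> 0"
  shows "frame E (smul E a e)"
proof -
  have "gen E = {smul E b (smul E a e) | b. True}"
  proof (intro equalityI subsetI)
    fix v assume "v \<in> gen E"
    then obtain b where "v = smul E (b / a * a) e" using frame_cases[of v] assms by auto
    thus "v \<in> {smul E b (smul E a e) | b. True}"
      unfolding frame_mult_smul[OF frame_gen] by blast
  qed (auto intro: frame_smul_closed frame_gen)
  moreover have "smul E a e \<noteq> 0" using assms frame_smul_eq_0[OF frame_gen frame_nonzero] by blast
  moreover have "smul E a e \<in> gen E" by (intro frame_smul_closed frame_gen)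
  ultimately show ?thesis using E unfolding frame_def by blast
qed

text \<open>Generators of a free module of rank one differ by a unit: if a e generates, then writing
  e as a multiple of a e puts the inverse of a into q.\<close>

lemma generates_smul_iff:
  assumes q: "valuation_ring \<iota> q" and e: "generates E q e"
  shows "generates E q (smul E a e) \<longleftrightarrow> a \<in> units q"
proof
  assume *: "generates E q (smul E a e)"
  have st: "{smul E b e | b. b \<in> q} = {smul E b (smul E a e) | b. b \<in> q}"
    using e * by (simp add: generates_def)
  have "smul E 1 e \<in> {smul E b e | b. b \<in> q}" using valuation_ring_1[OF q] by blast
  then obtain b where "b \<in> q" "smul E 1 e = smul E (b * a) e"
    unfolding st frame_mult_smul[OF frame_gen] by blast
  hence b: "b \<in> q" "1 = b * a" unfolding frame_cancel by auto
  hence a: "a \<noteq> 0" "inverse a = b" by (auto simp: inverse_unique mult.commute)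
  have "smul E (1 * a) e \<in> {smul E b (smul E a e) | b. b \<in> q}"
    unfolding frame_mult_smul[OF frame_gen] using valuation_ring_1[OF q] by blast
  then obtain c where "c \<in> q" "smul E a e = smul E c e" unfolding st[symmetric] by auto
  thus "a \<in> units q" using a b by (simp add: frame_cancel units_def)
next
  assume a: "a \<in> units q"
  have "{smul E b e | b. b \<in> q} = {smul E b (smul E a e) | b. b \<in> q}"
  proof (intro equalityI subsetI)
    fix v assume "v \<in> {smul E b e | b. b \<in> q}"
    then obtain b where b: "b \<in> q" "v = smul E b e" by blast
    have "inverse a * a = 1" using a by (simp add: units_def)
    hence "v = smul E (b * inverse a) (smul E a e)"
      unfolding b(2) frame_mult_smul[OF frame_gen, symmetric] mult.assoc by simp
    moreover have "b * inverse a \<in> q" using a b valuation_ring_mult[OF q] by (simp add: units_def)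
    ultimately show "v \<in> {smul E b (smul E a e) | b. b \<in> q}" by blast
  next
    fix v assume "v \<in> {smul E b (smul E a e) | b. b \<in> q}"
    then obtain b where "b \<in> q" "v = smul E (b * a) e"
      by (auto simp: frame_mult_smul[OF frame_gen])
    thus "v \<in> {smul E b e | b. b \<in> q}" using a valuation_ring_mult[OF q] by (auto simp: units_def)
  qed
  moreover have "a \<noteq> 0" using a by (simp add: units_def)
  ultimately show "generates E q (smul E a e)"
    using e frame_smul_closed[OF frame_gen, of a] frame_smul_eq_0[OF frame_gen frame_nonzero, of a]
    by (auto simp: generates_def)
qed

end

section \<open>Hom sheaves and their frames\<close>

lemma gen_hom_pullback_iff:
  "h \<in> gen (hom_pullback fs E F) \<longleftrightarrow>
     (\<forall>v\<in>gen E. \<forall>w\<in>gen E. h (v + w) = h v + h w) \<and>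
     (\<forall>a. \<forall>v\<in>gen E. h (smul E a v) = smul F (fs a) (h v)) \<and>
     (\<forall>v\<in>gen E. h v \<in> gen F) \<and> (\<forall>v. v \<notin> gen E \<longrightarrow> h v = 0)"
  unfolding hom_pullback_def Let_def by (auto simp: image_subset_iff)

lemma smul_hom_pullback: "smul (hom_pullback fs E F) a h = (\<lambda>v. smul F a (h v))"
  by (simp add: hom_pullback_def Let_def)

lemma stalk_hom_pullback:
  "stalk (hom_pullback fs E F) q =
     {h \<in> gen (hom_pullback fs E F). h ` stalk E (fs -` q) \<subseteq> stalk F q}"
  by (simp add: hom_pullback_def Let_def)

lemma generates_frame:
  assumes "frame E e" "generates E q v"
  shows "frame E v"
proof -
  obtain a where v: "v = smul E a e" and "v \<noteq> 0"
    using frame_cases[OF assms(1), of v] assms(2) by (auto simp: generates_def)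
  moreover from this have "a \<noteq> 0" using frame_0_smul[OF assms(1) frame_gen[OF assms(1)]] by auto
  ultimately show ?thesis using frame_smul[OF assms(1)] by simp
qed

lemma ideal_power_mult:
  assumes q: "valuation_ring \<iota> q" and a: "a \<in> ideal_power q n" and r: "r \<in> q"
  shows "a * r \<in> ideal_power q n"
  using a
proof (induction n arbitrary: a)
  case 0
  thus ?case using r valuation_ring_mult[OF q] by simp
next
  case (Suc n)
  then obtain xs where a: "a = (\<Sum>(a, b)\<leftarrow>xs. a * b)" and xs: "set xs \<subseteq> max_ideal q \<times> ideal_power q n"
    by auto
  define ys where "ys = map (\<lambda>(a, b). (a, b * r)) xs"
  have "set ys \<subseteq> max_ideal q \<times> ideal_power q n"
    using xs Suc.IH by (auto simp: ys_def)
  moreover have "a * r = (\<Sum>(a, b)\<leftarrow>ys. a * b)"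
    unfolding a ys_def by (induction xs) (auto simp: algebra_simps)
  ultimately show ?case unfolding ideal_power.simps by blast
qed

lemma stalk_power_iff:
  assumes q: "valuation_ring \<iota> q" and E: "frame E e" and e: "generates E q e"
  shows "smul E a e \<in> stalk_power E q n \<longleftrightarrow> a \<in> ideal_power q n"
proof
  assume "smul E a e \<in> stalk_power E q n"
  then obtain b c where "b \<in> ideal_power q n" "c \<in> q" "smul E a e = smul E b (smul E c e)"
    using e by (auto simp: stalk_power_def generates_def)
  thus "a \<in> ideal_power q n"
    using ideal_power_mult[OF q] frame_cancel[OF E]
    by (simp add: frame_mult_smul[OF E frame_gen[OF E], symmetric])
next
  assume a: "a \<in> ideal_power q n"
  have "e = smul E 1 e" using frame_smul_1[OF E frame_gen[OF E]] by simp
  hence "e \<in> stalk E q" using e valuation_ring_1[OF q] by (auto simp: generates_def)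
  thus "smul E a e \<in> stalk_power E q n" using a by (auto simp: stalk_power_def)
qed

context
  fixes fs :: "'kx::field \<Rightarrow> 'ky::field" and E :: "('kx, 'v::ab_group_add) vsheaf"
    and F :: "('ky, 'w::ab_group_add) vsheaf" and e f
  assumes fs: "field_hom fs" and E: "frame E e" and F: "frame F f"
begin

interpretation field_hom fs by (rule fs)

lemma hom_map_frame: "hom_map fs E e F f (smul E a e) = smul F (fs a) f"
  unfolding hom_map_def coordinate_smul[OF E] using frame_smul_closed[OF E frame_gen[OF E]] by simp

lemma hom_map_gen: "hom_map fs E e F f \<in> gen (hom_pullback fs E F)"
proof -
  let ?h = "hom_map fs E e F f"
  note Ee = frame_gen[OF E] and Ff = frame_gen[OF F]
  have "?h (v + w) = ?h v + ?h w" if vw: "v \<in> gen E" "w \<in> gen E" for v w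
  proof -
    obtain a b where "v = smul E a e" "w = smul E b e"
      using frame_cases[OF E vw(1)] frame_cases[OF E vw(2)] by blast
    moreover from this have "v + w = smul E (a + b) e" by (simp add: frame_add_smul[OF E Ee])
    ultimately show ?thesis by (simp only: hom_map_frame hom_add frame_add_smul[OF F Ff])
  qed
  moreover have "?h (smul E a v) = smul F (fs a) (?h v)" if v: "v \<in> gen E" for a v
  proof -
    obtain b where "v = smul E b e" using frame_cases[OF E v] by blast
    moreover from this have "smul E a v = smul E (a * b) e" by (simp add: frame_mult_smul[OF E Ee])
    ultimately show ?thesis by (simp only: hom_map_frame hom_mult frame_mult_smul[OF F Ff])
  qed
  moreover have "?h v \<in> gen F" if "v \<in> gen E" for v
    using that by (simp add: hom_map_def frame_smul_closed[OF F Ff])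
  moreover have "?h v = 0" if "v \<notin> gen E" for v using that by (simp add: hom_map_def)
  ultimately show ?thesis unfolding gen_hom_pullback_iff by blast
qed

lemma hom_pullback_eq:
  assumes h: "h \<in> gen (hom_pullback fs E F)" and a: "h e = smul F a f"
  shows "h = smul (hom_pullback fs E F) a (hom_map fs E e F f)"
proof
  fix v
  show "h v = smul (hom_pullback fs E F) a (hom_map fs E e F f) v"
  proof (cases "v \<in> gen E")
    case True
    then obtain b where v: "v = smul E b e" using frame_cases[OF E] by blast
    have "h v = smul F (fs b) (smul F a f)"
      unfolding v using h a frame_gen[OF E] by (simp add: gen_hom_pullback_iff)
    also have "\<dots> = smul F a (smul F (fs b) f)"
      by (simp only: frame_mult_smul[OF F frame_gen[OF F], symmetric] mult.commute)
    finally show ?thesis unfolding v smul_hom_pullback hom_map_frame .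
  next
    case False
    hence "h v = 0" using h by (simp add: gen_hom_pullback_iff)
    thus ?thesis using False frame_smul_0[OF F] by (simp add: smul_hom_pullback hom_map_def)
  qed
qed

lemma smul_hom_closed:
  assumes "h \<in> gen (hom_pullback fs E F)"
  shows "smul (hom_pullback fs E F) a h \<in> gen (hom_pullback fs E F)"
proof -
  have F2: "h v \<in> gen F" if "v \<in> gen E" for v
    using assms that unfolding gen_hom_pullback_iff by blast
  have "smul F a (h (v + w)) = smul F a (h v) + smul F a (h w)" if "v \<in> gen E" "w \<in> gen E" for v w
    using assms that F2 unfolding gen_hom_pullback_iff by (simp add: frame_smul_add[OF F])
  moreover have "smul F a (h (smul E b v)) = smul F (fs b) (smul F a (h v))" if "v \<in> gen E" for b v
  proof -
    have "h (smul E b v) = smul F (fs b) (h v)"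
      using assms that unfolding gen_hom_pullback_iff by blast
    thus ?thesis using F2[OF that] by (simp only: frame_mult_smul[OF F, symmetric] mult.commute)
  qed
  moreover have "smul F a (h v) \<in> gen F" if "v \<in> gen E" for v
    using F2[OF that] by (rule frame_smul_closed[OF F])
  moreover have "smul F a (h v) = 0" if "v \<notin> gen E" for v
  proof -
    have "h v = 0" using assms that unfolding gen_hom_pullback_iff by blast
    thus ?thesis by (simp only: frame_smul_0[OF F])
  qed
  ultimately show ?thesis unfolding gen_hom_pullback_iff smul_hom_pullback by blast
qed

lemma frame_hom: "frame (hom_pullback fs E F) (hom_map fs E e F f)"
proof -
  let ?H = "hom_pullback fs E F" and ?h = "hom_map fs E e F f"
  have val: "h v \<in> gen F" if "h \<in> gen ?H" for h v
    using that frame_0[OF F] by (cases "v \<in> gen E") (simp_all add: gen_hom_pullback_iff)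
  have "h + h' \<in> gen ?H" if "h \<in> gen ?H" "h' \<in> gen ?H" for h h'
  proof -
    have "h v + h' v \<in> gen F" for v using val that by (intro frame_add[OF F])
    moreover have "smul F b (h v) + smul F b (h' v) = smul F b (h v + h' v)" for b v
      using val that by (intro frame_smul_add[OF F, symmetric])
    ultimately show ?thesis using that
      by (simp add: gen_hom_pullback_iff)
  qed
  moreover have "smul ?H a (h + h') = smul ?H a h + smul ?H a h'" if "h \<in> gen ?H" "h' \<in> gen ?H" for a h h'
  proof
    fix v
    show "smul ?H a (h + h') v = (smul ?H a h + smul ?H a h') v"
      using val[OF that(1), of v] val[OF that(2), of v]
      by (simp add: smul_hom_pullback frame_smul_add[OF F])
  qed
  moreover have "smul ?H (a + b) h = smul ?H a h + smul ?H b h" if "h \<in> gen ?H" for a b h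
  proof
    fix v
    show "smul ?H (a + b) h v = (smul ?H a h + smul ?H b h) v"
      using val[OF that, of v] by (simp add: smul_hom_pullback frame_add_smul[OF F])
  qed
  moreover have "smul ?H (a * b) h = smul ?H a (smul ?H b h)" if "h \<in> gen ?H" for a b h
  proof
    fix v
    show "smul ?H (a * b) h v = smul ?H a (smul ?H b h) v"
      using val[OF that, of v] by (simp add: smul_hom_pullback frame_mult_smul[OF F])
  qed
  moreover have "smul ?H 1 h = h" if "h \<in> gen ?H" for h
  proof
    fix v
    show "smul ?H 1 h v = h v"
      using val[OF that, of v] by (simp add: smul_hom_pullback frame_smul_1[OF F])
  qed
  moreover have "?h \<noteq> 0"
  proof
    assume "?h = 0"
    hence "?h (smul E 1 e) = 0" by simp
    thus False unfolding hom_map_frame using frame_smul_eq_0[OF F frame_gen[OF F] frame_nonzero[OF F]]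
      by simp
  qed
  moreover have "gen ?H = {smul ?H a ?h | a. True}"
  proof (intro equalityI subsetI)
    fix h assume h: "h \<in> gen ?H"
    obtain a where "h e = smul F a f" using frame_cases[OF F val[OF h]] by metis
    from hom_pullback_eq[OF h this] show "h \<in> {smul ?H a ?h | a. True}" by blast
  qed (auto intro: smul_hom_closed hom_map_gen)
  ultimately show ?thesis
    unfolding frame_def using hom_map_gen smul_hom_closed by (intro conjI) auto
qed

text \<open>The stalk of E is taken at the image point, whose local ring is the preimage of q. A
  semilinear map sends it into the stalk of F exactly when the image of e is a multiple of f with
  coefficient in q.\<close>

lemma generates_hom:
  assumes q: "valuation_ring \<iota> q" and e: "generates E (fs -` q) e" and f: "generates F q f"
  shows "generates (hom_pullback fs E F) q (hom_map fs E e F f)"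
proof -
  let ?H = "hom_pullback fs E F" and ?h = "hom_map fs E e F f"
  note Ff = frame_gen[OF F]
  have stE: "stalk E (fs -` q) = {smul E a e | a. fs a \<in> q}" using e by (auto simp: generates_def)
  have stF: "stalk F q = {smul F a f | a. a \<in> q}" using f by (simp add: generates_def)
  have "stalk ?H q = {smul ?H a ?h | a. a \<in> q}"
  proof (intro equalityI subsetI)
    fix h assume "h \<in> stalk ?H q"
    hence h: "h \<in> gen ?H" "h ` stalk E (fs -` q) \<subseteq> stalk F q"
      unfolding stalk_hom_pullback by blast+
    have "smul E 1 e \<in> stalk E (fs -` q)" unfolding stE using valuation_ring_1[OF q] by force
    hence "h e \<in> stalk F q" using h(2) frame_smul_1[OF E frame_gen[OF E]] by auto
    then obtain a where "a \<in> q" "h e = smul F a f" unfolding stF by blast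
    with hom_pullback_eq[OF h(1)] show "h \<in> {smul ?H a ?h | a. a \<in> q}" by blast
  next
    fix h assume "h \<in> {smul ?H a ?h | a. a \<in> q}"
    then obtain a where a: "a \<in> q" "h = smul ?H a ?h" by blast
    have "h (smul E b e) = smul F (a * fs b) f" for b
      unfolding a(2) frame_mult_smul[OF F Ff]
      by (simp add: smul_hom_pullback hom_map_frame)
    hence "h ` stalk E (fs -` q) \<subseteq> stalk F q"
      unfolding stE stF using a(1) valuation_ring_mult[OF q] by auto
    moreover have "h \<in> gen ?H" unfolding a(2) by (intro smul_hom_closed hom_map_gen)
    ultimately show "h \<in> stalk ?H q" unfolding stalk_hom_pullback by blast
  qed
  thus ?thesis using frame_gen[OF frame_hom] frame_nonzero[OF frame_hom] by (simp add: generates_def)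
qed

end

text \<open>The transition rule for Hom sheaves. Combined with d(1/\<tau>) = - \<tau>^(-2) d\<tau>
  and its dual for derivations, it determines the twists computed below.\<close>

lemma hom_map_smul:
  assumes fs: "field_hom fs" and E: "frame E e" and F: "frame F f" and a: "a \<noteq> 0" and b: "b \<noteq> 0"
  shows "hom_map fs E (smul E a e) F (smul F b f) =
    smul (hom_pullback fs E F) (b / fs a) (hom_map fs E e F f)"
proof (rule hom_pullback_eq[OF fs E F hom_map_gen[OF fs frame_smul[OF E a] frame_smul[OF F b]]])
  interpret field_hom fs by fact
  have "e = smul E (inverse a) (smul E a e)"
    using a frame_smul_1[OF E frame_gen[OF E]]
    by (simp add: frame_mult_smul[OF E frame_gen[OF E], symmetric])
  hence "hom_map fs E (smul E a e) F (smul F b f) e = smul F (fs (inverse a)) (smul F b f)"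
    using hom_map_frame[OF fs frame_smul[OF E a] frame_smul[OF F b]] by metis
  thus "hom_map fs E (smul E a e) F (smul F b f) e = smul F (b / fs a) f"
    by (simp add: frame_mult_smul[OF F frame_gen[OF F], symmetric] hom_inverse divide_inverse mult.commute)
qed

lemma frame_structure_sheaf: "frame structure_sheaf 1"
  by (auto simp: frame_def structure_sheaf_def algebra_simps)

lemma generates_structure_sheaf: "generates structure_sheaf q 1"
  by (simp add: generates_def structure_sheaf_def)

section \<open>Tangent, cotangent and twisted bundles on the projective line\<close>

context rational_function_field
begin

lemma derivations_mem: "(\<lambda>z. a * D z) \<in> derivations \<iota>"
  using derivation by (rule derivations_scale)

lemma frame_tangent: "frame (tangent \<iota>) D"
proof -
  have "derivations \<iota> = {(\<lambda>z. a * D z) | a. True}"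
    using derivation_multiple derivations_mem by blast
  moreover have "(\<lambda>z. v z + w z) \<in> derivations \<iota>" if "v \<in> derivations \<iota>" "w \<in> derivations \<iota>" for v w
  proof -
    have "(\<lambda>z. v z + w z) = (\<lambda>z. (v \<tau> + w \<tau>) * D z)"
      by (subst derivation_multiple[OF that(1)], subst derivation_multiple[OF that(2)])
        (simp add: distrib_right)
    thus ?thesis using derivations_mem by simp
  qed
  moreover have "D \<noteq> 0" using derivation_coordinate by (metis zero_fun_apply zero_neq_one)
  moreover have "(\<lambda>z. a * v z) \<in> derivations \<iota>" if "v \<in> derivations \<iota>" for a v
    using that by (rule derivations_scale)
  ultimately show ?thesis
    using derivation unfolding frame_def tangent_def vsheaf.select_convs
    by (intro conjI ballI allI) (simp_all add: plus_fun_def distrib_left distrib_right mult.assoc)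
qed

text \<open>A derivation E that preserves q has coefficient E \<tau> in q; conversely D itself
  preserves q by \<open>derivation_closed\<close>.\<close>

lemma generates_tangent:
  assumes q: "valuation_ring \<iota> q" and \<tau>: "\<tau> \<in> q"
  shows "generates (tangent \<iota>) q D"
proof -
  have "{E \<in> derivations \<iota>. E ` q \<subseteq> q} = {(\<lambda>z. a * D z) | a. a \<in> q}"
  proof (intro equalityI subsetI)
    fix E assume E: "E \<in> {E \<in> derivations \<iota>. E ` q \<subseteq> q}"
    hence "E = (\<lambda>z. E \<tau> * D z)" "E \<tau> \<in> q" using derivation_multiple \<tau> by auto
    thus "E \<in> {(\<lambda>z. a * D z) | a. a \<in> q}" by blast
  next
    fix E assume "E \<in> {(\<lambda>z. a * D z) | a. a \<in> q}"
    thus "E \<in> {E \<in> derivations \<iota>. E ` q \<subseteq> q}"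
      using derivations_mem valuation_ring_mult[OF q] derivation_closed[OF q \<tau>] by blast
  qed
  thus ?thesis using frame_gen[OF frame_tangent] frame_nonzero[OF frame_tangent]
    by (simp add: generates_def tangent_def)
qed

text \<open>Since D \<tau> = 1, the frame dual to D is d\<tau>; this makes the general lemmas on Hom
  sheaves available for the cotangent sheaf.\<close>

lemma hom_map_differential: "hom_map id (tangent \<iota>) D structure_sheaf 1 = differential \<iota> \<tau>"
proof
  fix E
  show "hom_map id (tangent \<iota>) D structure_sheaf 1 E = differential \<iota> \<tau> E"
  proof (cases "E \<in> derivations \<iota>")
    case True
    have "E = smul (tangent \<iota>) (E \<tau>) D"
      using derivation_multiple[OF True] by (simp add: tangent_def)
    thus ?thesis using True coordinate_smul[OF frame_tangent, of "E \<tau>"]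
      by (simp add: hom_map_def differential_def tangent_def structure_sheaf_def)
  qed (simp add: hom_map_def differential_def tangent_def)
qed

lemma field_hom_id: "field_hom id"
  by unfold_locales auto

lemma frame_cotangent: "frame (cotangent \<iota>) (differential \<iota> \<tau>)"
  unfolding cotangent_def hom_bundle_def hom_map_differential[symmetric]
  by (rule frame_hom[OF field_hom_id frame_tangent frame_structure_sheaf])

lemma generates_cotangent:
  assumes q: "valuation_ring \<iota> q" and \<tau>: "\<tau> \<in> q"
  shows "generates (cotangent \<iota>) q (differential \<iota> \<tau>)"
  unfolding cotangent_def hom_bundle_def hom_map_differential[symmetric]
  by (rule generates_hom[OF field_hom_id frame_tangent frame_structure_sheaf q])
    (simp_all add: generates_tangent[OF q \<tau>] generates_structure_sheaf)

lemma differential_eq: "differential \<iota> z = smul (cotangent \<iota>) (D z) (differential \<iota> \<tau>)"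
proof
  fix E
  show "differential \<iota> z E = smul (cotangent \<iota>) (D z) (differential \<iota> \<tau>) E"
  proof (cases "E \<in> derivations \<iota>")
    case True
    have "E z = E \<tau> * D z" using fun_cong[OF derivation_multiple[OF True]] .
    thus ?thesis using True
      by (simp add: differential_def cotangent_def hom_bundle_def smul_hom_pullback structure_sheaf_def)
  qed (simp add: differential_def cotangent_def hom_bundle_def smul_hom_pullback structure_sheaf_def)
qed

text \<open>Such a bundle is isomorphic to \<open>O(n)\<close>, trivialized by \<open>e\<close> on the affine line.\<close>

definition twisted :: "('k, 'v::ab_group_add) vsheaf \<Rightarrow> 'v \<Rightarrow> nat \<Rightarrow> bool" where
  "twisted E e n \<longleftrightarrow> frame E e \<and>
     (\<forall>q\<in>closed_points \<iota>. \<tau> \<in> q \<longrightarrow> generates E q e) \<and>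
     (\<forall>q\<in>closed_points \<iota>. inverse \<tau> \<in> max_ideal q \<longrightarrow> generates E q (smul E (\<tau> ^ n) e))"

section \<open>The two standard charts and bundles trivialized on them\<close>

lemma closed_point_cases:
  assumes "q \<in> closed_points \<iota>"
  obtains "\<tau> \<in> q" | "inverse \<tau> \<in> max_ideal q"
proof -
  have q: "valuation_ring \<iota> q" using assms by (simp add: closed_points_iff)
  show thesis
  proof (cases "\<tau> \<in> q")
    case False
    hence "inverse \<tau> \<in> q" using valuation_ring_cases[OF q] by blast
    hence "inverse \<tau> \<in> max_ideal q" using False by (simp add: max_ideal_def)
    thus thesis using that by blast
  qed (use that in blast)
qed

lemma affine_open: "nonempty_open \<iota> {q \<in> closed_points \<iota>. \<tau> \<in> q}"
proof -
  interpret inv: rational_function_field \<iota> "inverse \<tau>" "\<lambda>z. - (\<tau> ^ 2) * D z"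
    by (rule inverse_coordinate)
  have "closed_points \<iota> - {q \<in> closed_points \<iota>. \<tau> \<in> q} \<subseteq>
      {q \<in> closed_points \<iota>. inverse \<tau> \<in> max_ideal q}"
    using closed_point_cases by blast
  thus ?thesis using inv.finite_points_zero finite_subset by (auto simp: nonempty_open_def)
qed

lemma infinity_open: "nonempty_open \<iota> {q \<in> closed_points \<iota>. inverse \<tau> \<in> q}"
proof -
  interpret inv: rational_function_field \<iota> "inverse \<tau>" "\<lambda>z. - (\<tau> ^ 2) * D z"
    by (rule inverse_coordinate)
  show ?thesis by (rule inv.affine_open)
qed

text \<open>At points of this chart where 1/\<tau> does not vanish, \<tau> is a unit, so e and
  \<tau>^n e generate the same stalk. The generator at infinity thus works on the whole chart, as
  local triviality demands.\<close>

lemma twisted_generates_infinity: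
  assumes E: "twisted E e n" and q: "q \<in> closed_points \<iota>" and z: "inverse \<tau> \<in> q"
  shows "generates E q (smul E (\<tau> ^ n) e)"
proof (cases "inverse \<tau> \<in> max_ideal q")
  case False
  have v: "valuation_ring \<iota> q" using q by (simp add: closed_points_iff)
  have u: "inverse \<tau> \<in> units q" using False z units_iff[OF v] by blast
  hence \<tau>: "\<tau> \<in> units q" using units_inverse[OF v] by fastforce
  hence "generates E q e" using E q by (auto simp: twisted_def units_def)
  thus ?thesis using generates_smul_iff[OF _ v] units_power[OF v \<tau>] E by (auto simp: twisted_def)
qed (use E q in \<open>auto simp: twisted_def\<close>)

lemma twisted_line_bundle:
  assumes E: "twisted E e n"
  shows "line_bundle \<iota> E"
proof -
  have F: "frame E e" using E by (simp add: twisted_def)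
  have "\<exists>U v. nonempty_open \<iota> U \<and> q \<in> U \<and> (\<forall>q'\<in>U. generates E q' v)" if q: "q \<in> closed_points \<iota>" for q
    using q
  proof (cases rule: closed_point_cases)
    case 1
    thus ?thesis using affine_open q E
      by (intro exI[of _ "{q \<in> closed_points \<iota>. \<tau> \<in> q}"] exI[of _ e]) (auto simp: twisted_def)
  next
    case 2
    thus ?thesis using infinity_open q twisted_generates_infinity[OF E]
      by (intro exI[of _ "{q \<in> closed_points \<iota>. inverse \<tau> \<in> q}"] exI[of _ "smul E (\<tau> ^ n) e"])
        (auto simp: max_ideal_def)
  qed
  moreover have "e \<in> gen E" "e \<noteq> 0" "gen E = {smul E a e | a. True}" using F by (auto simp: frame_def)
  ultimately show ?thesis using F unfolding line_bundle_def frame_def by blast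
qed

lemma twisted_generates_iff:
  assumes E: "twisted E e n" and q: "q \<in> closed_points \<iota>"
  shows "\<tau> \<in> q \<Longrightarrow> generates E q (smul E a e) \<longleftrightarrow> a \<in> units q"
    and "inverse \<tau> \<in> max_ideal q \<Longrightarrow> generates E q (smul E a e) \<longleftrightarrow> a * inverse \<tau> ^ n \<in> units q"
proof -
  have v: "valuation_ring \<iota> q" using q by (simp add: closed_points_iff)
  have F: "frame E e" using E by (simp add: twisted_def)
  show "generates E q (smul E a e) \<longleftrightarrow> a \<in> units q" if "\<tau> \<in> q"
    using E q that by (intro generates_smul_iff[OF F v]) (auto simp: twisted_def)
  show "generates E q (smul E a e) \<longleftrightarrow> a * inverse \<tau> ^ n \<in> units q" if z: "inverse \<tau> \<in> max_ideal q"
  proof -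
    have "a = a * inverse \<tau> ^ n * \<tau> ^ n"
      using coordinate_nonzero by (simp add: mult.assoc power_mult_distrib[symmetric])
    hence "smul E a e = smul E (a * inverse \<tau> ^ n) (smul E (\<tau> ^ n) e)"
      using frame_mult_smul[OF F frame_gen[OF F]] by metis
    moreover have "frame E (smul E (\<tau> ^ n) e)" using coordinate_nonzero by (intro frame_smul[OF F]) simp
    moreover have "generates E q (smul E (\<tau> ^ n) e)" using E q z by (auto simp: twisted_def)
    ultimately show ?thesis using generates_smul_iff[OF _ v] by metis
  qed
qed

lemma twisted_stalk_power_iff:
  assumes E: "twisted E e n" and q: "q \<in> closed_points \<iota>"
  shows "\<tau> \<in> q \<Longrightarrow> smul E a e \<in> stalk_power E q m \<longleftrightarrow> a \<in> ideal_power q m"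
    and "inverse \<tau> \<in> max_ideal q \<Longrightarrow>
      smul E a e \<in> stalk_power E q m \<longleftrightarrow> a * inverse \<tau> ^ n \<in> ideal_power q m"
proof -
  have v: "valuation_ring \<iota> q" using q by (simp add: closed_points_iff)
  have F: "frame E e" using E by (simp add: twisted_def)
  show "smul E a e \<in> stalk_power E q m \<longleftrightarrow> a \<in> ideal_power q m" if "\<tau> \<in> q"
    using E q that by (intro stalk_power_iff[OF v F]) (auto simp: twisted_def)
  show "smul E a e \<in> stalk_power E q m \<longleftrightarrow> a * inverse \<tau> ^ n \<in> ideal_power q m"
    if z: "inverse \<tau> \<in> max_ideal q"
  proof -
    have "a = a * inverse \<tau> ^ n * \<tau> ^ n"
      using coordinate_nonzero by (simp add: mult.assoc power_mult_distrib[symmetric])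
    hence "smul E a e = smul E (a * inverse \<tau> ^ n) (smul E (\<tau> ^ n) e)"
      using frame_mult_smul[OF F frame_gen[OF F]] by metis
    moreover have "frame E (smul E (\<tau> ^ n) e)" using coordinate_nonzero by (intro frame_smul[OF F]) simp
    moreover have "generates E q (smul E (\<tau> ^ n) e)" using E q z by (auto simp: twisted_def)
    ultimately show ?thesis using stalk_power_iff[OF v] by metis
  qed
qed

text \<open>The usual model of O(n) inside the function field: at the point where \<tau> is not
  regular, poles of order at most n are allowed.\<close>

definition standard_bundle :: "nat \<Rightarrow> ('k, 'k) vsheaf" where
  "standard_bundle n = \<lparr>gen = UNIV, smul = (*),
     stalk = (\<lambda>q. if \<tau> \<in> q then q else {\<tau> ^ n * a | a. a \<in> q})\<rparr>"

lemma twisted_standard_bundle: "twisted (standard_bundle n) 1 n"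
proof -
  have "frame (standard_bundle n) 1"
    by (auto simp: frame_def standard_bundle_def algebra_simps)
  moreover have "\<tau> \<notin> q" if "inverse \<tau> \<in> max_ideal q" for q
    using that coordinate_nonzero by (auto simp: max_ideal_def)
  ultimately show ?thesis using coordinate_nonzero
    by (auto simp: twisted_def generates_def standard_bundle_def mult.commute)
qed

text \<open>The tangent bundle is O(2): at infinity it is generated by - \<tau>^2 D, the derivation
  dual to d(1/\<tau>). Taking Hom from it therefore lowers the twist by 2; the sign is a unit and is
  multiplied away at the end.\<close>

lemma twisted_hom_tangent:
  assumes E: "twisted E e (n + 2)"
  shows "twisted (hom_bundle (tangent \<iota>) E) (hom_map id (tangent \<iota>) D E e) n"
proof -
  let ?H = "hom_bundle (tangent \<iota>) E" and ?h = "hom_map id (tangent \<iota>) D E e"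
  have F: "frame E e" using E by (simp add: twisted_def)
  have H: "frame ?H ?h"
    unfolding hom_bundle_def by (rule frame_hom[OF field_hom_id frame_tangent F])
  have "generates ?H q ?h" if "q \<in> closed_points \<iota>" "\<tau> \<in> q" for q
  proof -
    have v: "valuation_ring \<iota> q" using that by (simp add: closed_points_iff)
    have "generates E q e" using E that by (auto simp: twisted_def)
    thus ?thesis unfolding hom_bundle_def
      by (intro generates_hom[OF field_hom_id frame_tangent F v])
        (simp_all add: generates_tangent[OF v that(2)])
  qed
  moreover have "generates ?H q (smul ?H (\<tau> ^ n) ?h)"
    if q: "q \<in> closed_points \<iota>" and z: "inverse \<tau> \<in> max_ideal q" for q
  proof -
    interpret inv: rational_function_field \<iota> "inverse \<tau>" "\<lambda>z. - (\<tau> ^ 2) * D z"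
      by (rule inverse_coordinate)
    have v: "valuation_ring \<iota> q" using q by (simp add: closed_points_iff)
    have zq: "inverse \<tau> \<in> q" using z by (simp add: max_ideal_def)
    let ?e = "smul E (\<tau> ^ (n + 2)) e" and ?D = "smul (tangent \<iota>) (- (\<tau> ^ 2)) D"
    have nz: "\<tau> ^ (n + 2) \<noteq> 0" "- (\<tau> ^ 2) \<noteq> 0" using coordinate_nonzero by auto
    have e: "generates E q ?e" using E q z by (auto simp: twisted_def)
    have "?D = (\<lambda>z. - (\<tau> ^ 2) * D z)" by (simp add: tangent_def)
    hence D: "frame (tangent \<iota>) ?D" "generates (tangent \<iota>) q ?D"
      using inv.frame_tangent inv.generates_tangent[OF v zq] by simp_all
    have "generates ?H q (hom_map id (tangent \<iota>) ?D E ?e)"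
      unfolding hom_bundle_def
      by (rule generates_hom[OF field_hom_id D(1) frame_smul[OF F nz(1)] v]) (simp_all only: D e vimage_id id_apply)
    also have "hom_map id (tangent \<iota>) ?D E ?e = smul ?H (\<tau> ^ (n + 2) / id (- (\<tau> ^ 2))) ?h"
      unfolding hom_bundle_def by (rule hom_map_smul[OF field_hom_id frame_tangent F nz(2,1)])
    also have "\<tau> ^ (n + 2) / id (- (\<tau> ^ 2)) = - 1 * \<tau> ^ n"
      using coordinate_nonzero by (simp add: power2_eq_square)
    also have "smul ?H (- 1 * \<tau> ^ n) ?h = smul ?H (- 1) (smul ?H (\<tau> ^ n) ?h)"
      by (rule frame_mult_smul[OF H frame_gen[OF H]])
    finally have g: "generates ?H q (smul ?H (- 1) (smul ?H (\<tau> ^ n) ?h))" .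
    have F': "frame ?H (smul ?H (\<tau> ^ n) ?h)"
      using coordinate_nonzero by (intro frame_smul[OF H]) simp
    have "smul ?H (- 1) (smul ?H (- 1) (smul ?H (\<tau> ^ n) ?h)) = smul ?H (\<tau> ^ n) ?h"
      using frame_mult_smul[OF F' frame_gen[OF F'], of "- 1" "- 1", symmetric]
        frame_smul_1[OF F' frame_gen[OF F']] by simp
    moreover have "generates ?H q (smul ?H (- 1) (smul ?H (- 1) (smul ?H (\<tau> ^ n) ?h)))"
      using generates_smul_iff[OF generates_frame[OF H g] v g] units_minus[OF v units_1[OF v]] by blast
    ultimately show ?thesis by simp
  qed
  ultimately show ?thesis using H by (simp add: twisted_def)
qed

end

section \<open>The Artin--Schreier map\<close>

text \<open>Holds for any valuation ring, hence also at points of the affine line where \<tau> is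
  not a local parameter.\<close>

lemma ideal_power_Suc_subset:
  assumes q: "valuation_ring \<iota> q" and a: "a \<in> ideal_power q (Suc n)"
  shows "a \<in> max_ideal q"
proof -
  have sub: "ideal_power q n \<subseteq> q" for n
  proof (induction n)
    case (Suc n)
    have "(\<Sum>(a, b)\<leftarrow>xs. a * b) \<in> q" if "set xs \<subseteq> max_ideal q \<times> ideal_power q n" for xs
      using that
    proof (induction xs)
      case (Cons x xs)
      obtain a b where x: "x = (a, b)" by (cases x)
      have "a * b \<in> q" using Cons.prems Suc.IH unfolding x
        by (intro max_ideal_subset[OF q, OF max_ideal_mult_right[OF q]]) auto
      moreover have "(\<Sum>(a, b)\<leftarrow>xs. a * b) \<in> q" using Cons by auto
      ultimately show ?case unfolding x by (simp add: valuation_ring_add[OF q])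
    qed (simp add: valuation_ring_0[OF q])
    thus ?case by auto
  qed simp
  obtain xs where xs: "set xs \<subseteq> max_ideal q \<times> ideal_power q n" and a: "a = (\<Sum>(a, b)\<leftarrow>xs. a * b)"
    using a by auto
  from xs have "(\<Sum>(a, b)\<leftarrow>xs. a * b) \<in> max_ideal q"
  proof (induction xs)
    case (Cons x xs)
    obtain a b where x: "x = (a, b)" by (cases x)
    have "a * b \<in> max_ideal q" using Cons.prems sub unfolding x
      by (intro max_ideal_mult_right[OF q]) auto
    moreover have "(\<Sum>(a, b)\<leftarrow>xs. a * b) \<in> max_ideal q" using Cons by auto
    ultimately show ?case unfolding x by (simp add: max_ideal_add[OF q])
  qed (simp add: max_ideal_0[OF q])
  thus ?thesis using a by simp
qed

text \<open>The bound on p makes the subtractions in p - 2 and 2p - 3 exact and lets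
  (1/\<tau>)^(p-1) vanish at infinity.\<close>

locale artin_schreier = rational_function_field \<iota> \<tau> D
  for \<iota> :: "'l::field \<Rightarrow> 'k::field" and \<tau> :: 'k and D :: "'k \<Rightarrow> 'k" +
  fixes fs :: "'k \<Rightarrow> 'k" and p :: nat
  assumes fs: "field_hom fs" and fs_const: "fs (\<iota> c) = \<iota> c"
    and fs_coordinate: "fs \<tau> = \<tau> ^ p - \<tau>"
    and char_p: "of_nat p = (0 :: 'k)" and p_ge_3: "3 \<le> p"
begin

interpretation fs: field_hom fs by (rule fs)

abbreviation "V \<equiv> hom_cotangent \<iota> \<iota> fs"

definition differential_hom :: "(('k \<Rightarrow> 'k) \<Rightarrow> 'k) \<Rightarrow> (('k \<Rightarrow> 'k) \<Rightarrow> 'k)" where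
  "differential_hom = hom_map fs (cotangent \<iota>) (differential \<iota> \<tau>) (cotangent \<iota>) (differential \<iota> \<tau>)"

lemma valuation_ring_pullback:
  assumes q: "valuation_ring \<iota> q"
  shows "valuation_ring \<iota> (fs -` q)"
proof -
  have "range \<iota> \<subseteq> fs -` q" using valuation_ring_const[OF q] by (auto simp: fs_const)
  moreover have "a - b \<in> fs -` q \<and> a * b \<in> fs -` q" if "a \<in> fs -` q" "b \<in> fs -` q" for a b
    using that valuation_ring_diff[OF q] valuation_ring_mult[OF q]
    by (simp add: fs.hom_minus fs.hom_mult)
  moreover have "a \<in> fs -` q \<or> inverse a \<in> fs -` q" for a
    using valuation_ring_cases[OF q, of "fs a"] by (simp add: fs.hom_inverse)
  ultimately show ?thesis unfolding valuation_ring_def by blast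
qed

lemma fs_poly_eval: "fs (poly_eval \<iota> a x) = poly_eval \<iota> a (fs x)"
  by (induction a) (simp_all add: fs.hom_add fs.hom_mult fs_const)

lemma frame_V: "frame V differential_hom"
  unfolding differential_hom_def hom_cotangent_def by (rule frame_hom[OF fs frame_cotangent frame_cotangent])

text \<open>The degree 2p - 2 is the sum of 2p from the pulled back tangent bundle and - 2 from the
  cotangent bundle. At infinity the map taking d(1/\<tau>) to d(1/\<tau>) is a generator; with c = -
  1/\<tau>^2 it is c / fs c = (\<tau>^p - \<tau>)^2 / \<tau>^2 times the map taking d\<tau> to
  d\<tau>, and this factor is \<tau>^(2p-2) up to a unit.\<close>

lemma twisted_V: "twisted V differential_hom (2 * p - 2)"
proof -
  have "generates V q differential_hom" if "q \<in> closed_points \<iota>" and \<tau>: "\<tau> \<in> q" for q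
  proof -
    have v: "valuation_ring \<iota> q" using that by (simp add: closed_points_iff)
    have "\<tau> \<in> fs -` q"
      using \<tau> by (simp add: fs_coordinate valuation_ring_diff[OF v] valuation_ring_power[OF v])
    thus ?thesis unfolding differential_hom_def hom_cotangent_def
      by (intro generates_hom[OF fs frame_cotangent frame_cotangent v] generates_cotangent
          valuation_ring_pullback v \<tau>)
  qed
  moreover have "generates V q (smul V (\<tau> ^ (2 * p - 2)) differential_hom)"
    if q: "q \<in> closed_points \<iota>" and z: "inverse \<tau> \<in> max_ideal q" for q
  proof -
    interpret inv: rational_function_field \<iota> "inverse \<tau>" "\<lambda>z. - (\<tau> ^ 2) * D z"
      by (rule inverse_coordinate)
    have v: "valuation_ring \<iota> q" using q by (simp add: closed_points_iff)
    have zq: "inverse \<tau> \<in> q" using z by (simp add: max_ideal_def)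
    \<comment> \<open>The factor with \<tau>^p - \<tau> = \<tau>^p u; it has residue 1 at
      infinity.\<close>
    define u where "u = 1 - inverse \<tau> ^ (p - 1)"
    have "p - 1 = Suc (p - 2)" using p_ge_3 by simp
    hence "inverse \<tau> ^ (p - 1) = inverse \<tau> * inverse \<tau> ^ (p - 2)"
      by (simp only: power_Suc)
    also have "\<dots> \<in> max_ideal q"
      by (rule max_ideal_mult_right[OF v z]) (rule valuation_ring_power[OF v zq])
    finally have "1 + - 1 * inverse \<tau> ^ (p - 1) \<in> units q"
      using v valuation_ring_minus[OF v valuation_ring_1[OF v]]
      by (intro units_add_max_ideal[OF v] units_1[OF v] max_ideal_mult[OF v]) auto
    hence u: "u \<in> units q" by (simp add: u_def)
    have g: "\<tau> ^ p - \<tau> = \<tau> ^ p * u"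
    proof -
      have "p = Suc (p - 1)" using p_ge_3 by simp
      hence "\<tau> ^ p * inverse \<tau> ^ (p - 1) = \<tau> * (\<tau> ^ (p - 1) * inverse \<tau> ^ (p - 1))"
        by (metis power_Suc mult.assoc)
      thus ?thesis using coordinate_nonzero
        by (simp add: u_def right_diff_distrib power_mult_distrib[symmetric])
    qed
    \<comment> \<open>The pullback of 1/\<tau> is regular at q, so the image of q lies in the chart
      at infinity of the target, where d(1/\<tau>) generates.\<close>
    have "fs (inverse \<tau>) = inverse \<tau> ^ p * inverse u"
      by (simp add: fs.hom_inverse fs_coordinate g power_inverse)
    also have "\<dots> \<in> q"
      using u zq by (intro valuation_ring_mult[OF v] valuation_ring_power[OF v]) (auto simp: units_def)
    finally have fz: "inverse \<tau> \<in> fs -` q" by simp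
    let ?e = "differential \<iota> \<tau>" and ?c = "- (1 / \<tau> ^ 2)"
    have c: "?c \<noteq> 0" using coordinate_nonzero by simp
    have "D (1 / \<tau>) = ?c"
      using derivations_divide[OF derivation coordinate_nonzero, of 1]
        derivations_0[OF derivation] derivation_coordinate by simp
    hence d: "differential \<iota> (inverse \<tau>) = smul (cotangent \<iota>) ?c ?e"
      by (simp add: differential_eq[of "inverse \<tau>"] divide_inverse)
    have "generates V q (hom_map fs (cotangent \<iota>) (differential \<iota> (inverse \<tau>))
        (cotangent \<iota>) (differential \<iota> (inverse \<tau>)))"
      unfolding hom_cotangent_def
      by (intro generates_hom[OF fs inv.frame_cotangent inv.frame_cotangent v]
          inv.generates_cotangent valuation_ring_pullback v fz zq)
    also have "hom_map fs (cotangent \<iota>) (differential \<iota> (inverse \<tau>))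
        (cotangent \<iota>) (differential \<iota> (inverse \<tau>)) = smul V (?c / fs ?c) differential_hom"
      unfolding d differential_hom_def hom_cotangent_def by (rule hom_map_smul[OF fs frame_cotangent frame_cotangent c c])
    also have "?c / fs ?c = u ^ 2 * \<tau> ^ (2 * p - 2)"
    proof -
      have "fs ?c = - (1 / (\<tau> ^ p * u) ^ 2)"
        by (simp add: fs.hom_uminus fs.hom_div fs.hom_power fs_coordinate g)
      hence "?c / fs ?c = u ^ 2 * ((\<tau> ^ p) ^ 2 / \<tau> ^ 2)"
        by (simp add: power_mult_distrib)
      also have "(\<tau> ^ p) ^ 2 / \<tau> ^ 2 = \<tau> ^ (2 * p - 2)"
        using p_ge_3 coordinate_nonzero by (simp add: power_mult[symmetric] power_diff mult.commute)
      finally show ?thesis .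
    qed
    also have "smul V (u ^ 2 * \<tau> ^ (2 * p - 2)) differential_hom = smul V (u ^ 2) (smul V (\<tau> ^ (2 * p - 2)) differential_hom)"
      by (rule frame_mult_smul[OF frame_V frame_gen[OF frame_V]])
    finally have g: "generates V q (smul V (u ^ 2) (smul V (\<tau> ^ (2 * p - 2)) differential_hom))" .
    have F: "frame V (smul V (\<tau> ^ (2 * p - 2)) differential_hom)"
      using coordinate_nonzero by (intro frame_smul[OF frame_V]) simp
    have u2: "inverse (u ^ 2) \<in> units q" by (intro units_inverse[OF v] units_power[OF v] u)
    hence "inverse (u ^ 2) * u ^ 2 = 1" by (simp add: units_def)
    hence "smul V (inverse (u ^ 2)) (smul V (u ^ 2) (smul V (\<tau> ^ (2 * p - 2)) differential_hom))
        = smul V (\<tau> ^ (2 * p - 2)) differential_hom"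
      using frame_mult_smul[OF F frame_gen[OF F], of "inverse (u ^ 2)" "u ^ 2", symmetric]
        frame_smul_1[OF F frame_gen[OF F]] by simp
    thus ?thesis using generates_smul_iff[OF generates_frame[OF frame_V g] v g] u2 by metis
  qed
  ultimately show ?thesis using frame_V by (simp add: twisted_def)
qed

text \<open>The chain rule with the derivative p \<tau>^(p-1) - 1 of \<tau>^p - \<tau>, whose first
  term vanishes in characteristic p.\<close>

lemma derivation_pullback: "D (fs z) = - fs (D z)"
proof -
  obtain a b where b: "b \<noteq> 0" and z: "z = poly_eval \<iota> a \<tau> / poly_eval \<iota> b \<tau>"
    using generated by blast
  have D: "D (fs \<tau>) = - 1"
    using derivations_0[OF derivation] derivations_power[OF derivation, of \<tau> p]
      char_p derivation_coordinate by (simp add: fs_coordinate)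
  have c: "D (fs (poly_eval \<iota> a \<tau>)) = - fs (D (poly_eval \<iota> a \<tau>))" for a
    by (simp add: fs_poly_eval derivations_poly_eval[OF derivation] D derivation_coordinate)
  have nz: "poly_eval \<iota> b \<tau> \<noteq> 0" using transcendental[OF b] .
  hence nz': "fs (poly_eval \<iota> b \<tau>) \<noteq> 0" by simp
  show ?thesis
    unfolding z fs.hom_div derivations_divide[OF derivation nz] derivations_divide[OF derivation nz'] c
    by (simp add: fs.hom_div fs.hom_minus fs.hom_mult fs.hom_power minus_divide_left)
qed

text \<open>Uniqueness holds because d\<tau> is a frame and has to go to d(\<tau>^p - \<tau>) = -
  d\<tau>; that the resulting map is right on every dz is
  \<open>derivation_pullback\<close>.\<close>

lemma pullback_differential_eq: "pullback_differential \<iota> \<iota> fs = smul V (- 1) differential_hom"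
  unfolding pullback_differential_def
proof (rule the_equality, intro conjI allI)
  let ?C = "cotangent \<iota>"
  note C = frame_cotangent and Cg = frame_gen[OF frame_cotangent]
  show "smul V (- 1) differential_hom \<in> gen V" by (intro frame_smul_closed[OF frame_V] frame_gen[OF frame_V])
  fix z
  have "smul V (- 1) differential_hom (differential \<iota> z) = smul ?C (- 1) (smul ?C (fs (D z)) (differential \<iota> \<tau>))"
    unfolding hom_cotangent_def smul_hom_pullback differential_hom_def differential_eq[of z]
      hom_map_frame[OF fs frame_cotangent frame_cotangent] ..
  also have "\<dots> = smul ?C (- fs (D z)) (differential \<iota> \<tau>)"
    by (simp add: frame_mult_smul[OF C Cg, symmetric])
  finally show "smul V (- 1) differential_hom (differential \<iota> z) = differential \<iota> (fs z)"
    by (simp add: differential_eq[of "fs z"] derivation_pullback)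
next
  fix h assume h: "h \<in> gen V \<and> (\<forall>z. h (differential \<iota> z) = differential \<iota> (fs z))"
  have "h (differential \<iota> \<tau>) = smul (cotangent \<iota>) (- 1) (differential \<iota> \<tau>)"
    using h by (simp add: differential_eq[of "fs \<tau>"] derivation_pullback derivation_coordinate)
  moreover have "h \<in> gen (hom_pullback fs (cotangent \<iota>) (cotangent \<iota>))"
    using h by (simp add: hom_cotangent_def)
  ultimately show "h = smul V (- 1) differential_hom"
    unfolding hom_cotangent_def differential_hom_def by (intro hom_pullback_eq[OF fs frame_cotangent frame_cotangent])
qed

text \<open>With respect to local generators the section is the unit - 1 on the affine line and -
  (1/\<tau>)^(2p-2) at infinity, where the exponent is positive.\<close>

lemma zeros_pullback_differential:
  "zeros \<iota> V (smul V (- 1) differential_hom) = {q \<in> closed_points \<iota>. inverse \<tau> \<in> max_ideal q}"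
proof -
  interpret inv: rational_function_field \<iota> "inverse \<tau>" "\<lambda>z. - (\<tau> ^ 2) * D z"
    by (rule inverse_coordinate)
  have "smul V (- 1) differential_hom \<in> stalk_power V q 1 \<longleftrightarrow> inverse \<tau> \<in> max_ideal q"
    if q: "q \<in> closed_points \<iota>" for q
  proof -
    have v: "valuation_ring \<iota> q" using q by (simp add: closed_points_iff)
    from q show ?thesis
    proof (cases rule: closed_point_cases)
      case 1
      have "- 1 \<notin> ideal_power q 1"
        using ideal_power_Suc_subset[OF v, of "- 1" 0] units_minus[OF v units_1[OF v]]
          units_iff[OF v] by auto
      moreover have "inverse \<tau> \<notin> max_ideal q" using 1 coordinate_nonzero by (auto simp: max_ideal_def)
      ultimately show ?thesis using twisted_stalk_power_iff(1)[OF twisted_V q 1] by blast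
    next
      case 2
      have zq: "inverse \<tau> \<in> q" using 2 by (simp add: max_ideal_def)
      have "2 * p - 2 = Suc (2 * p - 3)" using p_ge_3 by simp
      hence "- 1 * inverse \<tau> ^ (2 * p - 2) = inverse \<tau> ^ 1 * (- (inverse \<tau> ^ (2 * p - 3)))"
        by simp
      moreover have "- (inverse \<tau> ^ (2 * p - 3)) \<in> q"
        by (intro valuation_ring_minus[OF v] valuation_ring_power[OF v] zq)
      ultimately have "- 1 * inverse \<tau> ^ (2 * p - 2) \<in> ideal_power q 1"
        unfolding inv.ideal_power_principal[OF v 2] by blast
      thus ?thesis using twisted_stalk_power_iff(2)[OF twisted_V q 2] 2 by blast
    qed
  qed
  thus ?thesis by (auto simp: zeros_def)
qed

end

section \<open>The genus of the projective line\<close>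

text \<open>A nonconstant divisor of least degree is irreducible, and irreducible polynomials over a
  field are prime.\<close>

lemma exists_prime_factor:
  fixes b :: "'l::field poly"
  assumes "degree b \<noteq> 0"
  shows "\<exists>\<pi>. prime_elem \<pi> \<and> \<pi> dvd b"
proof -
  have b0: "b \<noteq> 0" using assms by auto
  obtain \<pi> where \<pi>: "degree \<pi> \<noteq> 0 \<and> \<pi> dvd b"
    and min: "\<And>c. degree c \<noteq> 0 \<and> c dvd b \<Longrightarrow> degree \<pi> \<le> degree c"
    using ex_has_least_nat[of "\<lambda>c. degree c \<noteq> 0 \<and> c dvd b" b degree] assms by auto
  have "irreducible \<pi>"
  proof (rule irreducibleI)
    show "\<pi> \<noteq> 0" using \<pi> by auto
    thus "\<not> \<pi> dvd 1" using \<pi> by (simp add: is_unit_iff_degree)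
    fix u v assume uv: "\<pi> = u * v"
    have nz: "u \<noteq> 0" "v \<noteq> 0" using \<pi> uv by auto
    have "degree u = 0 \<or> degree v = 0"
    proof (rule ccontr)
      assume *: "\<not> (degree u = 0 \<or> degree v = 0)"
      have "u dvd b" using \<pi> uv by (metis dvd_mult_left)
      hence "degree \<pi> \<le> degree u" using min * by blast
      thus False using * nz uv by (simp add: degree_mult_eq)
    qed
    thus "u dvd 1 \<or> v dvd 1" using nz by (auto simp: is_unit_iff_degree)
  qed
  thus ?thesis using field_poly_irreducible_imp_prime \<pi> by blast
qed

context rational_function_field
begin

lemma poly_eval_inject: "poly_eval \<iota> a \<tau> = poly_eval \<iota> b \<tau> \<longleftrightarrow> a = b"
  using transcendental[of "a - b"] by (auto simp: poly_eval_diff)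

text \<open>A denominator of least degree works, since a common factor that is not a unit could be
  cancelled.\<close>

lemma reduced_fraction:
  assumes "\<not> is_unit \<pi>"
  shows "\<exists>a b. b \<noteq> 0 \<and> z = poly_eval \<iota> a \<tau> / poly_eval \<iota> b \<tau> \<and> \<not> (\<pi> dvd a \<and> \<pi> dvd b)"
proof -
  define rep where "rep b \<longleftrightarrow> b \<noteq> 0 \<and> (\<exists>a. z = poly_eval \<iota> a \<tau> / poly_eval \<iota> b \<tau>)" for b
  have "\<exists>b. rep b" using generated[of z] by (auto simp: rep_def)
  then obtain b where b: "rep b" and min: "\<And>b'. rep b' \<Longrightarrow> degree b \<le> degree b'"
    using ex_has_least_nat[of rep _ degree] by blast
  then obtain a where b0: "b \<noteq> 0" and z: "z = poly_eval \<iota> a \<tau> / poly_eval \<iota> b \<tau>"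
    by (auto simp: rep_def)
  have "\<not> (\<pi> dvd a \<and> \<pi> dvd b)"
  proof
    assume "\<pi> dvd a \<and> \<pi> dvd b"
    then obtain a' b' where ab: "a = \<pi> * a'" "b = \<pi> * b'" by (auto elim!: dvdE)
    hence nz: "\<pi> \<noteq> 0" "b' \<noteq> 0" using b0 by auto
    hence "rep b'" using z transcendental[of \<pi>] unfolding ab poly_eval_mult rep_def by auto
    hence "degree b \<le> degree b'" by (rule min)
    thus False using nz assms unfolding ab by (simp add: degree_mult_eq is_unit_iff_degree)
  qed
  thus ?thesis using b0 z by blast
qed

text \<open>The localization of L[\<tau>] at \<pi>. These rings supply enough closed points to
  detect every pole on the affine line.\<close>

definition prime_point :: "'l poly \<Rightarrow> 'k set" where
  "prime_point \<pi> = {poly_eval \<iota> a \<tau> / poly_eval \<iota> b \<tau> | a b. \<not> \<pi> dvd b}"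

text \<open>Two presentations of the fraction are compared by cross multiplication: a prime that
  divides b but not the other denominator would divide a.\<close>

lemma prime_point_iff:
  assumes "prime_elem \<pi>" "b \<noteq> 0" "\<not> (\<pi> dvd a \<and> \<pi> dvd b)"
  shows "poly_eval \<iota> a \<tau> / poly_eval \<iota> b \<tau> \<in> prime_point \<pi> \<longleftrightarrow> \<not> \<pi> dvd b"
proof
  assume "poly_eval \<iota> a \<tau> / poly_eval \<iota> b \<tau> \<in> prime_point \<pi>"
  then obtain c e where e: "\<not> \<pi> dvd e"
    and eq: "poly_eval \<iota> a \<tau> / poly_eval \<iota> b \<tau> = poly_eval \<iota> c \<tau> / poly_eval \<iota> e \<tau>"
    unfolding prime_point_def by blast
  have "e \<noteq> 0" using e by auto
  hence "poly_eval \<iota> (a * e) \<tau> = poly_eval \<iota> (c * b) \<tau>"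
    using eq transcendental[of b] transcendental[of e] assms(2)
    by (simp add: poly_eval_mult frac_eq_eq)
  hence "a * e = c * b" by (simp only: poly_eval_inject)
  hence "\<pi> dvd a" if "\<pi> dvd b"
    using that e prime_elem_dvd_multD[OF assms(1), of a e] by simp
  thus "\<not> \<pi> dvd b" using assms(3) by blast
qed (auto simp: prime_point_def)

lemma prime_point_closed_point:
  assumes \<pi>: "prime_elem \<pi>"
  shows "prime_point \<pi> \<in> closed_points \<iota>"
proof -
  let ?q = "prime_point \<pi>"
  have n1: "\<not> \<pi> dvd 1" using \<pi> by (simp add: prime_elem_def)
  have "\<iota> c \<in> ?q" for c
  proof -
    have "\<iota> c = poly_eval \<iota> [:c:] \<tau> / poly_eval \<iota> 1 \<tau>" by simp
    thus ?thesis unfolding prime_point_def using n1 by blast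
  qed
  moreover have "u - v \<in> ?q \<and> u * v \<in> ?q" if uv: "u \<in> ?q" "v \<in> ?q" for u v
  proof -
    obtain a b where u: "u = poly_eval \<iota> a \<tau> / poly_eval \<iota> b \<tau>" and b: "\<not> \<pi> dvd b"
      using uv(1) unfolding prime_point_def by blast
    obtain c d where v: "v = poly_eval \<iota> c \<tau> / poly_eval \<iota> d \<tau>" and d: "\<not> \<pi> dvd d"
      using uv(2) unfolding prime_point_def by blast
    have bd: "\<not> \<pi> dvd b * d" using b d \<pi> by (simp add: prime_elem_dvd_mult_iff)
    have nz: "poly_eval \<iota> b \<tau> \<noteq> 0" "poly_eval \<iota> d \<tau> \<noteq> 0"
      using b d by (auto intro!: transcendental)
    have "u - v = poly_eval \<iota> (a * d - c * b) \<tau> / poly_eval \<iota> (b * d) \<tau>"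
      unfolding u v poly_eval_diff poly_eval_mult using nz by (simp add: diff_frac_eq)
    moreover have "u * v = poly_eval \<iota> (a * c) \<tau> / poly_eval \<iota> (b * d) \<tau>"
      unfolding u v poly_eval_mult by simp
    ultimately show ?thesis using bd unfolding prime_point_def by blast
  qed
  moreover have "z \<in> ?q \<or> inverse z \<in> ?q" for z
  proof -
    obtain a b where "z = poly_eval \<iota> a \<tau> / poly_eval \<iota> b \<tau>" "\<not> (\<pi> dvd a \<and> \<pi> dvd b)"
      using reduced_fraction[of \<pi> z] n1 by blast
    moreover from this have "inverse z = poly_eval \<iota> b \<tau> / poly_eval \<iota> a \<tau>" by simp
    ultimately show ?thesis unfolding prime_point_def by blast
  qed
  moreover have "poly_eval \<iota> 1 \<tau> / poly_eval \<iota> \<pi> \<tau> \<notin> ?q"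
    using prime_point_iff[OF \<pi>, of \<pi> 1] n1 \<pi> by (auto simp: prime_elem_def)
  hence "?q \<noteq> UNIV" by blast
  ultimately show ?thesis unfolding closed_points_def by blast
qed

lemma prime_elem_X: "prime_elem ([:0, 1:] :: 'l poly)"
  by (rule field_poly_irreducible_imp_prime[OF irreducible_linear_field_poly]) simp

lemma coordinate_in_prime_point:
  assumes "prime_elem \<pi>"
  shows "\<tau> \<in> prime_point \<pi>"
proof -
  have "\<tau> = poly_eval \<iota> [:0, 1:] \<tau> / poly_eval \<iota> 1 \<tau>" by simp
  moreover have "\<not> \<pi> dvd 1" using assms by (simp add: prime_elem_def)
  ultimately show ?thesis unfolding prime_point_def by blast
qed

text \<open>Read for the inverse coordinate, this provides the point at infinity in the abstract
  setting.\<close>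

lemma exists_zero: "\<exists>q\<in>closed_points \<iota>. \<tau> \<in> max_ideal q"
proof (rule bexI)
  show "prime_point [:0, 1:] \<in> closed_points \<iota>" by (rule prime_point_closed_point[OF prime_elem_X])
  have "poly_eval \<iota> 1 \<tau> / poly_eval \<iota> [:0, 1:] \<tau> \<notin> prime_point [:0, 1:]"
    using prime_point_iff[OF prime_elem_X, of "[:0, 1:]" 1] prime_elem_X by (auto simp: prime_elem_def)
  thus "\<tau> \<in> max_ideal (prime_point [:0, 1:])"
    using coordinate_in_prime_point[OF prime_elem_X] by (simp add: max_ideal_def divide_inverse)
qed

text \<open>Let r d\<tau> be a global section. A prime factor of the reduced denominator of r would
  give a pole on the affine line, so r is a polynomial. As d\<tau> = - \<tau>^2 d(1/\<tau>) has a
  double pole at infinity, a nonzero r would lead to a pole of order deg r + 2 there.\<close>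

lemma sections_cotangent: "sections (cotangent \<iota>) (closed_points \<iota>) = {0}"
proof -
  let ?C = "cotangent \<iota>" and ?d = "differential \<iota> \<tau>"
  interpret inv: rational_function_field \<iota> "inverse \<tau>" "\<lambda>z. - (\<tau> ^ 2) * D z"
    by (rule inverse_coordinate)
  note C = frame_cotangent and Cg = frame_gen[OF frame_cotangent]
  obtain q0 where q0: "q0 \<in> closed_points \<iota>" and z: "inverse \<tau> \<in> max_ideal q0"
    using inv.exists_zero by blast
  have v0: "valuation_ring \<iota> q0" using q0 by (simp add: closed_points_iff)
  have zq: "inverse \<tau> \<in> q0" using z by (simp add: max_ideal_def)
  have mem: "smul ?C r ?d \<in> stalk ?C q \<longleftrightarrow> r \<in> q" if "q \<in> closed_points \<iota>" "\<tau> \<in> q" for r q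
    using generates_cotangent[of q] that frame_cancel[OF C] by (auto simp: closed_points_iff generates_def)
  have mem0: "smul ?C r ?d \<in> stalk ?C q0 \<longleftrightarrow> r * \<tau> ^ 2 \<in> q0" for r
  proof -
    have g: "generates ?C q0 (differential \<iota> (inverse \<tau>))" by (rule inv.generates_cotangent[OF v0 zq])
    have "?d = smul ?C (- (\<tau> ^ 2)) (differential \<iota> (inverse \<tau>))"
      using inv.differential_eq[of \<tau>] derivation_coordinate by simp
    hence "smul ?C r ?d = smul ?C (- (r * \<tau> ^ 2)) (differential \<iota> (inverse \<tau>))"
      by (simp add: frame_mult_smul[OF inv.frame_cotangent frame_gen[OF inv.frame_cotangent], symmetric])
    hence "smul ?C r ?d \<in> stalk ?C q0 \<longleftrightarrow> - (r * \<tau> ^ 2) \<in> q0"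
      using g frame_cancel[OF inv.frame_cotangent] by (auto simp: generates_def)
    thus ?thesis using valuation_ring_minus[OF v0, of "r * \<tau> ^ 2"]
        valuation_ring_minus[OF v0, of "- (r * \<tau> ^ 2)"] by auto
  qed
  have "r = 0" if r: "smul ?C r ?d \<in> sections ?C (closed_points \<iota>)" for r
  proof (rule ccontr)
    assume "r \<noteq> 0"
    have rq: "r \<in> q" if "q \<in> closed_points \<iota>" "\<tau> \<in> q" for q
      using r mem[OF that] that by (auto simp: sections_def)
    obtain b where "b \<noteq> 0 \<and> (\<exists>a. r = poly_eval \<iota> a \<tau> / poly_eval \<iota> b \<tau>)"
      and min: "\<And>c. c \<noteq> 0 \<and> (\<exists>a. r = poly_eval \<iota> a \<tau> / poly_eval \<iota> c \<tau>) \<Longrightarrow> degree b \<le> degree c"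
      using ex_has_least_nat[of "\<lambda>b. b \<noteq> 0 \<and> (\<exists>a. r = poly_eval \<iota> a \<tau> / poly_eval \<iota> b \<tau>)" _ degree]
        generated[of r] by blast
    then obtain a where b: "b \<noteq> 0" and ra: "r = poly_eval \<iota> a \<tau> / poly_eval \<iota> b \<tau>" by blast
    have "degree b = 0"
    proof (rule ccontr)
      assume "degree b \<noteq> 0"
      then obtain \<pi> where \<pi>: "prime_elem \<pi>" "\<pi> dvd b" using exists_prime_factor by blast
      have "r \<in> prime_point \<pi>"
        by (rule rq[OF prime_point_closed_point[OF \<pi>(1)] coordinate_in_prime_point[OF \<pi>(1)]])
      hence "\<pi> dvd a" using prime_point_iff[OF \<pi>(1) b, of a] \<pi>(2) ra by blast
      then obtain a' b' where ab: "a = \<pi> * a'" "b = \<pi> * b'" using \<pi>(2) by (auto elim!: dvdE)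
      have nz: "\<pi> \<noteq> 0" "b' \<noteq> 0" using b ab by auto
      have "r = poly_eval \<iota> a' \<tau> / poly_eval \<iota> b' \<tau>"
        using transcendental[OF nz(1)] unfolding ra ab poly_eval_mult by simp
      hence "degree b \<le> degree b'" using min nz by blast
      moreover have "degree \<pi> \<noteq> 0"
        using \<pi>(1) nz by (auto simp: prime_elem_def is_unit_iff_degree)
      ultimately show False using nz unfolding ab by (simp add: degree_mult_eq)
    qed
    then obtain c where "b = [:c:]" by (rule degree_eq_zeroE)
    hence c: "r = poly_eval \<iota> (smult (inverse c) a) \<tau>"
      unfolding ra by (simp add: poly_eval_smult hom_inverse divide_inverse mult.commute)
    define a' where "a' = smult (inverse c) a"
    have a'0: "a' \<noteq> 0" using c \<open>r \<noteq> 0\<close> by (auto simp: a'_def)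
    \<comment> \<open>The reflected polynomial has the leading coefficient as constant term, so w is
      a unit at infinity and r is \<tau>^(deg a') times this unit.\<close>
    define w where "w = poly_eval \<iota> (reflect_poly a') (inverse \<tau>)"
    have "poly (reflect_poly a') 0 \<noteq> 0" using a'0 by (simp add: poly_0_coeff_0)
    hence w: "w \<in> units q0" unfolding w_def inv.poly_eval_coordinate_unit_iff[OF v0 z] .
    have "w = inverse \<tau> ^ degree a' * r"
      unfolding w_def c a'_def[symmetric] using coordinate_nonzero by (simp add: poly_eval_reflect)
    hence rw: "r = \<tau> ^ degree a' * w" using coordinate_nonzero
      by (simp add: mult.assoc[symmetric] power_mult_distrib[symmetric])
    have "smul ?C r ?d \<in> stalk ?C q0" using r q0 by (auto simp: sections_def)
    hence "w * \<tau> ^ (degree a' + 2) \<in> q0" unfolding mem0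
      by (simp add: rw power2_eq_square mult_ac)
    hence "\<tau> ^ (degree a' + 2) \<in> q0"
      using units_cancel_right[OF v0 w, of "\<tau> ^ (degree a' + 2)"] by (simp only: mult.commute)
    moreover have "inverse \<tau> * inverse \<tau> ^ (degree a' + 1) \<in> max_ideal q0"
      by (intro max_ideal_mult_right[OF v0 z] valuation_ring_power[OF v0] zq)
    hence "inverse \<tau> ^ (degree a' + 2) \<in> max_ideal q0" by simp
    ultimately have "\<tau> ^ (degree a' + 2) * inverse \<tau> ^ (degree a' + 2) \<in> max_ideal q0"
      by (rule max_ideal_mult[OF v0])
    also have "\<tau> ^ (degree a' + 2) * inverse \<tau> ^ (degree a' + 2) = 1"
      using coordinate_nonzero by (simp only: power_mult_distrib[symmetric] right_inverse power_one simp_thms)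
    finally show False using max_ideal_1[OF v0] by blast
  qed
  moreover have "sections ?C (closed_points \<iota>) \<subseteq> gen ?C"
  proof
    fix v assume "v \<in> sections ?C (closed_points \<iota>)"
    hence "v \<in> stalk ?C q0" using q0 by (auto simp: sections_def)
    then obtain a where "v = smul ?C a (differential \<iota> (inverse \<tau>))"
      using inv.generates_cotangent[OF v0 zq] by (auto simp: generates_def)
    thus "v \<in> gen ?C"
      using frame_smul_closed[OF inv.frame_cotangent frame_gen[OF inv.frame_cotangent]] by simp
  qed
  ultimately have "sections ?C (closed_points \<iota>) \<subseteq> {0}"
    using frame_cases[OF C] frame_0_smul[OF C Cg] by blast
  moreover have "0 \<in> stalk ?C q" if q: "q \<in> closed_points \<iota>" for q
    using q
  proof (cases rule: closed_point_cases)
    case 1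
    thus ?thesis using mem[OF q 1, of 0] valuation_ring_0[of \<iota> q] q frame_0_smul[OF C Cg]
      by (simp add: closed_points_iff)
  next
    case 2
    hence "q = q0" using inv.valuation_ring_unique q v0 z by (simp add: closed_points_iff)
    thus ?thesis using mem0[of 0] valuation_ring_0[OF v0] frame_0_smul[OF C Cg] by simp
  qed
  ultimately show ?thesis by (auto simp: sections_def)
qed

lemma genus_0: "genus \<iota> = 0"
proof -
  let ?s = "\<lambda>c. smul (cotangent \<iota>) (\<iota> c)"
  have s: "?s = (\<lambda>c h v. \<iota> c * h v)"
    by (intro ext) (simp add: cotangent_def hom_bundle_def smul_hom_pullback structure_sheaf_def)
  interpret vector_space ?s
    unfolding s by unfold_locales (auto simp: hom_add hom_mult algebra_simps)
  have "dim {0} = 0"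
    by (rule dim_unique[of "{}"]) (auto simp: independent_empty)
  thus ?thesis unfolding genus_def sections_cotangent .
qed

lemma euler_A1_eq: "euler_A1 \<iota> = gw_hyp"
  by (simp add: euler_A1_def genus_0 zmult_def)

end

section \<open>The degree of the Artin--Schreier map\<close>

text \<open>The nonzero terms have degrees deg(a_i) p + i, which are distinct because they differ
  modulo p; the term of largest degree cannot be cancelled.\<close>

lemma pcompose_expansion_unique:
  fixes G :: "'l::field poly"
  assumes G: "degree G = p" "0 < p" and sum: "(\<Sum>i<p. pcompose (a i) G * monom 1 i) = 0" and j: "j < p"
  shows "a j = 0"
proof (rule ccontr)
  assume "a j \<noteq> 0"
  define I where "I = {i. i < p \<and> a i \<noteq> 0}"
  define d where "d i = degree (a i) * p + i" for i
  have I: "finite I" "I \<noteq> {}" using \<open>a j \<noteq> 0\<close> j by (auto simp: I_def)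
  hence "Max (d ` I) \<in> d ` I" by (intro Max_in) auto
  then obtain m where m: "m \<in> I" "d m = Max (d ` I)" by auto
  have nz: "pcompose (a i) G \<noteq> 0" if "i \<in> I" for i
    using that G by (auto simp: I_def pcompose_eq_0_iff)
  have deg: "degree (pcompose (a i) G * monom 1 i) = d i" if "i \<in> I" for i
    using that nz[OF that] G by (simp add: d_def degree_mult_eq degree_monom_eq degree_pcompose monom_eq_0_iff)
  have "coeff (pcompose (a i) G * monom 1 i) (d m) = 0" if "i < p" "i \<noteq> m" for i
  proof (cases "i \<in> I")
    case True
    have "d i \<le> d m" using True I m by simp
    moreover have "d i mod p = i" "d m mod p = m" using that m(1) by (simp_all add: d_def I_def)
    hence "d i \<noteq> d m" using that by metis
    ultimately show ?thesis using deg[OF True] by (intro coeff_eq_0) simp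
  qed (use that in \<open>simp add: I_def\<close>)
  hence "coeff (\<Sum>i<p. pcompose (a i) G * monom 1 i) (d m) = coeff (pcompose (a m) G * monom 1 m) (d m)"
    using m by (simp add: coeff_sum I_def sum.remove[of _ m])
  also have "\<dots> = lead_coeff (pcompose (a m) G * monom 1 m)" using deg[OF m(1)] by simp
  also have "\<dots> \<noteq> 0" unfolding leading_coeff_0_iff using nz[OF m(1)] by (simp add: monom_eq_0_iff)
  finally show False using sum by simp
qed

lemma (in field_hom) poly_eval_monom: "poly_eval hom (monom c n) x = hom c * x ^ n"
  by (induction n) (simp_all add: monom_0 monom_Suc)

lemma (in field_hom) poly_eval_sum: "poly_eval hom (\<Sum>i\<in>A. f i) x = (\<Sum>i\<in>A. poly_eval hom (f i) x)"
  by (induction A rule: infinite_finite_induct) (simp_all add: poly_eval_add)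

lemma (in rational_function_field) common_denominator:
  "\<exists>c a. c \<noteq> 0 \<and> (\<forall>i<n::nat. r i = poly_eval \<iota> (a i) \<tau> / poly_eval \<iota> c \<tau>)"
proof (induction n)
  case 0
  show ?case by (intro exI[of _ 1]) simp
next
  case (Suc n)
  then obtain c a where c: "c \<noteq> 0" and a: "\<And>i. i < n \<Longrightarrow> r i = poly_eval \<iota> (a i) \<tau> / poly_eval \<iota> c \<tau>"
    by blast
  obtain b d where d: "d \<noteq> 0" and b: "r n = poly_eval \<iota> b \<tau> / poly_eval \<iota> d \<tau>"
    using generated by blast
  have nz: "poly_eval \<iota> c \<tau> \<noteq> 0" "poly_eval \<iota> d \<tau> \<noteq> 0" using c d transcendental by auto
  have "r i = poly_eval \<iota> (if i = n then b * c else a i * d) \<tau> / poly_eval \<iota> (c * d) \<tau>" if "i < Suc n" for i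
    using that a[of i] b nz by (cases "i = n") (simp_all add: poly_eval_mult)
  moreover have "c * d \<noteq> 0" using c d by simp
  ultimately show ?case
    by (intro exI[of _ "c * d"] exI[of _ "\<lambda>i. if i = n then b * c else a i * d"]) simp
qed

context artin_schreier
begin

interpretation fs: field_hom fs by (rule fs)

text \<open>The function field of the source as a vector space over that of the target, which acts
  through \<open>fs\<close>.\<close>

interpretation vs: vector_space "\<lambda>a z. fs a * z"
  by unfold_locales (simp_all add: distrib_left distrib_right fs.hom_add fs.hom_mult mult.assoc)

abbreviation "powers_span \<equiv> vs.span ((\<lambda>i. \<tau> ^ i) ` {..<p})"

lemma span_mult_coordinate:
  assumes "s \<in> powers_span"
  shows "\<tau> * s \<in> powers_span"
  using assms
proof (induction rule: vs.span_induct_alt)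
  case base
  show ?case by (simp add: vs.span_zero)
next
  case (step c b z)
  obtain i where i: "i < p" "b = \<tau> ^ i" using step(1) by blast
  have "\<tau> * b \<in> powers_span"
  proof (cases "Suc i < p")
    case True
    hence "\<tau> ^ Suc i \<in> powers_span" by (intro vs.span_base) blast
    thus ?thesis by (simp add: i)
  next
    case False
    hence "p = Suc i" using i by simp
    hence "\<tau> * b = \<tau> ^ p" by (simp add: i)
    \<comment> \<open>The equation \<tau>^p = \<tau> + fs \<tau> brings the first power outside the
      range back to exponents 1 and 0, both below p.\<close>
    also have "\<dots> = \<tau> ^ 1 + fs \<tau> * \<tau> ^ 0" by (simp add: fs_coordinate)
    also have "\<dots> \<in> powers_span" using p_ge_3
      by (intro vs.span_add vs.span_scale vs.span_base imageI) auto
    finally show ?thesis .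
  qed
  hence "fs c * (\<tau> * b) + \<tau> * z \<in> powers_span" using step by (intro vs.span_add vs.span_scale)
  thus ?case by (simp add: algebra_simps)
qed

lemma span_mult_poly:
  assumes "s \<in> powers_span"
  shows "poly_eval \<iota> a \<tau> * s \<in> powers_span"
proof (induction a)
  case (pCons c a)
  have "fs (\<iota> c) * s + \<tau> * (poly_eval \<iota> a \<tau> * s) \<in> powers_span"
    using pCons assms by (intro vs.span_add vs.span_scale span_mult_coordinate)
  thus ?case by (simp add: fs_const distrib_right mult.assoc)
qed (simp add: vs.span_zero)

lemma one_in_span: "1 \<in> powers_span"
proof -
  have "\<tau> ^ 0 \<in> powers_span" using p_ge_3 by (intro vs.span_base imageI) auto
  thus ?thesis by simp
qed

text \<open>The p + 1 powers up to exponent p lie in a space spanned by at most p vectors, so they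
  are dependent. Dependence concerns sets; coinciding powers are treated separately with the
  polynomial s^i - s^j.\<close>

lemma algebraic_over_pullback:
  assumes pow: "\<And>i. \<beta> ^ i \<in> powers_span"
  shows "\<exists>f. f \<noteq> 0 \<and> poly_eval fs f \<beta> = 0"
proof (cases "inj_on (\<lambda>i. \<beta> ^ i) {..p}")
  case True
  let ?T = "(\<lambda>i. \<beta> ^ i) ` {..p}"
  have "vs.dependent ?T"
  proof (rule ccontr)
    assume "\<not> vs.dependent ?T"
    hence "card ?T \<le> card ((\<lambda>i. \<tau> ^ i) ` {..<p})"
      using vs.independent_span_bound[of "(\<lambda>i. \<tau> ^ i) ` {..<p}" ?T] pow by blast
    also have "\<dots> \<le> p" using card_image_le[of "{..<p}"] by simp
    finally show False by (simp add: card_image[OF True])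
  qed
  then obtain u v where v: "v \<in> ?T" "u v \<noteq> 0" and sum: "(\<Sum>v\<in>?T. fs (u v) * v) = 0"
    using vs.dependent_finite[of ?T] by auto
  define f where "f = (\<Sum>i\<le>p. monom (u (\<beta> ^ i)) i)"
  have "poly_eval fs f \<beta> = 0"
    using sum unfolding f_def fs.poly_eval_sum fs.poly_eval_monom sum.reindex[OF True] by simp
  moreover obtain j where "j \<le> p" "v = \<beta> ^ j" using v by auto
  hence "coeff f j \<noteq> 0" using v(2) by (simp add: f_def coeff_sum coeff_monom)
  hence "f \<noteq> 0" by auto
  ultimately show ?thesis by blast
next
  case False
  then obtain i j where ij: "\<beta> ^ i = \<beta> ^ j" "i \<noteq> j" unfolding inj_on_def by blast
  have "poly_eval fs (monom 1 i - monom 1 j) \<beta> = 0"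
    using ij by (simp add: fs.poly_eval_diff fs.poly_eval_monom)
  moreover have "coeff (monom 1 i - monom 1 j :: 'k poly) i = 1" using ij by simp
  hence "monom 1 i - monom 1 j \<noteq> (0 :: 'k poly)" by (metis coeff_0 zero_neq_one)
  ultimately show ?thesis by blast
qed

text \<open>The constant term of an annihilating polynomial of minimal degree is nonzero, and solving for
  it expresses the inverse as a polynomial.\<close>

lemma inverse_poly_in_span:
  assumes "b \<noteq> 0"
  shows "inverse (poly_eval \<iota> b \<tau>) \<in> powers_span"
proof -
  let ?\<beta> = "poly_eval \<iota> b \<tau>"
  have mult: "poly_eval fs f ?\<beta> \<in> powers_span" for f
  proof (induction f)
    case (pCons c f)
    have "fs c * 1 + ?\<beta> * poly_eval fs f ?\<beta> \<in> powers_span"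
      using pCons one_in_span by (intro vs.span_add vs.span_scale span_mult_poly)
    thus ?case by simp
  qed (simp add: vs.span_zero)
  have pow: "?\<beta> ^ i \<in> powers_span" for i
    using mult[of "monom 1 i"] by (simp add: fs.poly_eval_monom)
  have "\<exists>f. f \<noteq> 0 \<and> poly_eval fs f ?\<beta> = 0" by (rule algebraic_over_pullback[OF pow])
  then obtain f where f: "f \<noteq> 0" "poly_eval fs f ?\<beta> = 0"
    and min: "\<And>g. g \<noteq> 0 \<and> poly_eval fs g ?\<beta> = 0 \<Longrightarrow> degree f \<le> degree g"
    using ex_has_least_nat[of "\<lambda>f. f \<noteq> 0 \<and> poly_eval fs f ?\<beta> = 0" _ degree] by blast
  obtain c g where fg: "f = pCons c g" by (cases f)
  have eq: "fs c + ?\<beta> * poly_eval fs g ?\<beta> = 0" using f(2) unfolding fg by simp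
  have "c \<noteq> 0"
  proof
    assume "c = 0"
    hence "g \<noteq> 0" "poly_eval fs g ?\<beta> = 0" using f(1) eq transcendental[OF assms] by (auto simp: fg)
    hence "degree f \<le> degree g" using min by blast
    thus False using \<open>g \<noteq> 0\<close> by (simp add: fg degree_pCons_eq)
  qed
  hence "?\<beta> * (fs (- inverse c) * poly_eval fs g ?\<beta>) = 1"
  proof -
    have "?\<beta> * poly_eval fs g ?\<beta> = - fs c" using eq by (simp add: eq_neg_iff_add_eq_0 add.commute)
    thus ?thesis using \<open>c \<noteq> 0\<close>
      by (simp add: fs.hom_uminus fs.hom_inverse mult.left_commute[of ?\<beta>])
  qed
  hence "inverse ?\<beta> = fs (- inverse c) * poly_eval fs g ?\<beta>" by (rule inverse_unique)
  thus ?thesis using mult by (simp only: vs.span_scale)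
qed

lemma span_UNIV: "powers_span = UNIV"
proof -
  have "z \<in> powers_span" for z
  proof -
    obtain a b where b: "b \<noteq> 0" and z: "z = poly_eval \<iota> a \<tau> / poly_eval \<iota> b \<tau>"
      using generated by blast
    show ?thesis unfolding z divide_inverse by (rule span_mult_poly[OF inverse_poly_in_span[OF b]])
  qed
  thus ?thesis by blast
qed

lemma powers_inj: "inj_on (\<lambda>i. \<tau> ^ i) A"
proof (rule inj_onI)
  fix i j assume "\<tau> ^ i = \<tau> ^ j"
  hence "poly_eval \<iota> (monom 1 i - monom 1 j) \<tau> = 0" by (simp add: poly_eval_diff poly_eval_monom)
  hence "monom 1 i = (monom 1 j :: 'l poly)" using transcendental[of "monom 1 i - monom 1 j"] by auto
  hence "degree (monom 1 i :: 'l poly) = degree (monom 1 j :: 'l poly)" by simp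
  thus "i = j" by (simp add: degree_monom_eq)
qed

text \<open>Multiplied by a common denominator, a relation becomes a polynomial identity, since
  \<open>fs\<close> acts on a(\<tau>) by substituting G = s^p - s. Comparison of degrees leaves only
  the trivial one.\<close>

lemma powers_independent: "vs.independent ((\<lambda>i. \<tau> ^ i) ` {..<p})"
proof
  assume "vs.dependent ((\<lambda>i. \<tau> ^ i) ` {..<p})"
  then obtain u v where v: "v \<in> (\<lambda>i. \<tau> ^ i) ` {..<p}" "u v \<noteq> 0"
    and sum: "(\<Sum>v\<in>(\<lambda>i. \<tau> ^ i) ` {..<p}. fs (u v) * v) = 0"
    using vs.dependent_finite[of "(\<lambda>i. \<tau> ^ i) ` {..<p}"] by auto
  define r where "r i = u (\<tau> ^ i)" for i
  have rs: "(\<Sum>i<p. fs (r i) * \<tau> ^ i) = 0"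
    using sum unfolding sum.reindex[OF powers_inj] by (simp add: r_def)
  obtain c a where c: "c \<noteq> 0" and a: "\<And>i. i < p \<Longrightarrow> r i = poly_eval \<iota> (a i) \<tau> / poly_eval \<iota> c \<tau>"
    using common_denominator by metis
  define G :: "'l poly" where "G = monom 1 p - monom 1 1"
  have G: "poly_eval \<iota> G \<tau> = fs \<tau>"
    by (simp add: G_def poly_eval_diff poly_eval_monom fs_coordinate)
  have "degree (- monom 1 1 :: 'l poly) < degree (monom 1 p :: 'l poly)"
    using p_ge_3 by (simp add: degree_monom_eq)
  hence dG: "degree G = p"
    using degree_add_eq_left[of "- monom 1 1 :: 'l poly" "monom 1 p"] by (simp add: G_def degree_monom_eq)
  have "poly_eval \<iota> (\<Sum>i<p. pcompose (a i) G * monom 1 i) \<tau> = (\<Sum>i<p. fs (poly_eval \<iota> (a i) \<tau>) * \<tau> ^ i)"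
    by (simp add: poly_eval_sum poly_eval_mult poly_eval_monom poly_eval_pcompose G fs_poly_eval)
  also have "\<dots> = fs (poly_eval \<iota> c \<tau>) * (\<Sum>i<p. fs (r i) * \<tau> ^ i)"
    unfolding sum_distrib_left
  proof (intro sum.cong refl)
    fix i assume "i \<in> {..<p}"
    hence "poly_eval \<iota> c \<tau> * r i = poly_eval \<iota> (a i) \<tau>" using a[of i] transcendental[OF c] by simp
    thus "fs (poly_eval \<iota> (a i) \<tau>) * \<tau> ^ i = fs (poly_eval \<iota> c \<tau>) * (fs (r i) * \<tau> ^ i)"
      by (metis fs.hom_mult mult.assoc)
  qed
  finally have "(\<Sum>i<p. pcompose (a i) G * monom 1 i) = 0"
    using rs transcendental by (metis mult_zero_right)
  moreover obtain j where j: "j < p" "v = \<tau> ^ j" using v by blast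
  ultimately have "a j = 0" using dG p_ge_3 by (intro pcompose_expansion_unique[of G p a j]) auto
  hence "r j = 0" using a[OF j(1)] by simp
  thus False using v j by (simp add: r_def)
qed

lemma degree_eq: "morphism_degree fs = p"
  unfolding morphism_degree_def
proof (rule vs.dim_unique[of "(\<lambda>i. \<tau> ^ i) ` {..<p}"])
  show "card ((\<lambda>i. \<tau> ^ i) ` {..<p}) = p" by (simp add: card_image[OF powers_inj])
qed (use span_UNIV powers_independent in auto)

end

section \<open>The concrete projective line\<close>

lemma field_hom_const_fract: "field_hom const_fract"
  by unfold_locales (simp_all add: const_fract_def Zero_fract_def One_fract_def one_pCons mult.commute)

lemma poly_eval_fract: "poly_eval const_fract a coord_fract = Fract a 1"
proof -
  interpret field_hom const_fract by (rule field_hom_const_fract)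
  show ?thesis
  proof (induction a)
    case (pCons c a)
    show ?case
      unfolding poly_eval_pCons pCons.IH by (simp add: const_fract_def coord_fract_def)
  qed (simp add: Zero_fract_def)
qed

definition fract_deriv :: "'l::field poly fract \<Rightarrow> 'l poly fract" where
  "fract_deriv z = (THE w. \<exists>a b. b \<noteq> 0 \<and> z = Fract a b \<and> w = Fract (pderiv a * b - a * pderiv b) (b * b))"

text \<open>Independence of the chosen fraction: given a d = c b and the derivative of this
  equation, the two quotient rule expressions agree after clearing denominators.\<close>

lemma fract_deriv_Fract:
  assumes b: "b \<noteq> 0"
  shows "fract_deriv (Fract a b) = Fract (pderiv a * b - a * pderiv b) (b * b)"
  unfolding fract_deriv_def
proof (rule the_equality)
  fix w assume "\<exists>c d. d \<noteq> 0 \<and> Fract a b = Fract c d \<and> w = Fract (pderiv c * d - c * pderiv d) (d * d)"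
  then obtain c d where d: "d \<noteq> 0" and e: "a * d = c * b"
    and w: "w = Fract (pderiv c * d - c * pderiv d) (d * d)"
    using b by (auto simp: eq_fract)
  have "pderiv (a * d) = pderiv (c * b)" using e by simp
  hence e': "a * pderiv d + d * pderiv a = c * pderiv b + b * pderiv c" by (simp add: pderiv_mult)
  have "(pderiv c * d - c * pderiv d) * (b * b) =
      (c * pderiv b + b * pderiv c) * (b * d) - (c * b) * (pderiv b * d + b * pderiv d)"
    by (simp add: algebra_simps)
  also have "\<dots> = (a * pderiv d + d * pderiv a) * (b * d) - (a * d) * (pderiv b * d + b * pderiv d)"
    by (simp only: e e')
  also have "\<dots> = (pderiv a * b - a * pderiv b) * (d * d)"
    by (simp add: algebra_simps)
  finally have "(pderiv c * d - c * pderiv d) * (b * b) = (pderiv a * b - a * pderiv b) * (d * d)" .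
  thus "w = Fract (pderiv a * b - a * pderiv b) (b * b)" using b d by (simp add: w eq_fract)
qed (use b in blast)

lemma rational_function_field_P1: "rational_function_field const_fract coord_fract fract_deriv"
proof -
  interpret field_hom const_fract by (rule field_hom_const_fract)
  show ?thesis
  proof
    show "poly_eval const_fract a coord_fract \<noteq> 0" if "a \<noteq> 0" for a :: "'a poly"
      using that by (simp add: poly_eval_fract Zero_fract_def eq_fract)
    show "\<exists>a b. b \<noteq> 0 \<and> z = poly_eval const_fract a coord_fract / poly_eval const_fract b coord_fract"
      for z :: "'a poly fract"
      by (cases z) (auto simp: poly_eval_fract)
    show "fract_deriv \<in> derivations (const_fract :: 'a \<Rightarrow> _)"
    proof -
      have "fract_deriv (u + v) = fract_deriv u + fract_deriv v" for u v :: "'a poly fract"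
      proof -
        obtain a b where u: "u = Fract a b" "b \<noteq> 0" by (cases u) auto
        obtain c d where v: "v = Fract c d" "d \<noteq> 0" by (cases v) auto
        have "(pderiv (a * d + c * b) * (b * d) - (a * d + c * b) * pderiv (b * d)) * ((b * b) * (d * d)) =
            ((pderiv a * b - a * pderiv b) * (d * d) + (pderiv c * d - c * pderiv d) * (b * b)) *
            ((b * d) * (b * d))"
          unfolding pderiv_mult pderiv_add by (simp add: algebra_simps)
        thus ?thesis using u v by (simp add: fract_deriv_Fract eq_fract)
      qed
      moreover have "fract_deriv (u * v) = u * fract_deriv v + v * fract_deriv u" for u v :: "'a poly fract"
      proof -
        obtain a b where u: "u = Fract a b" "b \<noteq> 0" by (cases u) auto
        obtain c d where v: "v = Fract c d" "d \<noteq> 0" by (cases v) auto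
        have "(pderiv (a * c) * (b * d) - (a * c) * pderiv (b * d)) * ((b * (d * d)) * (d * (b * b))) =
            ((a * (pderiv c * d - c * pderiv d)) * (d * (b * b)) +
             (c * (pderiv a * b - a * pderiv b)) * (b * (d * d))) * ((b * d) * (b * d))"
          unfolding pderiv_mult by (simp add: algebra_simps)
        thus ?thesis using u v by (simp add: fract_deriv_Fract eq_fract)
      qed
      moreover have "fract_deriv (const_fract c) = 0" for c :: 'a
        by (simp add: const_fract_def fract_deriv_Fract Zero_fract_def pderiv_pCons)
      ultimately show ?thesis by (simp add: derivations_def)
    qed
    show "fract_deriv (coord_fract :: 'a poly fract) = 1"
      by (simp add: coord_fract_def fract_deriv_Fract One_fract_def pderiv_pCons one_pCons)
  qed
qed

lemma infinity_P1_closed_point: "infinity_P1 \<in> closed_points (const_fract :: 'l::field \<Rightarrow> _)"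
proof -
  let ?q = "infinity_P1 :: 'l poly fract set"
  have Fract_iff: "Fract a b \<in> ?q \<longleftrightarrow> degree a \<le> degree b" if b: "b \<noteq> 0" for a b :: "'l poly"
  proof
    assume "Fract a b \<in> ?q"
    then obtain c d where d: "d \<noteq> 0" "degree c \<le> degree d" and e: "a * d = c * b"
      using b by (auto simp: infinity_P1_def eq_fract)
    show "degree a \<le> degree b"
    proof (cases "a = 0")
      case False
      hence "c \<noteq> 0" using e d by auto
      hence "degree a + degree d = degree c + degree b"
        using e d False b by (metis degree_mult_eq)
      thus ?thesis using d by simp
    qed simp
  next
    assume "degree a \<le> degree b"
    thus "Fract a b \<in> ?q" using b unfolding infinity_P1_def by auto
  qed
  have "const_fract c \<in> ?q" for c :: 'l
    by (simp add: const_fract_def Fract_iff)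
  moreover have "u - v \<in> ?q \<and> u * v \<in> ?q" if uv: "u \<in> ?q" "v \<in> ?q" for u v
  proof -
    obtain a b where u: "u = Fract a b" "b \<noteq> 0" "degree a \<le> degree b"
      using uv(1) unfolding infinity_P1_def by blast
    obtain c d where v: "v = Fract c d" "d \<noteq> 0" "degree c \<le> degree d"
      using uv(2) unfolding infinity_P1_def by blast
    have bd: "degree (b * d) = degree b + degree d" using u v by (simp add: degree_mult_eq)
    have "degree (a * d) \<le> degree b + degree d" "degree (c * b) \<le> degree b + degree d"
      "degree (a * c) \<le> degree b + degree d"
      using degree_mult_le[of a d] degree_mult_le[of c b] degree_mult_le[of a c] u v by linarith+
    moreover from this have "degree (a * d - c * b) \<le> degree b + degree d" by (intro degree_diff_le)
    ultimately show ?thesis using u v bd by (simp add: Fract_iff)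
  qed
  moreover have "z \<in> ?q \<or> inverse z \<in> ?q" for z
  proof -
    obtain a b where z: "z = Fract a b" "b \<noteq> 0" by (cases z) auto
    show ?thesis using z by (cases "a = 0") (auto simp: Fract_iff)
  qed
  moreover have "Fract [:0, 1:] 1 \<notin> ?q" by (simp add: Fract_iff)
  hence "?q \<noteq> UNIV" by blast
  ultimately show ?thesis unfolding closed_points_def by blast
qed

lemma inverse_coord_infinity: "inverse coord_fract \<in> max_ideal (infinity_P1 :: 'l::field poly fract set)"
proof -
  have "inverse (coord_fract :: 'l poly fract) = Fract 1 [:0, 1:]"
    by (simp add: coord_fract_def)
  also have "Fract 1 [:0, 1:] \<in> (infinity_P1 :: 'l poly fract set)"
    unfolding infinity_P1_def by (intro CollectI exI conjI refl) auto
  finally have "inverse coord_fract \<in> (infinity_P1 :: 'l poly fract set)" .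
  moreover have "coord_fract \<notin> (infinity_P1 :: 'l poly fract set)"
  proof
    assume "coord_fract \<in> (infinity_P1 :: 'l poly fract set)"
    then obtain a b :: "'l poly" where b: "b \<noteq> 0" "degree a \<le> degree b" and "[:0, 1:] * b = a"
      unfolding infinity_P1_def coord_fract_def by (auto simp: eq_fract)
    hence "degree a = Suc (degree b)" by (auto simp: degree_pCons_eq)
    thus False using b by simp
  qed
  ultimately show ?thesis by (simp add: max_ideal_def)
qed

section \<open>Evaluation of rational functions at a transcendental element\<close>

context
  fixes \<iota> :: "'l::field \<Rightarrow> 'k::field" and x
  assumes \<iota>: "field_hom \<iota>" and transc: "\<And>a. a \<noteq> 0 \<Longrightarrow> poly_eval \<iota> a x \<noteq> 0"
begin

interpretation field_hom \<iota> by (rule \<iota>)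

lemma rat_eval_Fract:
  fixes a b :: "'l poly"
  assumes b: "b \<noteq> 0"
  shows "rat_eval \<iota> x (Fract a b) = poly_eval \<iota> a x / poly_eval \<iota> b x"
  unfolding rat_eval_def
proof (rule the_equality)
  fix z assume "\<exists>c d. Fract a b = Fract c d \<and> poly_eval \<iota> d x \<noteq> 0 \<and> z = poly_eval \<iota> c x / poly_eval \<iota> d x"
  then obtain c d where e: "Fract a b = Fract c d" and d: "poly_eval \<iota> d x \<noteq> 0"
    and z: "z = poly_eval \<iota> c x / poly_eval \<iota> d x" by blast
  have "d \<noteq> 0" using d by auto
  hence "a * d = c * b" using e b by (simp add: eq_fract)
  hence "poly_eval \<iota> a x * poly_eval \<iota> d x = poly_eval \<iota> c x * poly_eval \<iota> b x"
    by (metis poly_eval_mult)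
  thus "z = poly_eval \<iota> a x / poly_eval \<iota> b x" using d transc[OF b] by (simp add: z frac_eq_eq)
qed (use transc[OF b] in blast)

lemma field_hom_rat_eval: "field_hom (rat_eval \<iota> x)"
proof -
  have e: "rat_eval \<iota> x (Fract a 1) = poly_eval \<iota> a x" for a
    by (simp add: rat_eval_Fract)
  show ?thesis
  proof
    show "rat_eval \<iota> x 0 = 0" "rat_eval \<iota> x 1 = 1"
      by (simp_all add: Zero_fract_def One_fract_def e)
    fix u v :: "'l poly fract"
    obtain a b where u: "u = Fract a b" "b \<noteq> 0" by (cases u) auto
    obtain c d where v: "v = Fract c d" "d \<noteq> 0" by (cases v) auto
    have nz: "poly_eval \<iota> b x \<noteq> 0" "poly_eval \<iota> d x \<noteq> 0" using u v transc by auto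
    show "rat_eval \<iota> x (u + v) = rat_eval \<iota> x u + rat_eval \<iota> x v"
      "rat_eval \<iota> x (u * v) = rat_eval \<iota> x u * rat_eval \<iota> x v"
      using u v nz by (simp_all add: rat_eval_Fract poly_eval_add poly_eval_mult add_frac_eq)
  qed
qed

lemma rat_eval_const: "rat_eval \<iota> x (const_fract c) = \<iota> c"
  by (simp add: const_fract_def rat_eval_Fract)

lemma rat_eval_coord: "rat_eval \<iota> x coord_fract = x"
  by (simp add: coord_fract_def rat_eval_Fract)

end

text \<open>The point is that y^p - y is again transcendental, so that evaluation at it is a field
  homomorphism: composing a nonzero polynomial with the nonconstant G gives a nonzero
  polynomial.\<close>

lemma artin_schreier_P1:
  assumes "of_nat p = (0 :: 'l::field)" and p: "3 \<le> p"
  shows "artin_schreier (const_fract :: 'l \<Rightarrow> _) coord_fract fract_deriv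
    (P1_comorphism (coord_fract ^ p - coord_fract)) p"
proof -
  interpret P1: rational_function_field "const_fract :: 'l \<Rightarrow> _" coord_fract fract_deriv
    by (rule rational_function_field_P1)
  let ?g = "coord_fract ^ p - coord_fract :: 'l poly fract"
  define G :: "'l poly" where "G = monom 1 p - monom 1 1"
  have G: "poly_eval const_fract G coord_fract = ?g"
    by (simp add: G_def P1.poly_eval_diff P1.poly_eval_monom)
  have "coeff G p \<noteq> 0" using p by (simp add: G_def)
  hence dG: "degree G > 0" using le_degree[of G p] p by simp
  have tr: "poly_eval const_fract a ?g \<noteq> 0" if "a \<noteq> 0" for a
  proof -
    have "pcompose a G \<noteq> 0" using that dG by (simp add: pcompose_eq_0_iff)
    hence "poly_eval const_fract (pcompose a G) coord_fract \<noteq> 0" by (rule P1.transcendental)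
    thus ?thesis by (simp add: P1.poly_eval_pcompose G)
  qed
  have "of_nat n = const_fract (of_nat n :: 'l)" for n
    by (induction n) (simp_all add: P1.hom_add)
  hence "of_nat p = (0 :: 'l poly fract)" using assms(1) by simp
  thus ?thesis unfolding P1_comorphism_def
    using field_hom_rat_eval[OF P1.field_hom_axioms tr] rat_eval_const[OF P1.field_hom_axioms tr]
      rat_eval_coord[OF P1.field_hom_axioms tr] p
    by (intro artin_schreier.intro artin_schreier_axioms.intro P1.rational_function_field_axioms) auto
qed

section \<open>The local ring of the affine line at a rational point\<close>

text \<open>The coordinate functional of the j-th basis vector, which will serve as \<eta> in a
  Bezoutian form. Its values outside V are arbitrary, hence the restriction of its properties to
  V.\<close>

lemma quot_basis_functional:
  fixes sc :: "'a::field \<Rightarrow> 'v::ab_group_add \<Rightarrow> 'v"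
  assumes sc: "vector_space sc" and V: "module.subspace sc V" and W: "module.subspace sc W"
    and WV: "W \<subseteq> V" and bs: "quot_basis sc V W bs" and j: "j < length bs"
  obtains \<phi> where "\<And>u v. u \<in> V \<Longrightarrow> v \<in> V \<Longrightarrow> \<phi> (u + v) = \<phi> u + \<phi> v"
    "\<And>l v. v \<in> V \<Longrightarrow> \<phi> (sc l v) = l * \<phi> v" "\<And>w. w \<in> W \<Longrightarrow> \<phi> w = 0"
    "\<And>i. i < length bs \<Longrightarrow> \<phi> (bs ! i) = (if i = j then 1 else 0)"
proof -
  interpret vector_space sc by fact
  let ?n = "length bs"
  obtain c where c: "\<And>v. v \<in> V \<Longrightarrow> v - (\<Sum>i<?n. sc (c v i) (bs ! i)) \<in> W"
    using quot_basis_span[OF bs] by metis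
  have eq: "c v j = d j" if "v \<in> V" "v - (\<Sum>i<?n. sc (d i) (bs ! i)) \<in> W" for v d
    by (rule quot_basis_unique[OF bs that(1) c[OF that(1)] that(2) j])
  have "c (u + v) j = c u j + c v j" if "u \<in> V" "v \<in> V" for u v
  proof (rule eq[where d = "\<lambda>i. c u i + c v i"])
    show "u + v \<in> V" using subspace_add[OF V that] .
    show "u + v - (\<Sum>i<?n. sc (c u i + c v i) (bs ! i)) \<in> W"
      using subspace_add[OF W c[OF that(1)] c[OF that(2)]]
      by (simp add: scale_left_distrib sum.distrib algebra_simps)
  qed
  moreover have "c (sc l v) j = l * c v j" if "v \<in> V" for l v
  proof (rule eq[where d = "\<lambda>i. l * c v i"])
    show "sc l v \<in> V" using subspace_scale[OF V that] .
    show "sc l v - (\<Sum>i<?n. sc (l * c v i) (bs ! i)) \<in> W"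
      using subspace_scale[OF W c[OF that], of l] by (simp add: scale_right_diff_distrib scale_sum_right)
  qed
  moreover have "c w j = 0" if "w \<in> W" for w
    using eq[of w "\<lambda>_. 0"] that WV by auto
  moreover have "c (bs ! i) j = (if i = j then 1 else 0)" if i: "i < ?n" for i
  proof -
    have "(\<Sum>k<?n. sc (if k = i then 1 else 0) (bs ! k)) = bs ! i"
      using i by (simp add: if_distrib[of "\<lambda>c. sc c _"] sum.delta cong: if_cong)
    moreover have "bs ! i \<in> V" using bs nth_mem[OF i] by (auto simp: quot_basis_def)
    ultimately show ?thesis using eq[of "bs ! i" "\<lambda>k. if k = i then 1 else 0"] subspace_0[OF W] by auto
  qed
  ultimately show thesis using that[of "\<lambda>v. c v j"] by blast
qed

text \<open>The form that \<open>A1_local_ring\<close> takes at a rational point: it depends on the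
  value c alone and has the local parameter s - c, written \<open>A1_coord c\<close>.\<close>

definition A1_stalk :: "'l::field \<Rightarrow> 'l poly fract set" where
  "A1_stalk c = {Fract a b | a b. poly b c \<noteq> 0}"

abbreviation A1_coord :: "'l::field \<Rightarrow> 'l poly fract" where
  "A1_coord c \<equiv> Fract [:- c, 1:] 1"

abbreviation A1_scale :: "'l::field \<Rightarrow> 'l poly fract \<Rightarrow> 'l poly fract" where
  "A1_scale \<equiv> \<lambda>l r. const_fract l * r"

lemma vector_space_A1: "vector_space A1_scale"
proof -
  interpret field_hom const_fract by (rule field_hom_const_fract)
  show ?thesis by unfold_locales (simp_all add: distrib_left distrib_right hom_add hom_mult mult.assoc)
qed

lemma const_0: "const_fract 0 = (0 :: 'l::field poly fract)"
  by (simp add: const_fract_def Zero_fract_def)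

lemma const_minus_1: "const_fract (- 1) = (- 1 :: 'l::field poly fract)"
proof -
  interpret field_hom const_fract by (rule field_hom_const_fract)
  show ?thesis by (simp add: hom_uminus)
qed

lemma A1_stalk_const: "const_fract l \<in> A1_stalk c"
  unfolding A1_stalk_def const_fract_def by force

lemma A1_stalk_add: "u \<in> A1_stalk c \<Longrightarrow> v \<in> A1_stalk c \<Longrightarrow> u + v \<in> A1_stalk c"
  and A1_stalk_mult: "u \<in> A1_stalk c \<Longrightarrow> v \<in> A1_stalk c \<Longrightarrow> u * v \<in> A1_stalk c"
proof -
  assume "u \<in> A1_stalk c" "v \<in> A1_stalk c"
  then obtain a b a' b' where u: "u = Fract a b" "poly b c \<noteq> 0" and v: "v = Fract a' b'" "poly b' c \<noteq> 0"
    unfolding A1_stalk_def by blast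
  have nz: "b \<noteq> 0" "b' \<noteq> 0" "poly (b * b') c \<noteq> 0" using u v by auto
  have "u + v = Fract (a * b' + a' * b) (b * b')" "u * v = Fract (a * a') (b * b')"
    using u v nz by simp_all
  thus "u + v \<in> A1_stalk c" "u * v \<in> A1_stalk c" unfolding A1_stalk_def using nz by blast+
qed

lemma A1_stalk_coord_power: "A1_coord c ^ n \<in> A1_stalk c"
proof (induction n)
  case 0
  show ?case using A1_stalk_const[of 1] by (simp add: const_fract_def One_fract_def one_pCons)
next
  case (Suc n)
  have "A1_coord c \<in> A1_stalk c" unfolding A1_stalk_def by force
  thus ?case using Suc by (simp add: A1_stalk_mult)
qed

lemma A1_coord_nonzero: "A1_coord c \<noteq> 0"
  by (simp add: Zero_fract_def eq_fract)

text \<open>The residue is the value at c; the numerator left after subtracting it is divisible by s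
  - c.\<close>

lemma A1_stalk_residue:
  assumes "r \<in> A1_stalk c"
  shows "\<exists>l. \<exists>r'\<in>A1_stalk c. r = const_fract l + A1_coord c * r'"
proof -
  obtain a b where r: "r = Fract a b" and b: "poly b c \<noteq> 0" using assms unfolding A1_stalk_def by blast
  define l where "l = poly a c / poly b c"
  have "poly (a - [:l:] * b) c = 0" using b by (simp add: l_def)
  then obtain d where d: "a - [:l:] * b = [:- c, 1:] * d" by (metis dvd_def poly_eq_0_iff_dvd)
  have b0: "b \<noteq> 0" using b by auto
  have "a = [:l:] * b + [:- c, 1:] * d" using d by (simp add: algebra_simps)
  hence "r = const_fract l + A1_coord c * Fract d b"
    using b0 by (simp add: r const_fract_def)
  moreover have "Fract d b \<in> A1_stalk c" using b unfolding A1_stalk_def by blast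
  ultimately show ?thesis by blast
qed

lemma A1_stalk_const_in_ideal:
  assumes "r \<in> A1_stalk c" "const_fract l = A1_coord c * r"
  shows "l = 0"
proof -
  obtain a b where r: "r = Fract a b" and b: "poly b c \<noteq> 0" using assms unfolding A1_stalk_def by blast
  have "b \<noteq> 0" using b by auto
  hence "[:l:] * b = [:- c, 1:] * a" using assms(2) by (simp add: r const_fract_def eq_fract)
  hence "poly ([:l:] * b) c = poly ([:- c, 1:] * a) c" by simp
  thus ?thesis using b by simp
qed

context
  fixes c :: "'l::field" and n :: nat
begin

interpretation A1: vector_space A1_scale by (rule vector_space_A1)

definition coord_ideal :: "'l poly fract set" where
  "coord_ideal = {A1_coord c ^ n * r | r. r \<in> A1_stalk c}"

lemma subspace_A1_stalk: "module.subspace A1_scale (A1_stalk c)"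
proof -
  have "0 = const_fract (0::'l)" by (simp add: const_fract_def Zero_fract_def)
  thus ?thesis unfolding A1.subspace_def using A1_stalk_const A1_stalk_add A1_stalk_mult by metis
qed

lemma subspace_coord_ideal: "module.subspace A1_scale coord_ideal"
  unfolding A1.subspace_def
proof (intro conjI ballI allI)
  let ?\<pi> = "A1_coord c ^ n"
  show "0 \<in> coord_ideal"
    using A1.subspace_0[OF subspace_A1_stalk] unfolding coord_ideal_def by force
  fix x assume "x \<in> coord_ideal"
  then obtain r where r: "r \<in> A1_stalk c" "x = ?\<pi> * r" unfolding coord_ideal_def by blast
  have "A1_scale l x = ?\<pi> * A1_scale l r" for l by (simp add: r)
  thus "A1_scale l x \<in> coord_ideal" for l
    using A1_stalk_mult[OF A1_stalk_const r(1)] unfolding coord_ideal_def by blast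
  fix y assume "y \<in> coord_ideal"
  then obtain r' where r': "r' \<in> A1_stalk c" "y = ?\<pi> * r'" unfolding coord_ideal_def by blast
  have "x + y = ?\<pi> * (r + r')" by (simp add: r r' distrib_left)
  thus "x + y \<in> coord_ideal" using A1_stalk_add[OF r(1) r'(1)] unfolding coord_ideal_def by blast
qed

lemma coord_ideal_subset: "coord_ideal \<subseteq> A1_stalk c"
  unfolding coord_ideal_def using A1_stalk_mult[OF A1_stalk_coord_power] by blast

end

lemma power_in_coord_ideal: "n \<le> k \<Longrightarrow> A1_coord c ^ k \<in> coord_ideal c n"
  unfolding coord_ideal_def using A1_stalk_coord_power[of c "k - n"]
  by (auto intro!: exI[of _ "A1_coord c ^ (k - n)"] simp flip: power_add)

text \<open>Induction on n. For spanning, the residue is the lowest coefficient and the remainder is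
  divided by s - c; for independence, taking residues kills the lowest coefficient of a relation and
  s - c is then cancelled.\<close>

lemma quot_basis_powers:
  "quot_basis A1_scale (A1_stalk c) (coord_ideal c n) (map (\<lambda>i. A1_coord c ^ i) [0..<n])"
proof (rule quot_basisI[OF vector_space_A1 subspace_coord_ideal])
  let ?\<pi> = "A1_coord c"
  have nth: "(\<Sum>i<length (map (\<lambda>i. ?\<pi> ^ i) [0..<n]). A1_scale (d i) (map (\<lambda>i. ?\<pi> ^ i) [0..<n] ! i))
      = (\<Sum>i<n. const_fract (d i) * ?\<pi> ^ i)" for d
    by (intro sum.cong) auto
  have shift: "(\<Sum>i<Suc n. const_fract (d i) * ?\<pi> ^ i) =
      const_fract (d 0) + ?\<pi> * (\<Sum>i<n. const_fract (d (Suc i)) * ?\<pi> ^ i)" for n d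
    unfolding sum.lessThan_Suc_shift by (simp add: sum_distrib_left mult_ac)
  show "set (map (\<lambda>i. ?\<pi> ^ i) [0..<n]) \<subseteq> A1_stalk c" by (auto intro: A1_stalk_coord_power)
  have "\<exists>d. v - (\<Sum>i<n. const_fract (d i) * ?\<pi> ^ i) \<in> coord_ideal c n" if "v \<in> A1_stalk c" for v
    using that
  proof (induction n arbitrary: v)
    case 0
    thus ?case by (auto simp: coord_ideal_def)
  next
    case (Suc n)
    obtain l r where r: "r \<in> A1_stalk c" "v = const_fract l + ?\<pi> * r"
      using A1_stalk_residue[OF Suc.prems] by blast
    obtain d r' where d: "r' \<in> A1_stalk c" "r - (\<Sum>i<n. const_fract (d i) * ?\<pi> ^ i) = ?\<pi> ^ n * r'"
      using Suc.IH[OF r(1)] unfolding coord_ideal_def by blast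
    \<comment> \<open>\<open>case_nat l d\<close> puts the residue l in front of the coefficients
      already found for r.\<close>
    have "v - (\<Sum>i<Suc n. const_fract (case_nat l d i) * ?\<pi> ^ i) =
        ?\<pi> * (r - (\<Sum>i<n. const_fract (d i) * ?\<pi> ^ i))"
      unfolding shift r by (simp add: algebra_simps)
    also have "\<dots> = ?\<pi> ^ Suc n * r'" unfolding d by simp
    finally show ?case using d(1) unfolding coord_ideal_def by blast
  qed
  thus "\<exists>d. v - (\<Sum>i<length (map (\<lambda>i. ?\<pi> ^ i) [0..<n]). A1_scale (d i) (map (\<lambda>i. ?\<pi> ^ i) [0..<n] ! i))
      \<in> coord_ideal c n" if "v \<in> A1_stalk c" for v
    unfolding nth using that .
  have indep: "d i = 0" if "(\<Sum>i<n. const_fract (d i) * ?\<pi> ^ i) \<in> coord_ideal c n" "i < n" for d i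
    using that
  proof (induction n arbitrary: d i)
    case (Suc n)
    let ?s = "\<Sum>i<n. const_fract (d (Suc i)) * ?\<pi> ^ i"
    obtain r where r: "r \<in> A1_stalk c" "const_fract (d 0) + ?\<pi> * ?s = ?\<pi> * (?\<pi> ^ n * r)"
      using Suc.prems(1) unfolding shift coord_ideal_def by (auto simp: mult.assoc)
    have s: "?s \<in> A1_stalk c"
    proof -
      interpret A1: vector_space A1_scale by (rule vector_space_A1)
      show ?thesis
        by (intro A1.subspace_sum[OF subspace_A1_stalk] A1_stalk_mult A1_stalk_const A1_stalk_coord_power)
    qed
    \<comment> \<open>The difference is written as a sum with the scalar - 1, so that closure of the
      stalk under sums and products applies.\<close>
    have "const_fract (d 0) = ?\<pi> * (?\<pi> ^ n * r + const_fract (- 1) * ?s)"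
      using r(2) by (simp add: algebra_simps const_minus_1)
    hence d0: "d 0 = 0"
      by (rule A1_stalk_const_in_ideal[rotated])
        (intro A1_stalk_add A1_stalk_mult A1_stalk_const A1_stalk_coord_power r(1) s)
    hence "?\<pi> * ?s = ?\<pi> * (?\<pi> ^ n * r)"
      using r(2) unfolding d0 const_0 by (simp only: add_0_left)
    hence "?s = ?\<pi> ^ n * r" using A1_coord_nonzero[of c] mult_left_cancel by blast
    hence "?s \<in> coord_ideal c n" using r(1) unfolding coord_ideal_def by blast
    hence "d (Suc i) = 0" if "i < n" for i using Suc.IH[of "\<lambda>i. d (Suc i)"] that by blast
    thus ?case using d0 Suc.prems(2) by (cases i) auto
  qed simp
  show "d i = 0" if "(\<Sum>i<length (map (\<lambda>i. ?\<pi> ^ i) [0..<n]). A1_scale (d i) (map (\<lambda>i. ?\<pi> ^ i) [0..<n] ! i))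
      \<in> coord_ideal c n" "i < length (map (\<lambda>i. ?\<pi> ^ i) [0..<n])" for d i
    using indep[of d i] that unfolding nth by simp
qed

text \<open>The upper half of the powers of the local coordinate spans a totally isotropic subspace of half
  the dimension.\<close>

lemma gw_class_even:
  fixes c :: "'l::field"
  assumes two: "(2::'l) \<noteq> 0"
    and add: "\<And>u v. u \<in> A1_stalk c \<Longrightarrow> v \<in> A1_stalk c \<Longrightarrow> \<eta> (u + v) = \<eta> u + \<eta> v"
    and scl: "\<And>l v. v \<in> A1_stalk c \<Longrightarrow> \<eta> (const_fract l * v) = l * \<eta> v"
    and rad: "\<And>w. w \<in> coord_ideal c (2 * m) \<Longrightarrow> \<eta> w = 0"
    and \<gamma>: "has_gw_class A1_scale (A1_stalk c) (coord_ideal c (2 * m)) (\<lambda>b c. \<eta> (b * c)) \<gamma>"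
  shows "\<gamma> = zmult (int m) gw_hyp"
proof -
  let ?V = "A1_stalk c" and ?W = "coord_ideal c (2 * m)" and ?\<beta> = "\<lambda>b c. \<eta> (b * c)"
  let ?cs = "map (\<lambda>i. A1_coord c ^ i) [0..<2 * m]"
  obtain bs where bs: "quot_basis A1_scale ?V ?W bs" and form: "is_form (gram ?\<beta> bs)"
    and \<gamma>: "\<gamma> = gw_class (gram ?\<beta> bs)"
    using \<gamma> unfolding has_gw_class_def Let_def by blast
  have iso: "isometric (gram ?\<beta> bs) (gram ?\<beta> ?cs)"
  proof (rule gram_isometric[OF vector_space_A1 subspace_coord_ideal subspace_A1_stalk
        coord_ideal_subset bs quot_basis_powers _ _ _ _ form])
    show "\<eta> (u * w) = \<eta> (w * u)" for u w by (simp add: mult.commute)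
    show "\<eta> ((u + v) * w) = \<eta> (u * w) + \<eta> (v * w)" if "u \<in> ?V" "v \<in> ?V" "w \<in> ?V" for u v w
      unfolding distrib_right using that by (intro add A1_stalk_mult)
    show "\<eta> (const_fract l * u * w) = l * \<eta> (u * w)" if "u \<in> ?V" "w \<in> ?V" for l u w
      unfolding mult.assoc using that by (intro scl A1_stalk_mult)
    show "\<eta> (u * w) = 0" if uw: "u \<in> ?W" "w \<in> ?V" for u w
    proof (rule rad)
      obtain r where "u = A1_coord c ^ (2 * m) * r" "r \<in> ?V" using uw(1) unfolding coord_ideal_def by blast
      thus "u * w \<in> ?W" unfolding coord_ideal_def using A1_stalk_mult[OF _ uw(2)]
        by (auto simp: mult.assoc)
    qed
  qed
  have "gw_class (gram ?\<beta> ?cs) = zmult (int m) gw_hyp"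
  proof (rule gw_class_metabolic[OF _ isometricD(2)[OF iso] two])
    show "gram ?\<beta> ?cs \<in> carrier_mat (m + m) (m + m)" by (rule carrier_matI) auto
    fix i j assume ij: "m \<le> i" "i < m + m" "m \<le> j" "j < m + m"
    have "\<eta> (A1_coord c ^ i * A1_coord c ^ j) = 0"
      unfolding power_add[symmetric] using ij by (intro rad power_in_coord_ideal) simp
    thus "gram ?\<beta> ?cs $$ (i, j) = 0" using ij by simp
  qed
  thus ?thesis unfolding \<gamma> gw_class_eq[OF iso] .
qed

section \<open>The local index\<close>

lemma (in field_hom) A1_local_ring_eq:
  assumes q: "valuation_ring hom q" and xq: "x \<in> q" and x: "x - hom c \<in> max_ideal q"
  shows "A1_local_ring hom x q = A1_stalk c"
  using poly_eval_unit_iff[OF assms] units_iff[OF q] poly_eval_closed[OF q field_hom_axioms xq]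
  unfolding A1_local_ring_def A1_stalk_def by simp

context rational_function_field
begin

lemma order_ideal_power:
  assumes q: "valuation_ring \<iota> q" and \<tau>: "\<tau> \<in> max_ideal q" and u: "u \<in> units q"
  shows "\<tau> ^ m * u \<in> ideal_power q n \<longleftrightarrow> n \<le> m"
proof
  assume "n \<le> m"
  hence "\<tau> ^ m * u = \<tau> ^ n * (\<tau> ^ (m - n) * u)" by (simp add: mult.assoc[symmetric] flip: power_add)
  moreover have "\<tau> ^ (m - n) * u \<in> q"
    using \<tau> u by (intro valuation_ring_mult[OF q] valuation_ring_power[OF q]) (auto simp: units_def max_ideal_def)
  ultimately show "\<tau> ^ m * u \<in> ideal_power q n" unfolding ideal_power_principal[OF q \<tau>] by blast
next
  assume "\<tau> ^ m * u \<in> ideal_power q n"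
  then obtain w where w: "w \<in> q" "\<tau> ^ m * u = \<tau> ^ n * w" unfolding ideal_power_principal[OF q \<tau>] by blast
  show "n \<le> m"
  proof (rule ccontr)
    assume "\<not> n \<le> m"
    hence "m < n" by simp
    then obtain k where k: "n = m + Suc k" using less_iff_Suc_add by auto
    have "\<tau> ^ m * u = \<tau> ^ m * (\<tau> * (\<tau> ^ k * w))" using w(2) by (simp add: k power_add mult_ac)
    hence "u = \<tau> * (\<tau> ^ k * w)" using coordinate_nonzero by simp
    moreover have "\<tau> * (\<tau> ^ k * w) \<in> max_ideal q"
      using \<tau> w by (intro max_ideal_mult_right[OF q] valuation_ring_mult[OF q] valuation_ring_power[OF q])
        (auto simp: max_ideal_def)
    ultimately show False using u units_iff[OF q] by blast
  qed
qed

lemma order_unique: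
  assumes q: "valuation_ring \<iota> q" and \<tau>: "\<tau> \<in> max_ideal q"
    and u: "u \<in> units q" and w: "w \<in> units q" and eq: "\<tau> ^ m * u = \<tau> ^ n * w"
  shows "m = n"
  using order_ideal_power[OF q \<tau> u, of m n] order_ideal_power[OF q \<tau> u, of m m]
    order_ideal_power[OF q \<tau> w, of n m] order_ideal_power[OF q \<tau> w, of n n]
  unfolding eq by simp

text \<open>Since \<open>dx\<close> generates the cotangent space, \<open>x - x(q)\<close> is again a local parameter at \<open>q\<close>.\<close>

lemma etale_local_parameter:
  assumes q: "valuation_ring \<iota> q" and \<tau>: "\<tau> \<in> max_ideal q" and x: "x \<in> q"
    and dx: "generates (cotangent \<iota>) q (differential \<iota> x)"
  obtains c w where "w \<in> units q" "x = \<iota> c + \<tau> * w"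
proof -
  have \<tau>q: "\<tau> \<in> q" using \<tau> by (simp add: max_ideal_def)
  obtain c w where w: "w \<in> q" "x = \<iota> c + \<tau> * w" using residue_decomposition[OF q \<tau> x] by blast
  have "D x \<in> units q"
    using dx generates_smul_iff[OF frame_cotangent q generates_cotangent[OF q \<tau>q]]
    by (simp add: differential_eq[of x])
  \<comment> \<open>By the product rule D x and w agree modulo the maximal ideal, so w inherits
    being a unit.\<close>
  moreover have "D x = w + \<tau> * D w"
  proof -
    have "D (\<iota> c + \<tau> * w) = D (\<iota> c) + (\<tau> * D w + w * D \<tau>)" using derivation by (simp add: derivations_def)
    moreover have "D (\<iota> c) = 0" using derivation by (simp add: derivations_def)
    ultimately show ?thesis by (simp add: w derivation_coordinate)
  qed
  moreover have "\<tau> * D w \<in> max_ideal q"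
    by (rule max_ideal_mult_right[OF q \<tau> derivation_closed[OF q \<tau>q w(1)]])
  ultimately have "w \<in> units q"
    using w(1) max_ideal_add[OF q, of w "\<tau> * D w"] units_iff[OF q] by auto
  thus thesis using that w by blast
qed

text \<open>The choices in the definition are arbitrary here. The function \<sigma>0 has order 2m
  because v and e differ by a unit, g does not change this order, and x - c is a local parameter; so
  F generates the ideal of (s - c)^(2m). What remains is a statement about functionals on the local
  ring modulo this ideal, which is \<open>gw_class_even\<close>.\<close>

lemma local_index_even:
  fixes E :: "('k, 'v::ab_group_add) vsheaf" and N :: "('k, 'n::ab_group_add) vsheaf"
  assumes q: "valuation_ring \<iota> q" and \<tau>: "\<tau> \<in> max_ideal q" and two: "(2::'l) \<noteq> 0"
    and E: "frame E e" and e: "generates E q e" and u: "u \<in> units q"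
    and \<sigma>: "\<sigma> = smul E (\<tau> ^ (2 * m) * u) e"
    and ind: "is_local_index \<iota> E N \<mu> \<sigma> q \<gamma>"
  shows "\<gamma> = zmult (int m) gw_hyp"
proof -
  obtain n U x v \<sigma>0 N0 g F where n: "1 \<le> n" "\<sigma> \<in> stalk_power E q n" "\<sigma> \<notin> stalk_power E q (Suc n)"
    and nis: "nisnevich_coordinates \<iota> q U x" and triv: "compatible_trivialization \<iota> E N \<mu> U x v"
    and \<sigma>0: "\<sigma>0 \<in> q" "\<sigma> = smul E \<sigma>0 v" and N0: "2 * n \<le> N0" and g: "g \<in> ideal_power q N0"
    and F: "F \<in> A1_local_ring \<iota> x q" "\<sigma>0 + g = rat_eval \<iota> x F"
    and bez: "bezout_gw_class (A1_local_ring \<iota> x q) F \<gamma>"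
    using ind unfolding is_local_index_def by blast
  have qU: "q \<in> U" and tr: "\<And>a. a \<noteq> 0 \<Longrightarrow> poly_eval \<iota> a x \<noteq> 0"
    and x: "x \<in> q" and dx: "generates (cotangent \<iota>) q (differential \<iota> x)"
    using nis by (auto simp: nisnevich_coordinates_def sections_def structure_sheaf_def)
  have v: "generates E q v" using triv qU by (simp add: compatible_trivialization_def)
  obtain w where w: "v = smul E w e" using frame_cases[OF E, of v] v by (auto simp: generates_def)
  hence wu: "w \<in> units q" using v generates_smul_iff[OF E q e] by simp
  \<comment> \<open>The order n in the definition is forced, which turns the bound on N0 into one in
    terms of m.\<close>
  have n_eq: "n = 2 * m"
    using n(2,3) unfolding \<sigma> stalk_power_iff[OF q E e] order_ideal_power[OF q \<tau> u] by simp
  have "smul E (\<tau> ^ (2 * m) * u) e = smul E (\<sigma>0 * w) e"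
    using \<sigma> \<sigma>0(2) by (simp add: w frame_mult_smul[OF E frame_gen[OF E]])
  hence "\<tau> ^ (2 * m) * u = \<sigma>0 * w" by (simp add: frame_cancel[OF E])
  hence \<sigma>0_eq: "\<sigma>0 = \<tau> ^ (2 * m) * (u * inverse w)"
    using wu by (simp add: units_def field_simps)
  obtain g' where g': "g' \<in> q" "g = \<tau> ^ N0 * g'" using g unfolding ideal_power_principal[OF q \<tau>] by blast
  \<comment> \<open>Since n \<ge> 1, the bound 2n \<le> N0 gives N0 \<ge> 2m + 1. So g retains a
    factor \<tau> after division by \<tau>^(2m) and is absorbed into the unit u'.\<close>
  have N0_eq: "N0 = 2 * m + Suc (N0 - Suc (2 * m))" using N0 n_eq n(1) by simp
  define u' where "u' = u * inverse w + \<tau> * (\<tau> ^ (N0 - Suc (2 * m)) * g')"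
  have "\<tau> \<in> q" using \<tau> by (simp add: max_ideal_def)
  hence u': "u' \<in> units q" unfolding u'_def
    by (intro units_add_max_ideal[OF q] units_mult[OF q u] units_inverse[OF q wu]
        max_ideal_mult_right[OF q \<tau>] valuation_ring_mult[OF q] valuation_ring_power[OF q] g'(1))
  have "g = \<tau> ^ (2 * m) * (\<tau> * (\<tau> ^ (N0 - Suc (2 * m)) * g'))"
    unfolding g'(2) by (subst N0_eq) (simp add: power_add mult_ac)
  hence sum: "\<sigma>0 + g = \<tau> ^ (2 * m) * u'" by (simp add: \<sigma>0_eq u'_def distrib_left)
  obtain c t where t: "t \<in> units q" "x = \<iota> c + \<tau> * t" by (rule etale_local_parameter[OF q \<tau> x dx])
  hence xc: "x - \<iota> c \<in> max_ideal q" using max_ideal_mult_right[OF q \<tau>, of t] by (simp add: units_def)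
  have R: "A1_local_ring \<iota> x q = A1_stalk c" by (rule A1_local_ring_eq[OF q x xc])
  note unit = poly_eval_unit_iff[OF q x xc, THEN iffD2]
  obtain a b where Fab: "F = Fract a b" and b: "poly b c \<noteq> 0" using F(1) unfolding R A1_stalk_def by blast
  have b0: "b \<noteq> 0" using b by auto
  have "rat_eval \<iota> x F = poly_eval \<iota> a x / poly_eval \<iota> b x"
    unfolding Fab by (rule rat_eval_Fract[OF field_hom_axioms _ b0]) (rule tr)
  hence "poly_eval \<iota> a x = \<tau> ^ (2 * m) * u' * poly_eval \<iota> b x"
    using F(2) tr[OF b0] unfolding sum by simp
  hence ax: "poly_eval \<iota> a x = \<tau> ^ (2 * m) * (u' * poly_eval \<iota> b x)" by (simp add: mult.assoc)
  have u'b: "u' * poly_eval \<iota> b x \<in> units q" by (rule units_mult[OF q u' unit[OF b]])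
  have "a \<noteq> 0" using ax u'b coordinate_nonzero by (auto simp: units_def)
  \<comment> \<open>The order of the numerator at c is found by evaluation at x, where s - c becomes
    \<tau> t with t a unit and the cofactor a1 becomes a unit.\<close>
  then obtain a1 where a1: "a = [:- c, 1:] ^ order c a * a1" "\<not> [:- c, 1:] dvd a1"
    using order_decomp by blast
  hence pa1: "poly a1 c \<noteq> 0" by (simp add: poly_eq_0_iff_dvd)
  have "poly_eval \<iota> [:- c, 1:] x = \<tau> * t" by (simp add: t hom_uminus)
  hence "poly_eval \<iota> a x = \<tau> ^ order c a * (t ^ order c a * poly_eval \<iota> a1 x)"
    by (subst a1(1)) (simp only: poly_eval_mult poly_eval_power power_mult_distrib mult.assoc)
  hence "\<tau> ^ order c a * (t ^ order c a * poly_eval \<iota> a1 x) = \<tau> ^ (2 * m) * (u' * poly_eval \<iota> b x)"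
    using ax by simp
  moreover have "t ^ order c a * poly_eval \<iota> a1 x \<in> units q"
    by (rule units_mult[OF q units_power[OF q t(1)] unit[OF pa1]])
  ultimately have ord: "order c a = 2 * m" by (intro order_unique[OF q \<tau> _ u'b])
  have pw: "A1_coord c ^ k = Fract ([:- c, 1:] ^ k) 1" for k
    by (induction k) (simp_all add: One_fract_def)
  have F_eq: "F = A1_coord c ^ (2 * m) * Fract a1 b"
    unfolding Fab pw using a1(1) b0 by (simp add: ord)
  \<comment> \<open>F differs from the power of s - c by \<open>Fract a1 b\<close>, a unit of the
    local ring with inverse \<open>Fract b a1\<close>.\<close>
  have I: "{F * r | r. r \<in> A1_stalk c} = coord_ideal c (2 * m)"
  proof (intro equalityI subsetI)
    fix z assume "z \<in> {F * r | r. r \<in> A1_stalk c}"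
    then obtain r where r: "r \<in> A1_stalk c" "z = F * r" by blast
    have "Fract a1 b \<in> A1_stalk c" unfolding A1_stalk_def using b by blast
    hence "Fract a1 b * r \<in> A1_stalk c" using r(1) by (rule A1_stalk_mult)
    thus "z \<in> coord_ideal c (2 * m)" unfolding coord_ideal_def r(2) F_eq by (auto simp: mult.assoc)
  next
    fix z assume "z \<in> coord_ideal c (2 * m)"
    then obtain r where r: "r \<in> A1_stalk c" "z = A1_coord c ^ (2 * m) * r" unfolding coord_ideal_def by blast
    have "a1 \<noteq> 0" using pa1 by auto
    hence "Fract a1 b * Fract b a1 = 1" using b0 by (simp add: One_fract_def eq_fract mult.commute)
    hence "z = F * (Fract b a1 * r)" unfolding F_eq r(2) by (metis mult.assoc mult_1)
    moreover have "Fract b a1 \<in> A1_stalk c" unfolding A1_stalk_def using pa1 by blast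
    ultimately show "z \<in> {F * r | r. r \<in> A1_stalk c}" using A1_stalk_mult r(1) by blast
  qed
  obtain \<eta> where \<eta>: "\<forall>b\<in>A1_stalk c. \<forall>d\<in>A1_stalk c. \<eta> (b + d) = \<eta> b + \<eta> d"
    "\<forall>l. \<forall>b\<in>A1_stalk c. \<eta> (const_fract l * b) = l * \<eta> b"
    "\<forall>b\<in>coord_ideal c (2 * m). \<eta> b = 0"
    "has_gw_class A1_scale (A1_stalk c) (coord_ideal c (2 * m)) (\<lambda>b d. \<eta> (b * d)) \<gamma>"
    using bez unfolding bezout_gw_class_def Let_def R I by blast
  show ?thesis by (rule gw_class_even[OF two _ _ _ \<eta>(4)]) (use \<eta>(1-3) in auto)
qed

end

text \<open>The Bezoutian of \<open>s\<^sup>n\<close> is \<open>\<Sum>\<^sub>i s\<^sup>i \<otimes> s\<^sup>n\<^sup>-\<^sup>1\<^sup>-\<^sup>i\<close>, so \<open>\<eta>\<close> is the coefficient of \<open>s\<^sup>n\<^sup>-\<^sup>1\<close>.\<close>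

lemma bezout_gw_class_power:
  assumes n: "0 < n"
  shows "\<exists>\<gamma>. bezout_gw_class (A1_stalk 0) ((coord_fract :: 'l::field poly fract) ^ n) \<gamma>"
proof -
  let ?R = "A1_stalk (0::'l)" and ?s = "coord_fract :: 'l poly fract"
  have s: "A1_coord (0::'l) = ?s" by (simp add: coord_fract_def)
  let ?bs = "map (\<lambda>i. ?s ^ i) [0..<n]"
  have I: "coord_ideal (0::'l) n = {?s ^ n * r | r. r \<in> ?R}" unfolding coord_ideal_def s ..
  have bs: "quot_basis A1_scale ?R {?s ^ n * r | r. r \<in> ?R} ?bs"
    using quot_basis_powers[of "0::'l" n] unfolding I s .
  have "n - 1 < length ?bs" using n by simp
  then obtain \<eta> where \<eta>: "\<And>u v. u \<in> ?R \<Longrightarrow> v \<in> ?R \<Longrightarrow> \<eta> (u + v) = \<eta> u + \<eta> v"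
    "\<And>l v. v \<in> ?R \<Longrightarrow> \<eta> (const_fract l * v) = l * \<eta> v"
    "\<And>w. w \<in> {?s ^ n * r | r. r \<in> ?R} \<Longrightarrow> \<eta> w = 0"
    and \<eta>b: "\<And>i. i < length ?bs \<Longrightarrow> \<eta> (?bs ! i) = (if i = n - 1 then 1 else 0)"
    using quot_basis_functional[OF vector_space_A1 subspace_A1_stalk
        subspace_coord_ideal[of "0::'l" n, unfolded I] coord_ideal_subset[of "0::'l" n, unfolded I] bs]
    by blast
  have \<eta>_power: "\<eta> (?s ^ k) = (if k = n - 1 then 1 else 0)" for k
  proof (cases "k < n")
    case True
    thus ?thesis using \<eta>b[of k] by simp
  next
    case False
    hence "\<eta> (?s ^ k) = 0" using power_in_coord_ideal[of n k "0::'l"] unfolding I s by (intro \<eta>(3)) simp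
    thus ?thesis using False n by auto
  qed
  have sR: "?s ^ i \<in> ?R" for i using A1_stalk_coord_power[of "0::'l" i] unfolding s .
  define ts where "ts = map (\<lambda>i. (?s ^ i, ?s ^ (n - Suc i))) [0..<n]"
  define G where "G = gram (\<lambda>b c. \<eta> (b * c)) ?bs"
  \<comment> \<open>The functional picks out the exponent n - 1, so the Gram matrix is antidiagonal.
    It is therefore its own inverse, which gives nondegeneracy.\<close>
  have G: "G = mat n n (\<lambda>(i, j). if i + j = n - 1 then 1 else 0)"
    by (rule eq_matI) (auto simp: G_def \<eta>_power simp flip: power_add)
  have "is_form G"
  proof -
    have "G * G = 1\<^sub>m n"
    proof (rule eq_matI)
      fix i j assume "i < dim_row (1\<^sub>m n :: 'l mat)" "j < dim_col (1\<^sub>m n :: 'l mat)"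
      hence ij: "i < n" "j < n" by auto
      have "(G * G) $$ (i, j) =
          (\<Sum>k<n. (if i + k = n - 1 then 1 else 0) * (if k + j = n - 1 then 1 else 0))"
        using ij by (simp add: G scalar_prod_def atLeast0LessThan)
      also have "\<dots> = (\<Sum>k<n. if k = n - 1 - i then (if k + j = n - 1 then 1 else 0) else 0)"
        using ij by (intro sum.cong) auto
      also have "\<dots> = (if i = j then 1 else 0)" using ij by (auto simp: sum.delta)
      finally show "(G * G) $$ (i, j) = 1\<^sub>m n $$ (i, j)" using ij by simp
    qed (auto simp: G)
    hence "det G * det G = 1" using det_mult[of G n G] by (simp add: G)
    hence "det G \<noteq> 0" by auto
    moreover have "transpose_mat G = G" by (rule eq_matI) (auto simp: G add.commute)
    ultimately show ?thesis by (simp add: is_form_def G)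
  qed
  hence "has_gw_class A1_scale ?R {?s ^ n * r | r. r \<in> ?R} (\<lambda>b c. \<eta> (b * c)) (gw_class G)"
    unfolding has_gw_class_def Let_def using bs unfolding G_def by blast
  moreover have "set ts \<subseteq> ?R \<times> ?R" using sR by (auto simp: ts_def)
  moreover have "tensor_eq A1_scale A1_scale ?R ?R (free_gen (?s ^ n) 1 - free_gen 1 (?s ^ n))
      (\<Sum>(b, c)\<leftarrow>ts. free_gen (b * ?s) c - free_gen b (c * ?s))"
  proof -
    interpret vector_space "\<lambda>(l::'l) (f :: 'l poly fract \<times> 'l poly fract \<Rightarrow> 'l) p. l * f p"
      by unfold_locales (auto simp: algebra_simps)
    \<comment> \<open>The sum telescopes already in the free vector space, since s^(n-1-i) times s
      is s^(n-i).\<close>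
    have "(\<Sum>(b, c)\<leftarrow>ts. free_gen (b * ?s) c - free_gen b (c * ?s) :: _ \<Rightarrow> 'l)
        = (\<Sum>i<n. free_gen (?s ^ Suc i) (?s ^ (n - Suc i)) - free_gen (?s ^ i) (?s ^ (n - i)))"
      unfolding ts_def map_map comp_def prod.case interv_sum_list_conv_sum_set_nat atLeast0LessThan[symmetric]
      by (intro sum.cong) (auto simp: mult.commute Suc_diff_Suc simp flip: power_Suc)
    also have "\<dots> = free_gen (?s ^ n) 1 - free_gen 1 (?s ^ n)"
      using sum_lessThan_telescope[of "\<lambda>i. free_gen (?s ^ i) (?s ^ (n - i))" n] by simp
    finally have "free_gen (?s ^ n) 1 - free_gen 1 (?s ^ n) -
        (\<Sum>(b, c)\<leftarrow>ts. free_gen (b * ?s) c - free_gen b (c * ?s)) = (0 :: _ \<Rightarrow> 'l)" by simp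
    thus ?thesis unfolding tensor_eq_def using span_zero by metis
  qed
  moreover have "(\<Sum>(b, c)\<leftarrow>ts. const_fract (\<eta> b) * c) - 1 \<in> {?s ^ n * r | r. r \<in> ?R}"
  proof -
    \<comment> \<open>Of the summands \<eta>(s^i) s^(n-1-i) only i = n - 1 contributes, and it
      equals 1; the normalization holds exactly, so 0 witnesses membership in the ideal.\<close>
    have "(\<Sum>(b, c)\<leftarrow>ts. const_fract (\<eta> b) * c) =
        (\<Sum>i<n. if i = n - 1 then const_fract 1 * ?s ^ (n - Suc i) else 0)"
      unfolding ts_def map_map comp_def prod.case interv_sum_list_conv_sum_set_nat atLeast0LessThan[symmetric]
      by (intro sum.cong) (auto simp: \<eta>_power const_0)
    also have "\<dots> = 1" using n by (simp add: sum.delta const_fract_def One_fract_def one_pCons)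
    finally have "(\<Sum>(b, c)\<leftarrow>ts. const_fract (\<eta> b) * c) - 1 = ?s ^ n * 0" by simp
    moreover have "0 \<in> ?R" using A1_stalk_const[of 0 "0::'l"] by (simp add: const_0)
    ultimately show ?thesis by blast
  qed
  ultimately have "bezout_gw_class ?R (?s ^ n) (gw_class G)"
    unfolding bezout_gw_class_def Let_def using \<eta> by blast
  thus ?thesis by blast
qed

section \<open>The enriched Riemann--Hurwitz formula\<close>

text \<open>Multiplication identifies the square of O(k) with O(2k), and Hom(TY, E) is O(2k) when E
  is O(2k + 2). Generators correspond because the factors (1/\<tau>)^k at infinity multiply to
  (1/\<tau>)^(2k).\<close>

lemma (in rational_function_field) relative_orientation_twisted:
  assumes E: "twisted E e (2 * k + 2)"
  defines "H \<equiv> hom_bundle (tangent \<iota>) E" and "h \<equiv> hom_map id (tangent \<iota>) D E e"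
  shows "relative_orientation \<iota> E (standard_bundle k) (\<lambda>m n. smul H (m * n) h)"
proof -
  let ?N = "standard_bundle k" and ?\<mu> = "\<lambda>m n. smul H (m * n) h"
  have H: "twisted H h (2 * k)" unfolding H_def h_def by (rule twisted_hom_tangent[OF E])
  have F: "frame H h" using H by (simp add: twisted_def)
  note g = frame_gen[OF F]
  have "generates H q (?\<mu> n n)" if q: "q \<in> closed_points \<iota>" and n: "generates ?N q n" for q n
  proof -
    have v: "valuation_ring \<iota> q" using q by (simp add: closed_points_iff)
    have n': "generates ?N q (smul ?N n 1)" using n by (simp add: standard_bundle_def)
    from q show ?thesis
    proof (cases rule: closed_point_cases)
      case 1
      thus ?thesis using n' twisted_generates_iff(1)[OF twisted_standard_bundle q 1]
          twisted_generates_iff(1)[OF H q 1] units_mult[OF v] by blast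
    next
      case 2
      have "n * inverse \<tau> ^ k \<in> units q"
        using n' twisted_generates_iff(2)[OF twisted_standard_bundle q 2] by blast
      hence "(n * inverse \<tau> ^ k) * (n * inverse \<tau> ^ k) \<in> units q"
        using units_mult[OF v] by blast
      also have "(n * inverse \<tau> ^ k) * (n * inverse \<tau> ^ k) = n * n * inverse \<tau> ^ (2 * k)"
        unfolding mult_2 power_add by (simp only: mult_ac)
      finally show ?thesis using twisted_generates_iff(2)[OF H q 2] by blast
    qed
  qed
  moreover have "smul ?N = (*)" "gen ?N = UNIV" by (simp_all add: standard_bundle_def)
  ultimately show ?thesis
    unfolding relative_orientation_def Let_def H_def[symmetric]
    using twisted_line_bundle[OF E] twisted_line_bundle[OF twisted_standard_bundle]
    by (simp add: frame_smul_closed[OF F g] distrib_left distrib_right frame_add_smul[OF F g]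
        mult.assoc mult.left_commute frame_mult_smul[OF F g, symmetric])
qed

context artin_schreier
begin

interpretation inv: rational_function_field \<iota> "inverse \<tau>" "\<lambda>z. - (\<tau> ^ 2) * D z"
  by (rule inverse_coordinate)

abbreviation "orientation m n \<equiv>
  smul (hom_bundle (tangent \<iota>) V) (m * n) (hom_map id (tangent \<iota>) D V differential_hom)"

text \<open>The first equation yields the twist p - 2 of the square root N, the second the half p -
  1 of the order of the zero.\<close>

lemma p_arith: "2 * p - 2 = 2 * (p - 2) + 2" "2 * p - 2 = 2 * (p - 1)"
  using p_ge_3 by auto

lemma relative_orientation_V: "relative_orientation \<iota> V (standard_bundle (p - 2)) orientation"
  using relative_orientation_twisted twisted_V unfolding p_arith(1) by blast

lemma power_inverse_cancel: "inverse \<tau> ^ n * \<tau> ^ n = 1"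
  using coordinate_nonzero by (simp flip: power_mult_distrib)

text \<open>The choices are x = 1/\<tau> on its chart, the section l = \<tau>^(p-2) of N, g = 0 and
  F = s^(2p-2). The derivation dual to dx is - \<tau>^2 D, so l tensor l sends it to - \<tau>^(2p-2)
  times the frame of V. This sign cancels the one in the coefficient - 1 of the section, which
  leaves \<sigma>0 = x^(2p-2).\<close>

lemma is_local_index_infinity:
  assumes q: "q \<in> closed_points \<iota>" and z: "inverse \<tau> \<in> max_ideal q"
    and \<gamma>: "bezout_gw_class (A1_stalk 0) (coord_fract ^ (2 * p - 2)) \<gamma>"
  shows "is_local_index \<iota> V (standard_bundle (p - 2)) orientation (smul V (- 1) differential_hom) q \<gamma>"
proof -
  let ?n = "2 * p - 2" and ?U = "{q \<in> closed_points \<iota>. inverse \<tau> \<in> q}" and ?x = "inverse \<tau>"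
  let ?v = "smul V (- (\<tau> ^ ?n)) differential_hom" and ?\<sigma> = "smul V (- 1) differential_hom"
  note Vg = frame_gen[OF frame_V]
  have v: "valuation_ring \<iota> q" using q by (simp add: closed_points_iff)
  have xq: "?x \<in> q" using z by (simp add: max_ideal_def)
  have R: "A1_local_ring \<iota> ?x q = A1_stalk 0"
    using A1_local_ring_eq[OF v xq, of 0] z by simp
  have "?\<sigma> \<in> stalk_power V q k \<longleftrightarrow> k \<le> ?n" for k
    using twisted_stalk_power_iff(2)[OF twisted_V q z]
      inv.order_ideal_power[OF v z units_minus[OF v units_1[OF v]], of ?n k] by simp
  hence order: "1 \<le> ?n" "?\<sigma> \<in> stalk_power V q ?n" "?\<sigma> \<notin> stalk_power V q (Suc ?n)"
    using p_ge_3 by auto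
  have re: "field_hom (rat_eval \<iota> ?x)" "rat_eval \<iota> ?x (const_fract c) = \<iota> c"
    "rat_eval \<iota> ?x coord_fract = ?x" for c
    using field_hom_rat_eval[OF field_hom_axioms inv.transcendental]
      rat_eval_const[OF field_hom_axioms inv.transcendental]
      rat_eval_coord[OF field_hom_axioms inv.transcendental] by blast+
  have nis: "nisnevich_coordinates \<iota> q ?U ?x"
    unfolding nisnevich_coordinates_def
  proof (intro conjI ballI allI impI)
    show "nonempty_open \<iota> ?U" by (rule infinity_open)
    show "q \<in> ?U" using q xq by blast
    show "?x \<in> sections structure_sheaf ?U" by (auto simp: sections_def structure_sheaf_def)
    show "poly_eval \<iota> a ?x \<noteq> 0" if "a \<noteq> 0" for a using that by (rule inv.transcendental)
    show "generates (cotangent \<iota>) q' (differential \<iota> ?x)" if "q' \<in> ?U" for q'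
      using that by (intro inv.generates_cotangent) (auto simp: closed_points_iff)
    \<comment> \<open>Infinity is a rational point, so constants already represent all
      residues.\<close>
    fix w assume "w \<in> q"
    then obtain c r where "r \<in> q" "w = \<iota> c + ?x * r" using inv.residue_decomposition[OF v z] by blast
    hence "w - rat_eval \<iota> ?x (const_fract c) \<in> max_ideal q"
      using max_ideal_mult_right[OF v z] by (simp add: re)
    thus "\<exists>r\<in>A1_local_ring \<iota> ?x q. w - rat_eval \<iota> ?x r \<in> max_ideal q"
      unfolding R using A1_stalk_const by blast
  qed
  have triv: "compatible_trivialization \<iota> V (standard_bundle (p - 2)) orientation ?U ?x ?v"
    unfolding compatible_trivialization_def
  proof (intro conjI ballI bexI)
    fix q' assume "q' \<in> ?U"
    hence q': "q' \<in> closed_points \<iota>" "?x \<in> q'" by auto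
    hence v': "valuation_ring \<iota> q'" by (simp add: closed_points_iff)
    have g: "generates V q' (smul V (\<tau> ^ ?n) differential_hom)" by (rule twisted_generates_infinity[OF twisted_V q'])
    have "?v = smul V (- 1) (smul V (\<tau> ^ ?n) differential_hom)" by (simp add: frame_mult_smul[OF frame_V Vg, symmetric])
    thus "generates V q' ?v"
      using generates_smul_iff[OF generates_frame[OF frame_V g] v' g, of "- 1"]
        units_minus[OF v' units_1[OF v']] by simp
  next
    show "(\<lambda>z. - (\<tau> ^ 2) * D z) \<in> derivations \<iota>" by (rule derivations_mem)
    show "- (\<tau> ^ 2) * D ?x = 1" by (rule inv.derivation_coordinate)
    \<comment> \<open>\<tau>^(p-2) is the generator of N at infinity and a regular function at the
      other points of the chart.\<close>
    have "\<tau> ^ (p - 2) \<in> stalk (standard_bundle (p - 2)) q'" if q': "q' \<in> ?U" for q'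
    proof (cases "\<tau> \<in> q'")
      case True
      thus ?thesis using q' valuation_ring_power[of \<iota> q' \<tau>]
        by (simp add: standard_bundle_def closed_points_iff)
    next
      case False
      have "\<tau> ^ (p - 2) * 1 \<in> {\<tau> ^ (p - 2) * a | a. a \<in> q'}"
        using q' valuation_ring_1 by (auto simp: closed_points_iff)
      thus ?thesis using False by (simp add: standard_bundle_def)
    qed
    thus "\<tau> ^ (p - 2) \<in> sections (standard_bundle (p - 2)) ?U" by (simp add: sections_def)
    have "hom_map id (tangent \<iota>) D V differential_hom (smul (tangent \<iota>) (- (\<tau> ^ 2)) D) = smul V (- (\<tau> ^ 2)) differential_hom"
      using hom_map_frame[OF field_hom_id frame_tangent frame_V] by simp
    hence "orientation (\<tau> ^ (p - 2)) (\<tau> ^ (p - 2)) (smul (tangent \<iota>) (- (\<tau> ^ 2)) D) =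
        smul V (\<tau> ^ (p - 2) * \<tau> ^ (p - 2) * - (\<tau> ^ 2)) differential_hom"
      by (simp only: hom_bundle_def smul_hom_pullback frame_mult_smul[OF frame_V Vg, symmetric])
    also have "\<tau> ^ (p - 2) * \<tau> ^ (p - 2) * - (\<tau> ^ 2) = - (\<tau> ^ ?n)"
      unfolding p_arith(1) by (simp add: mult_2 power_add power2_eq_square)
    also have "smul (tangent \<iota>) (- (\<tau> ^ 2)) D = (\<lambda>z. - (\<tau> ^ 2) * D z)" by (simp add: tangent_def)
    finally show "orientation (\<tau> ^ (p - 2)) (\<tau> ^ (p - 2)) (\<lambda>z. - (\<tau> ^ 2) * D z) = ?v" .
  qed
  have "?\<sigma> = smul V (?x ^ ?n) ?v"
    using power_inverse_cancel[of ?n] by (simp add: frame_mult_smul[OF frame_V Vg, symmetric])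
  moreover have "?x ^ ?n \<in> q" by (rule valuation_ring_power[OF v xq])
  moreover have "0 \<in> ideal_power q (2 * ?n)"
    unfolding inv.ideal_power_principal[OF v z] using valuation_ring_0[OF v] by force
  moreover have "(coord_fract :: 'l poly fract) ^ ?n \<in> A1_local_ring \<iota> ?x q"
    unfolding R using A1_stalk_coord_power[of 0 ?n] by (simp add: coord_fract_def)
  moreover have "?x ^ ?n + 0 = rat_eval \<iota> ?x (coord_fract ^ ?n)"
  proof -
    interpret re: field_hom "rat_eval \<iota> ?x" by (rule re(1))
    show ?thesis by (simp add: re.hom_power re(3))
  qed
  ultimately show ?thesis
    using order nis triv \<gamma> unfolding is_local_index_def R[symmetric] by blast
qed

lemma local_index_infinity:
  assumes q: "q \<in> closed_points \<iota>" and z: "inverse \<tau> \<in> max_ideal q" and two: "(2::'l) \<noteq> 0"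
  shows "local_index \<iota> V (standard_bundle (p - 2)) orientation (smul V (- 1) differential_hom) q
    = zmult (int (p - 1)) gw_hyp"
proof -
  let ?ind = "is_local_index \<iota> V (standard_bundle (p - 2)) orientation (smul V (- 1) differential_hom) q"
  have v: "valuation_ring \<iota> q" using q by (simp add: closed_points_iff)
  let ?e = "smul V (\<tau> ^ (2 * p - 2)) differential_hom"
  have e: "generates V q ?e" using twisted_V q z by (simp add: twisted_def)
  have "smul V (- 1) differential_hom = smul V (inverse \<tau> ^ (2 * (p - 1)) * - 1) ?e"
    using power_inverse_cancel[of "2 * (p - 1)"] unfolding p_arith(2)
    by (simp add: frame_mult_smul[OF frame_V frame_gen[OF frame_V], symmetric])
  hence unique: "\<gamma> = zmult (int (p - 1)) gw_hyp" if "?ind \<gamma>" for \<gamma>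
    by (rule inv.local_index_even[OF v z two generates_frame[OF frame_V e] e
          units_minus[OF v units_1[OF v]] _ that])
  obtain \<gamma> where "bezout_gw_class (A1_stalk 0) ((coord_fract :: 'l poly fract) ^ (2 * p - 2)) \<gamma>"
    using bezout_gw_class_power[of "2 * p - 2"] p_ge_3 by auto
  hence \<gamma>: "?ind \<gamma>" by (rule is_local_index_infinity[OF q z])
  hence "local_index \<iota> V (standard_bundle (p - 2)) orientation (smul V (- 1) differential_hom) q = \<gamma>"
    unfolding local_index_def using unique by (intro the_equality) blast+
  thus ?thesis using unique[OF \<gamma>] by simp
qed

end

theorem proposition3p2:
  fixes p :: nat
    and \<iota> :: "'k::field poly fract \<Rightarrow> 'k poly fract poly fract"
    and y :: "'k poly fract poly fract"
    and fs :: "'k poly fract poly fract \<Rightarrow> 'k poly fract poly fract"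
    and d :: nat
  assumes "CHAR('k) = p" and "odd p"
    and "\<iota> = const_fract" and "y = coord_fract"
    and "fs = P1_comorphism (y ^ p - y)"
    and "d = morphism_degree fs"
    and "V = hom_cotangent \<iota> \<iota> fs"
    and "df = pullback_differential \<iota> \<iota> fs"
  shows "\<exists>(N :: ('k poly fract poly fract, 'k poly fract poly fract) vsheaf) \<mu>.
           relative_orientation \<iota> V N \<mu> \<and>
           local_index \<iota> V N \<mu> df infinity_P1 = zmult (int p - 1) gw_hyp \<and>
           euler_A1 \<iota> = zmult (int d) (euler_A1 \<iota>)
             - (\<Sum>q\<in>zeros \<iota> V df. local_index \<iota> V N \<mu> df q)"
proof -
  interpret C: field_hom "const_fract :: 'k \<Rightarrow> _" by (rule field_hom_const_fract)
  have const: "of_nat n = const_fract (of_nat n :: 'k)" for n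
    by (induction n) (simp_all add: C.hom_add)
  have "of_nat p = (0 :: 'k)" using assms(1) by (metis of_nat_CHAR)
  hence char: "of_nat p = (0 :: 'k poly fract)" using const[of p] by simp
  obtain k where k: "p = 2 * k + 1" using assms(2) by (auto elim: oddE)
  \<comment> \<open>As p is odd, 2 = 0 would make the image of p equal to 1, while it is 0.\<close>
  have two: "(2 :: 'k poly fract) \<noteq> 0"
  proof
    assume "(2 :: 'k poly fract) = 0"
    hence "of_nat p = (1 :: 'k poly fract)" by (simp add: k)
    thus False using char by simp
  qed
  \<comment> \<open>An odd p is not 0, so characteristic zero does not occur; with p = 1 excluded as
    well, 3 is the least possible value.\<close>
  have "p \<noteq> 1" using char by auto
  hence p3: "3 \<le> p" using k by auto
  interpret artin_schreier \<iota> y fract_deriv fs p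
    unfolding assms(3-5) by (rule artin_schreier_P1[OF char p3])
  have inf: "infinity_P1 \<in> closed_points \<iota>" "inverse y \<in> max_ideal infinity_P1"
    unfolding assms(3,4) by (rule infinity_P1_closed_point, rule inverse_coord_infinity)
  interpret inv: rational_function_field \<iota> "inverse y" "\<lambda>z. - (y ^ 2) * fract_deriv z"
    by (rule inverse_coordinate)
  have df: "df = smul V (- 1) differential_hom" unfolding assms(7,8) by (rule pullback_differential_eq)
  \<comment> \<open>The abstract description of the zeros by vanishing of 1/y determines a single
    valuation ring, which is \<open>infinity_P1\<close>.\<close>
  have zeros: "zeros \<iota> V df = {infinity_P1}"
    using inf inv.valuation_ring_unique zeros_pullback_differential
    unfolding df assms(7) by (auto simp: closed_points_iff)
  have ind: "local_index \<iota> V (standard_bundle (p - 2)) orientation df infinity_P1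
      = zmult (int (p - 1)) gw_hyp"
    using local_index_infinity[OF inf two] unfolding df assms(7) .
  have d: "d = Suc (p - 1)" using degree_eq p3 unfolding assms(6) by simp
  have "zmult (int d) gw_hyp - zmult (int (p - 1)) gw_hyp = (gw_hyp :: 'k poly fract gw)"
    unfolding d zmult_of_nat by simp
  moreover have "int (p - 1) = int p - 1" using p3 by simp
  ultimately show ?thesis
    using relative_orientation_V ind zeros unfolding assms(7) euler_A1_eq
    by (intro exI[of _ "standard_bundle (p - 2)"] exI[of _ orientation]) simp
qed

end
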